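(* Let $d,m\ge 1$ be integers and let $p_{\mathbf x},p_{\mathbf y}$ be the laws of two zero-mean Gaussian stationary random fields $\mathbf x=\{\mathbf x_{\mathbf t},\ \mathbf t\in\mathbb Z^d\}$ and $\mathbf y=\{\mathbf y_{\mathbf t},\ \mathbf t\in\mathbb Z^d\}$ with values in $\mathbb R^m$, whose power spectral densities $\Phi_{\mathbf x},\Phi_{\mathbf y}$ belong to $\mathcal S_m^+(\mathbb T^d)$ (bounded and coercive). Let $\mathbf h=\{H_{\mathbf t},\ \mathbf t\in\mathbb Z^d\}$ with $H_{\mathbf t}\in\mathbb R^{m\times m}$ be absolutely summable, let $H(e^{j\boldsymbol\vartheta})=\sum_{\mathbf t\in\mathbb Z^d}H_{\mathbf t}e^{-j\langle\boldsymbol\vartheta,\mathbf t\rangle}$, and let $\Omega(e^{j\boldsymbol\vartheta})=H(e^{j\boldsymbol\vartheta})^*H(e^{j\boldsymbol\vartheta})$. Let $$d_\Omega(p_{\mathbf x},p_{\mathbf y})^2:=\inf_{p_{\mathbf x,\mathbf y}}\ \mathbb E\big[\|(\mathbf h\star(\mathbf x-\mathbf y))_{\mathbf t}\|^2\big],$$ where the infimum is over all jointly Gaussian, jointly stationary, zero-mean laws $p_{\mathbf x,\mathbf y}$ of the pair $(\mathbf x,\mathbf y)$ whose marginals are $p_{\mathbf x}$ and $p_{\mathbf y}$. Then $$d_\Omega(p_{\mathbf x},p_{\mathbf y})^2=\operatorname{tr}\int_{\mathbb T^d}\Big(\Omega\Phi_{\mathbf x}+\Omega\Phi_{\mathbf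 y}-2\big(\Phi_{\mathbf y}^{1/2}\,\Omega\,\Phi_{\mathbf x}\,\Omega\,\Phi_{\mathbf y}^{1/2}\big)^{1/2}\Big)\,\mathrm d\mu,$$ that is, $d_\Omega(p_{\mathbf x},p_{\mathbf y})$ is the weighted Hellinger distance between $\Phi_{\mathbf x}$ and $\Phi_{\mathbf y}$ with weight function $\Omega$.
   Context: Notation: $\mathbb T^d=[0,2\pi]^d$; $\mathrm d\mu(\boldsymbol\vartheta)=\frac{1}{(2\pi)^d}\prod_{k=1}^d \mathrm d\vartheta_k$ is the normalized Lebesgue measure on $\mathbb T^d$; $j$ is the imaginary unit; $\|\cdot\|$ is the Euclidean norm; $A^*$ is the conjugate transpose; $A^{1/2}$ is the Hermitian positive semidefinite square root of a positive semidefinite Hermitian matrix $A$; all operations on spectral densities are pointwise in $\boldsymbol\vartheta$. The symbol $\star$ is discrete convolution: $(\mathbf h\star\mathbf z)_{\mathbf t}=\sum_{\mathbf s\in\mathbb Z^d}H_{\mathbf t-\mathbf s}\mathbf z_{\mathbf s}$. A zero-mean stationary random field $\mathbf z=\{\mathbf z_{\mathbf t}\}_{\mathbf t\in\mathbb Z^d}$ with values in $\mathbb R^n$ has covariance field $R_{\mathbf t}=\mathbb E[\mathbf z_{\mathbf t+\mathbf s}\mathbf z_{\mathbf s}^T]$ (independent of $\mathbf s$), and its power spectral density is $\Phi(e^{j\boldsymbol\vartheta})=\sum_{\mathbf t\in\mathbb Z^d}R_{\mathbf t}e^{-j\langle\boldsymbol\vartheta,\mathbf t\rangle}$, i.e.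 the Hermitian positive semidefinite matrix function on $\mathbb T^d$ whose Fourier coefficients are the $R_{\mathbf t}$. $\mathcal S_m^+(\mathbb T^d)$ is the set of $m\times m$ power spectral densities $\Phi$ that are bounded and coercive, i.e. there are constants $0<c\le C<\infty$ with $cI\le\Phi(e^{j\boldsymbol\vartheta})\le CI$ for (almost) all $\boldsymbol\vartheta$. Since the fields are zero-mean Gaussian, a law is determined by its finite-dimensional distributions at pairs of indices, equivalently by its covariance field. The joint law $p_{\mathbf x,\mathbf y}$ is the law of the $\mathbb R^{2m}$-valued zero-mean stationary Gaussian field $[\mathbf x_{\mathbf t}^T\ \mathbf y_{\mathbf t}^T]^T$, and the marginal constraints say that the law of its $\mathbf x$-component is $p_{\mathbf x}$ and that of its $\mathbf y$-component is $p_{\mathbf y}$. By stationarity the cost does not depend on $\mathbf t$. *)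

theory Defs
  imports "HOL-Probability.Probability"
begin

(* The law of a random field indexed by Z^d with values in R^n is a measure on paths
   "int ^ 'd \<Rightarrow> real ^ 'n". *)

definition path_space :: "(int ^ 'd \<Rightarrow> real ^ 'n) measure" where
  "path_space = (\<Pi>\<^sub>M t\<in>UNIV. borel)"

(* Point masses are included: a jointly Gaussian field may be degenerate, for instance when one
   component is a linear filtering of the other. *)

definition gaussian_distribution :: "real measure \<Rightarrow> bool" where
  "gaussian_distribution \<mu> \<longleftrightarrow>
     (\<exists>a. \<mu> = return borel a) \<or>
     (\<exists>a \<sigma>. 0 < \<sigma> \<and> \<mu> = density lborel (\<lambda>x. ennreal (normal_density a \<sigma> x)))"

definition gaussian_field :: "(int ^ 'd \<Rightarrow> real ^ 'n) measure \<Rightarrow> bool" where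
  "gaussian_field P \<longleftrightarrow>
     (\<forall>T a. finite T \<longrightarrow> gaussian_distribution (distr P borel (\<lambda>z. \<Sum>t\<in>T. a t \<bullet> z t)))"

definition zero_mean_field :: "(int ^ 'd \<Rightarrow> real ^ 'n) measure \<Rightarrow> bool" where
  "zero_mean_field P \<longleftrightarrow> (\<forall>t. integrable P (\<lambda>z. z t) \<and> (LINT z|P. z t) = 0)"

(* E[z_s z_t^T], for zero-mean fields *)
definition covariance ::
  "(int ^ 'd \<Rightarrow> real ^ 'n) measure \<Rightarrow> int ^ 'd \<Rightarrow> int ^ 'd \<Rightarrow> real ^ 'n ^ 'n" where
  "covariance P s t = (\<chi> i j. LINT z|P. z s $ i * z t $ j)"

(* Second-order stationarity; for a zero-mean Gaussian field this is the same as invariance of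
   the law under shifts. *)
definition stationary_field :: "(int ^ 'd \<Rightarrow> real ^ 'n) measure \<Rightarrow> bool" where
  "stationary_field P \<longleftrightarrow> (\<forall>t s s'. covariance P (t + s) s = covariance P (t + s') s')"

definition gaussian_stationary_law :: "(int ^ 'd \<Rightarrow> real ^ 'n) measure \<Rightarrow> bool" where
  "gaussian_stationary_law P \<longleftrightarrow>
     prob_space P \<and> sets P = sets path_space \<and>
     gaussian_field P \<and> zero_mean_field P \<and> stationary_field P"

definition torus_measure :: "(real ^ 'd) measure" where
  "torus_measure =
     density (lebesgue_on (cbox 0 (\<chi> k. 2 * pi))) (\<lambda>_. ennreal (1 / (2 * pi) ^ CARD('d)))"

definition pairing :: "real ^ 'd \<Rightarrow> int ^ 'd \<Rightarrow> real" where
  "pairing \<theta> t = (\<Sum>k\<in>UNIV. \<theta> $ k * of_int (t $ k))"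

definition conj_transpose :: "complex ^ 'm ^ 'n \<Rightarrow> complex ^ 'n ^ 'm" where
  "conj_transpose A = (\<chi> i j. cnj (A $ j $ i))"

definition psd :: "complex ^ 'n ^ 'n \<Rightarrow> bool" where
  "psd A \<longleftrightarrow> conj_transpose A = A \<and>
     (\<forall>v. 0 \<le> Re (\<Sum>i\<in>UNIV. cnj (v $ i) * (A *v v) $ i))"

definition psd_sqrt :: "complex ^ 'n ^ 'n \<Rightarrow> complex ^ 'n ^ 'n" where
  "psd_sqrt A = (THE B. psd B \<and> B ** B = A)"

(* A function on the torus is written as a function of the angle \<theta>. Spectral densities matter
   only up to null sets; the inversion formula R_t = \<integral> \<Phi> e^{j<\<theta>,t>} d\<mu> says that the Fourier
   series of \<Phi> is \<Sum> R_t e^{-j<\<theta>,t>}. *)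
definition spectral_density ::
  "(int ^ 'd \<Rightarrow> real ^ 'n) measure \<Rightarrow> (real ^ 'd \<Rightarrow> complex ^ 'n ^ 'n) \<Rightarrow> bool" where
  "spectral_density P \<Phi> \<longleftrightarrow>
     integrable torus_measure \<Phi> \<and>
     (AE \<theta> in torus_measure. psd (\<Phi> \<theta>)) \<and>
     (\<forall>t i j. complex_of_real (covariance P t 0 $ i $ j) =
        (LINT \<theta>|torus_measure. \<Phi> \<theta> $ i $ j * cis (pairing \<theta> t)))"

definition bounded_coercive :: "(real ^ 'd \<Rightarrow> complex ^ 'n ^ 'n) \<Rightarrow> bool" where
  "bounded_coercive \<Phi> \<longleftrightarrow>
     (\<exists>c C. 0 < c \<and> c \<le> C \<and>
        (AE \<theta> in torus_measure.
           psd (\<Phi> \<theta> - mat (complex_of_real c)) \<and> psd (mat (complex_of_real C) - \<Phi> \<theta>)))"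

definition transfer_function ::
  "(int ^ 'd \<Rightarrow> real ^ 'm ^ 'm) \<Rightarrow> real ^ 'd \<Rightarrow> complex ^ 'm ^ 'm" where
  "transfer_function H \<theta> =
     (\<chi> i j. \<Sum>\<^sub>\<infinity>t\<in>UNIV. complex_of_real (H t $ i $ j) * cis (- pairing \<theta> t))"

definition weight :: "(int ^ 'd \<Rightarrow> real ^ 'm ^ 'm) \<Rightarrow> real ^ 'd \<Rightarrow> complex ^ 'm ^ 'm" where
  "weight H \<theta> = conj_transpose (transfer_function H \<theta>) ** transfer_function H \<theta>"

(* The joint field takes values in R^{2m}, indexed by the sum type 'm + 'm. *)

definition first_component ::
  "(int ^ 'd \<Rightarrow> real ^ ('m + 'm)) \<Rightarrow> int ^ 'd \<Rightarrow> real ^ 'm" where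
  "first_component z = (\<lambda>t. \<chi> i. z t $ Inl i)"

definition second_component ::
  "(int ^ 'd \<Rightarrow> real ^ ('m + 'm)) \<Rightarrow> int ^ 'd \<Rightarrow> real ^ 'm" where
  "second_component z = (\<lambda>t. \<chi> i. z t $ Inr i)"

definition couplings ::
  "(int ^ 'd \<Rightarrow> real ^ 'm) measure \<Rightarrow> (int ^ 'd \<Rightarrow> real ^ 'm) measure \<Rightarrow>
   (int ^ 'd \<Rightarrow> real ^ ('m + 'm)) measure set" where
  "couplings p q =
     {P. gaussian_stationary_law P \<and>
         distr P path_space first_component = p \<and>
         distr P path_space second_component = q}"

definition convolution ::
  "(int ^ 'd \<Rightarrow> real ^ 'm ^ 'm) \<Rightarrow> (int ^ 'd \<Rightarrow> real ^ 'm) \<Rightarrow> int ^ 'd \<Rightarrow> real ^ 'm" where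
  "convolution H z t = (\<Sum>\<^sub>\<infinity>s\<in>UNIV. H (t - s) *v z s)"

(* For absolutely summable H the series in convolution converges almost surely and the costs are
   finite. By stationarity they do not depend on t, which is kept as a parameter. *)
definition transport_dist ::
  "(int ^ 'd \<Rightarrow> real ^ 'm ^ 'm) \<Rightarrow> int ^ 'd \<Rightarrow>
   (int ^ 'd \<Rightarrow> real ^ 'm) measure \<Rightarrow> (int ^ 'd \<Rightarrow> real ^ 'm) measure \<Rightarrow> real" where
  "transport_dist H t p q =
     sqrt (INF P\<in>couplings p q.
       LINT z|P. (norm (convolution H (\<lambda>s. first_component z s - second_component z s) t))\<^sup>2)"

definition weighted_hellinger_dist ::
  "(real ^ 'd \<Rightarrow> complex ^ 'm ^ 'm) \<Rightarrow> (real ^ 'd \<Rightarrow> complex ^ 'm ^ 'm) \<Rightarrow>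
   (real ^ 'd \<Rightarrow> complex ^ 'm ^ 'm) \<Rightarrow> real" where
  "weighted_hellinger_dist \<Omega> \<Phi> \<Psi> = sqrt (Re (trace (LINT \<theta>|torus_measure.
     \<Omega> \<theta> ** \<Phi> \<theta> + \<Omega> \<theta> ** \<Psi> \<theta>
       - 2 *\<^sub>R psd_sqrt (psd_sqrt (\<Psi> \<theta>) ** \<Omega> \<theta> ** \<Phi> \<theta> ** \<Omega> \<theta> ** psd_sqrt (\<Psi> \<theta>)))))"

end

theory Submission
  imports Defs
begin

text \<open>
  Both bounds compare the cross spectrum \<open>C\<close> of a coupling with the pointwise maximum of
  \<open>Re tr (\<Omega> C)\<close> over all \<open>C\<close> for which the block matrix with rows \<open>(A, C)\<close> and \<open>(C\<^sup>*, B)\<close> is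
  positive semidefinite; with \<open>R = B\<^sup>1\<^sup>/\<^sup>2\<close> that maximum is the fidelity \<open>tr (R \<Omega> A \<Omega> R)\<^sup>1\<^sup>/\<^sup>2\<close>.

  A coupling need not have a cross spectral density, so for the lower bound it is replaced by its
  expected periodograms: these are the Fejer means of the joint covariance, they are positive
  semidefinite at every frequency, and their diagonal blocks converge in mean to the given
  spectral densities. The pointwise bound passes to the limit along an almost everywhere convergent
  subsequence.

  For the upper bound, \<open>A \<Omega> R (S + \<delta>)\<inverse> R\<close> with \<open>S = (R \<Omega> A \<Omega> R)\<^sup>1\<^sup>/\<^sup>2\<close> is an admissible cross
  spectrum that is optimal up to a multiple of \<open>\<delta>\<close>. Its Fourier coefficients complete the two covariance
  fields to a positive semidefinite kernel, which a Cholesky factorization realizes as the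
  covariance of a Gaussian field driven by independent normal variables.
\<close>

text \<open>The fields are real, whereas a near-optimal cross spectrum is a complex matrix function
  whose symmetry under reversal of the frequency would have to be proved. Keeping only real parts of
  Fourier coefficients avoids this: with a real filter the cost sees nothing else, and the real part
  of a Hermitian positive semidefinite kernel is again positive semidefinite.

  The shift by \<delta> is forced by the weight, which may be singular at some frequencies; there S
  has no inverse. It also makes the cross spectrum a continuous, hence measurable, function of its
  data.

  The cost contains an infinite unordered sum inside an expectation. Both bounds evaluate it through
  finite truncations of the filter, where it is a finite combination of covariances, and remove the
  truncation by dominated convergence. In the lower bound the Fejer limit is taken at a fixed
  truncation, so that on the side of the covariances only finitely many weights have to tend to 1.
  Fejer means rather than partial Fourier sums are used because their kernel is nonnegative, which
  gives contraction in the supremum and the mean norm.\<close>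

notation conj_transpose (\<open>_\<^sup>\<dagger>\<close> [1000] 999)

section \<open>Positive semidefinite matrices\<close>

definition cip :: "complex ^ 'n \<Rightarrow> complex ^ 'n \<Rightarrow> complex" where
  "cip v w = (\<Sum>i\<in>UNIV. cnj (v $ i) * w $ i)"

lemma cip_add_left: "cip (u + v) w = cip u w + cip v w"
  and cip_add_right: "cip w (u + v) = cip w u + cip w v"
  and cip_diff_left: "cip (u - v) w = cip u w - cip v w"
  and cip_diff_right: "cip w (u - v) = cip w u - cip w v"
  and cip_scale_left: "cip (c *s u) w = cnj c * cip u w"
  and cip_scale_right: "cip w (c *s u) = c * cip w u"
  and cip_scaleR_right: "cip w (r *\<^sub>R u) = r *\<^sub>R cip w u"
  by (simp_all add: cip_def algebra_simps sum.distrib sum_subtractf sum_distrib_left scaleR_sum_right)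

lemma cip_zero [simp]: "cip 0 w = 0" "cip w 0 = 0"
  by (simp_all add: cip_def)

lemma cip_commute: "cip w v = cnj (cip v w)"
  by (simp add: cip_def mult.commute)

lemma norm_vec_power2: "(norm v)\<^sup>2 = (\<Sum>i\<in>UNIV. (norm (v $ i))\<^sup>2)"
  by (simp add: norm_vec_def L2_set_def sum_nonneg)

lemma cip_self: "cip v v = of_real ((norm v)\<^sup>2)"
  unfolding norm_vec_power2 cip_def of_real_sum complex_norm_square by (simp add: mult.commute)

lemma norm_sum_prod_le:
  fixes v w :: "'a::real_normed_algebra ^ 'n"
  shows "norm (\<Sum>i\<in>UNIV. v $ i * w $ i) \<le> norm v * norm w"
proof -
  have "norm (\<Sum>i\<in>UNIV. v $ i * w $ i) \<le> (\<Sum>i\<in>UNIV. \<bar>norm (v $ i)\<bar> * \<bar>norm (w $ i)\<bar>)"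
    by (rule sum_norm_le) (simp add: norm_mult_ineq)
  also have "\<dots> \<le> norm v * norm w"
    unfolding norm_vec_def by (rule L2_set_mult_ineq)
  finally show ?thesis .
qed

lemma norm_cip_le: "norm (cip v w) \<le> norm v * norm w"
proof -
  have "norm (cip v w) \<le> norm (\<chi> i. cnj (v $ i)) * norm w"
    using norm_sum_prod_le[of "\<chi> i. cnj (v $ i)" w] by (simp add: cip_def)
  also have "norm (\<chi> i. cnj (v $ i)) = norm v" by (simp add: norm_vec_def)
  finally show ?thesis .
qed

lemma norm_matrix_vector_mult_le:
  fixes A :: "'a::real_normed_algebra_1 ^ 'n ^ 'm"
  shows "norm (A *v v) \<le> norm A * norm v"
proof -
  have "norm (A *v v) = L2_set (\<lambda>i. norm ((A *v v) $ i)) UNIV" by (simp add: norm_vec_def)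
  also have "\<dots> \<le> L2_set (\<lambda>i. norm (A $ i) * norm v) UNIV"
    by (rule L2_set_mono) (auto simp: matrix_vector_mult_def intro: norm_sum_prod_le)
  also have "\<dots> = norm A * norm v"
    by (simp add: L2_set_left_distrib norm_vec_def)
  finally show ?thesis .
qed

text \<open>The norm of the matrix type is the Frobenius norm. Its square is the sum of the squared
  column norms, and \<open>A\<close> acts on each column of \<open>B\<close> separately.\<close>

lemma norm_matrix_mult_le:
  fixes A :: "'a::real_normed_algebra_1 ^ 'n ^ 'm" and B :: "'a ^ 'k ^ 'n"
  shows "norm (A ** B) \<le> norm A * norm B"
proof -
  have tr: "(norm B)\<^sup>2 = (\<Sum>j\<in>UNIV. (norm (column j B))\<^sup>2)" for B :: "'a ^ 'k ^ 'l"
    unfolding norm_vec_power2 by (subst sum.swap) (simp add: column_def)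
  have "(norm (A ** B))\<^sup>2 = (\<Sum>j\<in>UNIV. (norm (A *v column j B))\<^sup>2)"
    unfolding tr by (simp add: column_def matrix_matrix_mult_def matrix_vector_mult_def)
  also have "\<dots> \<le> (\<Sum>j\<in>UNIV. (norm A * norm (column j B))\<^sup>2)"
    by (intro sum_mono power_mono norm_matrix_vector_mult_le) simp
  also have "\<dots> = (norm A * norm B)\<^sup>2"
    unfolding power_mult_distrib tr[of B] by (simp add: sum_distrib_left)
  finally show ?thesis by (rule power2_le_imp_le) simp
qed

text \<open>The interpretations \<open>mm\<close> and \<open>mv\<close> of the two products provide
  distributivity, limits and continuity in one stroke; most of the matrix algebra below goes through
  them.\<close>

lemma bounded_bilinear_matrix_mult:
  "bounded_bilinear ((**) :: 'a::real_normed_algebra_1 ^ 'n ^ 'm \<Rightarrow> 'a ^ 'k ^ 'n \<Rightarrow> 'a ^ 'k ^ 'm)"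
proof
  show "\<exists>K. \<forall>a b. norm (a ** b :: 'a ^ 'k ^ 'm) \<le> norm a * norm b * K" for a :: "'a ^ 'n ^ 'm" and b
    by (intro exI[of _ 1]) (simp add: norm_matrix_mult_le)
qed (simp_all add: vec_eq_iff matrix_matrix_mult_def algebra_simps sum.distrib scaleR_sum_right)

interpretation mm: bounded_bilinear "(**) :: 'a::real_normed_algebra_1 ^ 'n ^ 'm \<Rightarrow> 'a ^ 'k ^ 'n \<Rightarrow> 'a ^ 'k ^ 'm"
  by (rule bounded_bilinear_matrix_mult)

lemma bounded_bilinear_matrix_vector_mult:
  "bounded_bilinear ((*v) :: 'a::real_normed_algebra_1 ^ 'n ^ 'm \<Rightarrow> 'a ^ 'n \<Rightarrow> 'a ^ 'm)"
proof
  show "\<exists>K. \<forall>a b. norm (a *v b :: 'a ^ 'm) \<le> norm a * norm b * K" for a :: "'a ^ 'n ^ 'm" and b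
    by (intro exI[of _ 1]) (simp add: norm_matrix_vector_mult_le)
qed (simp_all add: vec_eq_iff matrix_vector_mult_def algebra_simps sum.distrib scaleR_sum_right)

interpretation mv: bounded_bilinear "(*v) :: 'a::real_normed_algebra_1 ^ 'n ^ 'm \<Rightarrow> 'a ^ 'n \<Rightarrow> 'a ^ 'm"
  by (rule bounded_bilinear_matrix_vector_mult)

lemma conj_transpose_nth [simp]: "conj_transpose A $ i $ j = cnj (A $ j $ i)"
  by (simp add: conj_transpose_def)

lemma conj_transpose_conj_transpose [simp]: "(A\<^sup>\<dagger>)\<^sup>\<dagger> = A"
  by (simp add: vec_eq_iff)

lemma conj_transpose_mult: "(A ** B)\<^sup>\<dagger> = B\<^sup>\<dagger> ** A\<^sup>\<dagger>"
  by (simp add: vec_eq_iff matrix_matrix_mult_def mult.commute)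

lemma conj_transpose_linear:
  "(A + B)\<^sup>\<dagger> = A\<^sup>\<dagger> + B\<^sup>\<dagger>" "(A - B)\<^sup>\<dagger> = A\<^sup>\<dagger> - B\<^sup>\<dagger>" "(r *\<^sub>R A)\<^sup>\<dagger> = r *\<^sub>R A\<^sup>\<dagger>" "0\<^sup>\<dagger> = 0" "(- A)\<^sup>\<dagger> = - A\<^sup>\<dagger>"
  by (simp_all add: vec_eq_iff)

lemma conj_transpose_mat [simp]: "(mat (complex_of_real c))\<^sup>\<dagger> = mat (complex_of_real c)"
  "(mat 1 :: complex^'n^'n)\<^sup>\<dagger> = mat 1"
  by (simp_all add: vec_eq_iff mat_def)

lemma norm_conj_transpose [simp]: "norm (A\<^sup>\<dagger>) = norm A"
proof -
  have "(norm (A\<^sup>\<dagger>))\<^sup>2 = (norm A)\<^sup>2"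
    unfolding norm_vec_power2 by (subst sum.swap) simp
  then show ?thesis by simp
qed

lemma bounded_linear_conj_transpose: "bounded_linear conj_transpose"
  by (intro bounded_linear_intro[where K = 1]) (simp_all add: conj_transpose_linear)

lemma bounded_linear_trace: "bounded_linear (trace :: complex ^ 'n ^ 'n \<Rightarrow> complex)"
  unfolding trace_def
  by (intro bounded_linear_sum bounded_linear_compose[OF bounded_linear_vec_nth bounded_linear_vec_nth])

lemma mat_of_real: "(mat (complex_of_real c) :: complex ^ 'n ^ 'n) = c *\<^sub>R mat 1"
  by (simp add: vec_eq_iff mat_def scaleR_conv_of_real[where 'a = complex])

lemma cip_mult_left: "cip (A *v v) w = cip v (A\<^sup>\<dagger> *v w)"
proof -
  have "cip (A *v v) w = (\<Sum>i\<in>UNIV. \<Sum>j\<in>UNIV. cnj (A $ i $ j) * cnj (v $ j) * w $ i)"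
    by (simp add: cip_def matrix_vector_mult_def sum_distrib_right)
  also have "\<dots> = (\<Sum>j\<in>UNIV. \<Sum>i\<in>UNIV. cnj (A $ i $ j) * cnj (v $ j) * w $ i)"
    by (rule sum.swap)
  also have "\<dots> = cip v (A\<^sup>\<dagger> *v w)"
    by (simp add: cip_def matrix_vector_mult_def sum_distrib_left mult_ac)
  finally show ?thesis .
qed

text \<open>Transfers inequalities between forms on vectors to traces: \<open>X\<close> and
  \<open>Y\<close> are tested column by column.\<close>

lemma trace_eq_cip: "trace (X\<^sup>\<dagger> ** A ** Y) = (\<Sum>j\<in>UNIV. cip (column j X) (A *v column j Y))"
  unfolding matrix_mul_assoc[symmetric]
  by (simp add: trace_def cip_def column_def matrix_matrix_mult_def matrix_vector_mult_def)

lemma psd_cip: "psd A \<longleftrightarrow> A\<^sup>\<dagger> = A \<and> (\<forall>v. 0 \<le> Re (cip v (A *v v)))"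
  by (simp add: psd_def cip_def)

lemma psdD: "psd A \<Longrightarrow> A\<^sup>\<dagger> = A" "psd A \<Longrightarrow> 0 \<le> Re (cip v (A *v v))"
  by (simp_all add: psd_cip)

lemma hermitian_cip_real: "A\<^sup>\<dagger> = A \<Longrightarrow> Im (cip v (A *v v)) = 0"
  using cip_mult_left[of A v v] cip_commute[of "A *v v" v] by (simp add: complex_eq_iff)

lemma psd_zero [simp]: "psd 0"
  by (simp add: psd_cip conj_transpose_linear mv.zero_left)

lemma psd_add: "psd A \<Longrightarrow> psd B \<Longrightarrow> psd (A + B)"
  by (simp add: psd_cip conj_transpose_linear mv.add_left cip_add_right)

lemma psd_scaleR: "psd A \<Longrightarrow> 0 \<le> r \<Longrightarrow> psd (r *\<^sub>R A)"
  by (simp add: psd_cip conj_transpose_linear mv.scaleR_left cip_scaleR_right)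

lemma psd_one: "psd (mat 1)"
  by (simp add: psd_cip cip_self)

lemma psd_mat: "0 \<le> c \<Longrightarrow> psd (mat (complex_of_real c))"
  unfolding mat_of_real by (intro psd_scaleR psd_one)

lemma psd_congruence:
  assumes "psd A" shows "psd (X\<^sup>\<dagger> ** A ** X)"
proof -
  have "cip v ((X\<^sup>\<dagger> ** A ** X) *v v) = cip (X *v v) (A *v (X *v v))" for v
    by (simp add: cip_mult_left matrix_vector_mul_assoc matrix_mul_assoc)
  then show ?thesis using assms
    by (simp add: psd_cip conj_transpose_mult matrix_mul_assoc)
qed

lemma psd_conj_transpose_mult: "psd (X\<^sup>\<dagger> ** X)"
  using psd_congruence[OF psd_one, of X] by simp

lemma psd_trace:
  assumes "psd A" shows "0 \<le> Re (trace A)" "Im (trace A) = 0"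
proof -
  have *: "trace A = (\<Sum>j\<in>UNIV. cip (column j (mat 1)) (A *v column j (mat 1)))"
    using trace_eq_cip[of "mat 1" A "mat 1"] by simp
  show "0 \<le> Re (trace A)" unfolding * using assms by (auto simp: psdD intro!: sum_nonneg)
  show "Im (trace A) = 0" unfolding * using hermitian_cip_real[OF psdD(1)[OF assms]] by simp
qed

lemma trace_cyclic: "trace (A ** B ** C) = trace (B ** C ** (A :: complex^'n^'n))"
  using trace_mul_sym[of A "B ** C"] by (simp add: matrix_mul_assoc)

text \<open>The expansion of the form at \<open>v - t A v\<close>, with \<open>t\<close> tending to 0.\<close>

lemma psd_cip_eq_0:
  assumes "psd A" and 0: "Re (cip v (A *v v)) = 0" shows "A *v v = 0"
proof -
  define w where "w = A *v v"
  define a where "a = (norm w)\<^sup>2"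
  define b where "b = Re (cip w (A *v w))"
  have vAw: "cip v (A *v w) = of_real a"
    using cip_mult_left[of A v w] psdD(1)[OF assms(1)] by (simp add: w_def[symmetric] cip_self a_def)
  have wAv: "cip w (A *v v) = of_real a"
    by (simp add: w_def[symmetric] cip_self a_def)
  have "0 \<le> - 2 * t * a + t\<^sup>2 * b" for t :: real
  proof -
    have *: "A *v (v - of_real t *s w) = A *v v - of_real t *s (A *v w)"
      by (simp add: mv.diff_right vector_scalar_commute)
    have e: "cip (v - of_real t *s w) (A *v (v - of_real t *s w)) =
        cip v (A *v v) - of_real t * of_real a - of_real t * (of_real a - of_real t * cip w (A *v w))"
      unfolding * by (simp add: cip_diff_left cip_diff_right cip_scale_left cip_scale_right vAw wAv)
    from psdD(2)[OF assms(1), of "v - of_real t *s w"] show ?thesis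
      unfolding e using 0 by (simp add: b_def power2_eq_square algebra_simps)
  qed
  note q = this
  have b: "0 \<le> b" using psdD(2)[OF assms(1)] by (simp add: b_def)
  have "a \<le> 0"
  proof (rule ccontr)
    assume "\<not> a \<le> 0"
    then have "a > 0" by simp
    \<comment> \<open>The summand 1 covers \<open>b = 0\<close>. With \<open>t * b \<le> a\<close>
      the quadratic term recovers at most half of the loss \<open>2 * t * a\<close>.\<close>
    define t where "t = a / (b + 1)"
    have t: "0 < t" "t * b \<le> a" using \<open>a > 0\<close> b by (auto simp: t_def field_simps)
    have "t\<^sup>2 * b \<le> t * a" using mult_left_mono[OF t(2), of t] t(1) by (simp add: power2_eq_square mult_ac)
    moreover have "0 < t * a" using t(1) \<open>a > 0\<close> by simp
    ultimately show False using q[of t] by simp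
  qed
  then have "a = 0" by (simp add: a_def)
  then show ?thesis by (simp add: a_def w_def)
qed

text \<open>Nonnegativity of the block form at the vector with parts \<open>u\<close> and
  \<open>v\<close>; the off-diagonal blocks are adjoint to each other and together contribute twice
  a real part. In the original dimension, columns of two different matrices can be inserted for
  \<open>u\<close> and \<open>v\<close>.\<close>

definition joint_psd :: "complex ^ 'n ^ 'n \<Rightarrow> complex ^ 'n ^ 'n \<Rightarrow> complex ^ 'n ^ 'n \<Rightarrow> bool" where
  "joint_psd A C B \<longleftrightarrow>
     (\<forall>u v. 0 \<le> Re (cip u (A *v u)) + 2 * Re (cip u (C *v v)) + Re (cip v (B *v v)))"

text \<open>The test vectors are the \<open>i\<close>-th unit vector and \<open>z\<close> times the
  \<open>j\<close>-th, with \<open>z\<close> unimodular and turning the cross term into minus the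
  modulus of the entry. An arithmetic mean of diagonal entries is enough, because the densities have
  a uniform bound on the diagonal.\<close>

lemma joint_psd_norm_entry_le:
  assumes "joint_psd A C B" shows "norm (C $ i $ j) \<le> (Re (A $ i $ i) + Re (B $ j $ j)) / 2"
proof -
  define z where "z = (if C $ i $ j = 0 then 1 else - cnj (C $ i $ j) / norm (C $ i $ j))"
  have z1: "norm z = 1"
    by (simp add: z_def norm_divide)
  have z: "cnj z * z = 1"
    using complex_norm_square[of z] z1 by (simp add: mult.commute)
  have zC: "C $ i $ j * z = - of_real (norm (C $ i $ j))"
    using complex_norm_square[of "C $ i $ j"]
    by (auto simp: z_def power2_eq_square field_simps)
  have ax: "cip (axis k c) (A *v axis l d) = cnj c * A $ k $ l * d" for A :: "complex ^ 'a ^ 'a" and k l c d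
    by (simp add: cip_def matrix_vector_mult_def axis_def if_distrib[of "\<lambda>x. x * _"]
        if_distrib[of "\<lambda>x. _ * x"] if_distrib[of cnj] cong: if_cong)
  have e: "cip (axis i 1) (A *v axis i 1) = A $ i $ i" "cip (axis i 1) (C *v axis j z) = C $ i $ j * z"
    "cip (axis j z) (B *v axis j z) = B $ j $ j"
    using z by (simp_all add: ax mult_ac)
  show ?thesis
    using assms[unfolded joint_psd_def, rule_format, of "axis i 1" "axis j z"]
    unfolding e zC by simp
qed

text \<open>A positive semidefinite matrix may stand in all three places of
  \<open>joint_psd\<close>: the block form at \<open>u\<close> and \<open>v\<close> is then its own
  form at \<open>u + v\<close>.\<close>

lemma norm_entry_le_psd:
  assumes "psd A" shows "norm (A $ i $ j) \<le> (Re (A $ i $ i) + Re (A $ j $ j)) / 2"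
proof (rule joint_psd_norm_entry_le)
  have "Re (cip v (A *v u)) = Re (cip u (A *v v))" for u v
    using cip_mult_left[of A u v] cip_commute[of v "A *v u"] psdD(1)[OF assms] by simp
  then have "Re (cip (u + v) (A *v (u + v))) =
      Re (cip u (A *v u)) + 2 * Re (cip u (A *v v)) + Re (cip v (A *v v))" for u v
    by (simp add: mv.add_right cip_add_left cip_add_right)
  then show "joint_psd A A A"
    unfolding joint_psd_def using psdD(2)[OF assms] by metis
qed

lemma psd_diag_nonneg: "psd A \<Longrightarrow> 0 \<le> Re (A $ i $ i)"
  using order_trans[OF norm_ge_zero norm_entry_le_psd[of A i i]] by simp

lemma norm_entry_le_trace:
  assumes "psd A" shows "norm (A $ i $ j) \<le> Re (trace A)"
proof -
  have "Re (A $ k $ k) \<le> Re (trace A)" for k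
    unfolding trace_def Re_sum by (rule member_le_sum) (auto simp: psd_diag_nonneg assms)
  from this[of i] this[of j] show ?thesis using norm_entry_le_psd[OF assms, of i j] by simp
qed

lemma norm_matrix_le_sum: "norm (A::'a::real_normed_vector^'n^'m) \<le> (\<Sum>i\<in>UNIV. \<Sum>j\<in>UNIV. norm (A $ i $ j))"
proof -
  have "norm A \<le> (\<Sum>i\<in>UNIV. norm (A $ i))"
    by (simp add: norm_vec_def L2_set_le_sum)
  also have "\<dots> \<le> (\<Sum>i\<in>UNIV. \<Sum>j\<in>UNIV. norm (A $ i $ j))"
    by (intro sum_mono) (simp add: norm_vec_def L2_set_le_sum)
  finally show ?thesis .
qed

lemma norm_le_trace:
  fixes A :: "complex ^ 'n ^ 'n"
  assumes "psd A" shows "norm A \<le> (real CARD('n))\<^sup>2 * Re (trace A)"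
proof -
  have "norm A \<le> (\<Sum>i\<in>(UNIV::'n set). \<Sum>j\<in>(UNIV::'n set). Re (trace A))"
    by (rule order_trans[OF norm_matrix_le_sum]) (intro sum_mono norm_entry_le_trace assms)
  then show ?thesis by (simp add: power2_eq_square)
qed

lemma closed_psd: "closed {A. psd A}"
proof -
  have "{A. psd A} = {A. A\<^sup>\<dagger> = A} \<inter> (\<Inter>v. {A. 0 \<le> Re (cip v (A *v v))})"
    by (auto simp: psd_cip)
  also have "closed \<dots>"
    unfolding cip_def
    by (intro closed_Int closed_INT ballI closed_Collect_le closed_Collect_eq continuous_intros
        linear_continuous_on[OF bounded_linear_conj_transpose] mv.continuous_on)
  finally show ?thesis .
qed

lemma tendsto_psd: "X \<longlonglongrightarrow> A \<Longrightarrow> (\<And>n. psd (X n)) \<Longrightarrow> psd A"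
  using closed_sequentially[OF closed_psd, of X A] by auto

section \<open>Square roots: existence, uniqueness and continuity\<close>

lemma trace_conj_transpose_mult: "trace (X\<^sup>\<dagger> ** X) = of_real ((norm X)\<^sup>2)"
proof -
  have "trace (X\<^sup>\<dagger> ** X) = (\<Sum>j\<in>UNIV. \<Sum>i\<in>UNIV. of_real ((norm (X $ i $ j))\<^sup>2))"
    unfolding complex_norm_square by (simp add: trace_def matrix_matrix_mult_def mult.commute)
  also have "\<dots> = of_real ((norm X)\<^sup>2)"
    unfolding norm_vec_power2 of_real_sum by (rule sum.swap)
  finally show ?thesis .
qed

text \<open>Replaces the spectral theorem: polynomials in one matrix with nonnegative coefficients
  commute, are closed under products, and are positive semidefinite if that matrix is.\<close>

inductive_set nonneg_poly :: "complex ^ 'n ^ 'n \<Rightarrow> (complex ^ 'n ^ 'n) set" for X where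
  zero: "0 \<in> nonneg_poly X"
| one: "mat 1 \<in> nonneg_poly X"
| mult: "p \<in> nonneg_poly X \<Longrightarrow> X ** p \<in> nonneg_poly X"
| add: "p \<in> nonneg_poly X \<Longrightarrow> q \<in> nonneg_poly X \<Longrightarrow> p + q \<in> nonneg_poly X"
| scale: "p \<in> nonneg_poly X \<Longrightarrow> 0 \<le> r \<Longrightarrow> r *\<^sub>R p \<in> nonneg_poly X"

lemma nonneg_poly_commute_base: "p \<in> nonneg_poly X \<Longrightarrow> X ** p = p ** X"
  by (induction rule: nonneg_poly.induct)
    (simp_all add: mm.add_left mm.add_right mm.scaleR_left mm.scaleR_right matrix_mul_assoc)

lemma nonneg_poly_commute:
  "p \<in> nonneg_poly X \<Longrightarrow> q \<in> nonneg_poly X \<Longrightarrow> p ** q = q ** p"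
proof (induction rule: nonneg_poly.induct)
  case (mult p)
  then have "X ** p ** q = X ** q ** p" by (simp add: matrix_mul_assoc[symmetric])
  then show ?case using nonneg_poly_commute_base[OF mult.prems] by (simp add: matrix_mul_assoc)
qed (simp_all add: mm.add_left mm.add_right mm.scaleR_left mm.scaleR_right)

lemma nonneg_poly_mult:
  "p \<in> nonneg_poly X \<Longrightarrow> q \<in> nonneg_poly X \<Longrightarrow> p ** q \<in> nonneg_poly X"
  by (induction rule: nonneg_poly.induct)
    (simp_all add: mm.add_left mm.scaleR_left matrix_mul_assoc[symmetric] nonneg_poly.intros)

text \<open>Both claims are carried through the induction: multiplication by \<open>X\<close> asks
  for positivity of \<open>X ** X ** p\<close>, which by commutation is the congruence of
  \<open>p\<close> by \<open>X\<close>.\<close>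

lemma psd_nonneg_poly:
  assumes X: "psd X" and "p \<in> nonneg_poly X" shows "psd p" "psd (X ** p)"
proof -
  have "psd p \<and> psd (X ** p)" using assms(2)
  proof (induction rule: nonneg_poly.induct)
    case (mult p)
    then have "psd (X\<^sup>\<dagger> ** p ** X)" by (intro psd_congruence) simp
    then show ?case
      using mult nonneg_poly_commute_base[OF mult.hyps] psdD(1)[OF X] by (simp add: matrix_mul_assoc)
  qed (use X in \<open>simp_all add: mm.add_right mm.scaleR_right psd_add psd_scaleR psd_one\<close>)
  then show "psd p" "psd (X ** p)" by auto
qed

text \<open>A fixed point \<open>Y\<close> satisfies \<open>2 *\<^sub>R Y = X + Y ** Y\<close>, so
  \<open>mat 1 - Y\<close> is a square root of \<open>mat 1 - X\<close>. The power series of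
  \<open>1 - sqrt (1 - x)\<close> has nonnegative coefficients, in accordance with the iterates
  lying in \<open>nonneg_poly X\<close>.\<close>

primrec sqrt_iter :: "complex ^ 'n ^ 'n \<Rightarrow> nat \<Rightarrow> complex ^ 'n ^ 'n" where
  "sqrt_iter X 0 = 0"
| "sqrt_iter X (Suc n) = (1/2) *\<^sub>R (X + sqrt_iter X n ** sqrt_iter X n)"

lemma sqrt_iter_nonneg_poly: "sqrt_iter X n \<in> nonneg_poly X"
proof (induction n)
  case (Suc n)
  have "X \<in> nonneg_poly X" using nonneg_poly.mult[OF nonneg_poly.one, of X] by simp
  with Suc show ?case by (auto intro!: nonneg_poly.intros nonneg_poly_mult)
qed (simp add: nonneg_poly.zero)

text \<open>Squaring does not preserve the order of positive semidefinite matrices, so monotonicity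
  is not inherited directly. Since the iterates commute, an increment factors as half of
  \<open>(Z - Y) ** (Z + Y)\<close>, a product of polynomials with nonnegative coefficients.\<close>

lemma sqrt_iter_step: "sqrt_iter X (Suc n) - sqrt_iter X n \<in> nonneg_poly X"
proof (induction n)
  case 0
  have "X \<in> nonneg_poly X" using nonneg_poly.mult[OF nonneg_poly.one, of X] by simp
  then show ?case by (auto intro!: nonneg_poly.intros)
next
  case (Suc n)
  define Y Z where "Y = sqrt_iter X n" and "Z = sqrt_iter X (Suc n)"
  have "Y ** Z = Z ** Y"
    unfolding Y_def Z_def by (intro nonneg_poly_commute[of _ X] sqrt_iter_nonneg_poly)
  then have "sqrt_iter X (Suc (Suc n)) - sqrt_iter X (Suc n) = (1/2) *\<^sub>R ((Z - Y) ** (Z + Y))"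
    by (simp add: Y_def[symmetric] Z_def mm.diff_left mm.add_right algebra_simps)
  also have "\<dots> \<in> nonneg_poly X"
    using Suc unfolding Y_def Z_def
    by (intro nonneg_poly.scale nonneg_poly_mult nonneg_poly.add sqrt_iter_nonneg_poly) auto
  finally show ?case .
qed

text \<open>A sum of two congruences, of \<open>Y\<close> by \<open>mat 1 - Y\<close> and of
  \<open>mat 1 - Y\<close> by \<open>Y\<close>; the cubes cancel.\<close>

lemma psd_diff_square:
  assumes "psd Y" "psd (mat 1 - Y)" shows "psd (Y - Y ** Y)"
proof -
  have "Y - Y ** Y = (mat 1 - Y)\<^sup>\<dagger> ** Y ** (mat 1 - Y) + Y\<^sup>\<dagger> ** (mat 1 - Y) ** Y"
    unfolding psdD(1)[OF assms(1)] psdD(1)[OF assms(2)]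
    by (simp add: mm.diff_left mm.diff_right matrix_mul_assoc algebra_simps)
  then show ?thesis using assms by (simp add: psd_add psd_congruence)
qed

lemma psd_one_minus_sqrt_iter:
  assumes "psd X" "psd (mat 1 - X)" shows "psd (mat 1 - sqrt_iter X n)"
proof (induction n)
  case 0
  then show ?case by (simp add: psd_one)
next
  case (Suc n)
  define Y where "Y = sqrt_iter X n"
  have Y: "psd Y" unfolding Y_def by (rule psd_nonneg_poly[OF assms(1) sqrt_iter_nonneg_poly])
  have "mat 1 - sqrt_iter X (Suc n) = (1/2) *\<^sub>R ((mat 1 - X) + ((mat 1 - Y) + (Y - Y ** Y)))"
  proof -
    have "(mat 1 - X) + ((mat 1 - Y) + (Y - Y ** Y)) = (mat 1 + mat 1) - (X + Y ** Y)"
      by (simp add: algebra_simps)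
    then show ?thesis by (simp only: scaleR_diff_right scaleR_half_double sqrt_iter.simps Y_def)
  qed
  also have "psd \<dots>"
    using Suc assms Y unfolding Y_def by (intro psd_scaleR psd_add psd_diff_square) auto
  finally show ?case .
qed

text \<open>The norm of a positive semidefinite difference is controlled by its trace, so a bounded
  increasing sequence of real traces makes the iterates Cauchy. The recursion in the limit then
  shows that \<open>mat 1 - Z\<close> is the root.\<close>

lemma psd_sqrt_exists_contraction:
  fixes A :: "complex ^ 'n ^ 'n"
  assumes "psd A" "psd (mat 1 - A)" shows "\<exists>B. psd B \<and> B ** B = A"
proof -
  define X where "X = mat 1 - A"
  have X: "psd X" "psd (mat 1 - X)" using assms by (simp_all add: X_def)
  define Y where "Y = sqrt_iter X"
  define T where "T n = Re (trace (Y n))" for n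
  have psd_diff: "psd (Y n - Y m)" if "m \<le> n" for m n
    using that
  proof (induction rule: dec_induct)
    case (step k)
    have "psd ((Y k - Y m) + (Y (Suc k) - Y k))"
      unfolding Y_def using step.IH psd_nonneg_poly(1)[OF X(1) sqrt_iter_step]
      by (intro psd_add) (simp_all add: Y_def)
    then show ?case by simp
  qed simp
  have T_diff: "Re (trace (Y n - Y m)) = T n - T m" for m n
    by (simp add: T_def trace_sub)
  have "incseq T"
    using psd_trace(1)[OF psd_diff] unfolding T_diff by (auto simp: incseq_def)
  moreover have "T n \<le> real CARD('n)" for n
    using psd_trace(1)[OF psd_one_minus_sqrt_iter[OF X, of n]]
    by (simp add: T_def Y_def trace_sub trace_I)
  ultimately obtain L where "T \<longlonglongrightarrow> L"
    using incseq_convergent[of T "real CARD('n)"] by metis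
  then have "Cauchy T" by (rule LIMSEQ_imp_Cauchy)
  have "Cauchy Y"
  proof (rule metric_CauchyI)
    fix e :: real assume "0 < e"
    then have "0 < e / (real CARD('n))\<^sup>2" by simp
    then obtain M where M: "\<And>m n. m \<ge> M \<Longrightarrow> n \<ge> M \<Longrightarrow> norm (T m - T n) < e / (real CARD('n))\<^sup>2"
      using CauchyD[OF \<open>Cauchy T\<close>] by metis
    have *: "norm (Y m - Y n) < e" if "M \<le> m" "m \<le> n" for m n
    proof -
      have "norm (Y m - Y n) = norm (Y n - Y m)" by (rule norm_minus_commute)
      also have "\<dots> \<le> (real CARD('n))\<^sup>2 * (T n - T m)"
        using norm_le_trace[OF psd_diff[of m n]] that by (simp add: T_diff)
      also have "\<dots> < (real CARD('n))\<^sup>2 * (e / (real CARD('n))\<^sup>2)"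
        using M[of n m] that by (intro mult_strict_left_mono) auto
      finally show ?thesis by simp
    qed
    have "norm (Y m - Y n) < e" if "M \<le> m" "M \<le> n" for m n
      using *[of m n] *[of n m] that by (metis nle_le norm_minus_commute)
    then show "\<exists>M. \<forall>m\<ge>M. \<forall>n\<ge>M. dist (Y m) (Y n) < e" unfolding dist_norm by blast
  qed
  then obtain Z where Z: "Y \<longlonglongrightarrow> Z" by (auto simp: Cauchy_convergent_iff convergent_def)
  have "(\<lambda>n. Y (Suc n)) \<longlonglongrightarrow> (1/2) *\<^sub>R (X + Z ** Z)"
    unfolding Y_def sqrt_iter.simps
    by (intro tendsto_intros mm.tendsto Z[unfolded Y_def])
  then have fp: "Z = (1/2) *\<^sub>R (X + Z ** Z)"
    using LIMSEQ_Suc[OF Z] by (metis LIMSEQ_unique)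
  have "psd (mat 1 - Z)"
    by (rule tendsto_psd[of "\<lambda>n. mat 1 - Y n"])
      (use psd_one_minus_sqrt_iter[OF X] in \<open>auto intro!: tendsto_intros Z simp: Y_def[symmetric]\<close>)
  moreover have "(mat 1 - Z) ** (mat 1 - Z) = A"
  proof -
    have "Z + Z = X + Z ** Z" by (subst (1 2) fp) (simp add: scaleR_add_left[symmetric])
    then show ?thesis
      by (simp add: mm.diff_left mm.diff_right X_def algebra_simps)
  qed
  ultimately show ?thesis by blast
qed

lemma psd_norm_minus: "A\<^sup>\<dagger> = A \<Longrightarrow> psd (mat (complex_of_real (norm A)) - A)"
proof -
  assume A: "A\<^sup>\<dagger> = A"
  have "Re (cip v (A *v v)) \<le> norm A * (norm v)\<^sup>2" for v
  proof -
    have "Re (cip v (A *v v)) \<le> norm v * norm (A *v v)"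
      by (rule order_trans[OF complex_Re_le_cmod norm_cip_le])
    also have "\<dots> \<le> norm v * (norm A * norm v)"
      by (intro mult_left_mono norm_matrix_vector_mult_le) simp
    finally show ?thesis by (simp add: power2_eq_square mult_ac)
  qed
  then show ?thesis
    using A unfolding psd_cip mat_of_real
    by (simp add: conj_transpose_linear mv.diff_left mv.scaleR_left cip_diff_right cip_scaleR_right cip_self)
qed

lemma psd_sqrt_exists:
  assumes "psd A" shows "\<exists>B. psd B \<and> B ** B = A"
proof -
  \<comment> \<open>Division by \<open>c\<close> makes the matrix a contraction; the summand 1 keeps
    \<open>c\<close> positive for the zero matrix.\<close>
  define c where "c = norm A + 1"
  have c: "c > 0" by (simp add: c_def add_nonneg_pos)
  have "psd ((mat (complex_of_real (norm A)) - A) + mat (complex_of_real 1))"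
    using psdD[OF assms] by (intro psd_add psd_norm_minus psd_mat) auto
  also have "(mat (complex_of_real (norm A)) - A) + mat (complex_of_real 1) = c *\<^sub>R mat 1 - A"
    unfolding mat_of_real c_def by (simp add: algebra_simps)
  finally have "psd ((1/c) *\<^sub>R (c *\<^sub>R mat 1 - A))" using c by (intro psd_scaleR) auto
  then have "psd (mat 1 - (1/c) *\<^sub>R A)" using c by (simp add: scaleR_diff_right)
  moreover have "psd ((1/c) *\<^sub>R A)" using c assms by (intro psd_scaleR) auto
  ultimately obtain B where B: "psd B" "B ** B = (1/c) *\<^sub>R A"
    using psd_sqrt_exists_contraction by blast
  then show ?thesis using c
    by (intro exI[of _ "sqrt c *\<^sub>R B"])
      (auto simp: mm.scaleR_left mm.scaleR_right intro!: psd_scaleR)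
qed

lemma psd_trace_0: "psd A \<Longrightarrow> Re (trace A) = 0 \<Longrightarrow> A = 0"
  using norm_le_trace[of A] by simp

lemma psd_congruence_eq_0:
  assumes "psd B" "X\<^sup>\<dagger> ** B ** X = 0" shows "B ** X = 0"
proof -
  have "B *v (X *v v) = 0" for v
  proof (rule psd_cip_eq_0[OF assms(1)])
    show "Re (cip (X *v v) (B *v (X *v v))) = 0"
      using assms(2) by (simp add: cip_mult_left matrix_vector_mul_assoc matrix_mul_assoc mv.zero_left)
  qed
  then show ?thesis by (simp add: matrix_eq matrix_vector_mul_assoc mv.zero_left)
qed

text \<open>With \<open>D = B - C\<close>, equal squares mean \<open>B ** D + D ** C = 0\<close>.
  Multiplying by \<open>D\<close> and taking the trace writes 0 as a sum of two nonnegative traces,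
  which forces \<open>B ** D = 0\<close> and \<open>C ** D = 0\<close>, hence
  \<open>D ** D = 0\<close>.\<close>

lemma psd_square_inj:
  assumes "psd B" "psd C" "B ** B = C ** C" shows "B = C"
proof -
  define D where "D = B - C"
  have D: "D\<^sup>\<dagger> = D" using assms by (simp add: D_def conj_transpose_linear psdD)
  have "B ** D + D ** C = 0"
    using assms(3) by (simp add: D_def mm.diff_left mm.diff_right)
  then have "trace (D ** (B ** D + D ** C)) = 0" by (simp add: trace_0[simplified])
  then have "trace (D ** B ** D) + trace (D ** D ** C) = 0"
    by (simp add: mm.add_right trace_add matrix_mul_assoc)
  then have "trace (D\<^sup>\<dagger> ** B ** D) + trace (D\<^sup>\<dagger> ** C ** D) = 0"
    using trace_cyclic[of D D C] trace_cyclic[of D C D] by (simp add: D)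
  then have "Re (trace (D\<^sup>\<dagger> ** B ** D)) + Re (trace (D\<^sup>\<dagger> ** C ** D)) = 0"
    by (metis plus_complex.sel(1) zero_complex.sel(1))
  moreover have p: "psd (D\<^sup>\<dagger> ** B ** D)" "psd (D\<^sup>\<dagger> ** C ** D)"
    using assms by (simp_all add: psd_congruence)
  ultimately have "Re (trace (D\<^sup>\<dagger> ** B ** D)) = 0" "Re (trace (D\<^sup>\<dagger> ** C ** D)) = 0"
    using psd_trace(1)[OF p(1)] psd_trace(1)[OF p(2)] by linarith+
  then have "B ** D = 0" "C ** D = 0"
    using assms(1,2) psd_congruence_eq_0 psd_trace_0 p by blast+
  then have "D ** D = 0" unfolding D_def mm.diff_left by simp
  then have "of_real ((norm D)\<^sup>2) = (0::complex)"
    using trace_conj_transpose_mult[of D] D by (simp add: trace_0[simplified])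
  then show ?thesis by (simp add: D_def)
qed

lemma psd_sqrt: assumes "psd A" shows "psd (psd_sqrt A)" "psd_sqrt A ** psd_sqrt A = A"
proof -
  have "\<exists>!B. psd B \<and> B ** B = A"
    using psd_sqrt_exists[OF assms] psd_square_inj by blast
  from theI'[OF this] show "psd (psd_sqrt A)" "psd_sqrt A ** psd_sqrt A = A"
    by (simp_all add: psd_sqrt_def)
qed

lemma psd_sqrt_unique: "psd B \<Longrightarrow> B ** B = A \<Longrightarrow> psd_sqrt A = B"
  unfolding psd_sqrt_def by (rule the_equality) (auto intro: psd_square_inj)

lemma norm_psd_sqrt: assumes "psd A" shows "(norm (psd_sqrt A))\<^sup>2 = Re (trace A)"
  using trace_conj_transpose_mult[of "psd_sqrt A"] psd_sqrt[OF assms] by (simp add: psdD)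

lemma norm_trace_le:
  fixes A :: "complex ^ 'n ^ 'n"
  shows "norm (trace A) \<le> real CARD('n) * norm A"
proof -
  have "norm (trace A) \<le> (\<Sum>i\<in>(UNIV::'n set). norm A)"
    unfolding trace_def by (rule sum_norm_le) (meson Finite_Cartesian_Product.norm_nth_le order_trans)
  then show ?thesis by simp
qed

text \<open>Over a bounded set the graph is closed, being cut out by \<open>B ** B = A\<close>, and
  the roots stay in a compact set because the squared norm of a root is a trace. Closed graph and
  compact range give continuity there, and every convergent sequence is bounded.\<close>

lemma continuous_on_psd_sqrt: "continuous_on {A :: complex ^ 'n ^ 'n. psd A} psd_sqrt"
proof -
  have R: "continuous_on {A :: complex ^ 'n ^ 'n. psd A \<and> norm A \<le> R} psd_sqrt" (is "continuous_on ?S _") for R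
  proof (rule continuous_from_closed_graph)
    define K where "K = {B :: complex ^ 'n ^ 'n. psd B \<and> norm B \<le> sqrt (real CARD('n) * R)}"
    have "K = {B. psd B} \<inter> cball 0 (sqrt (real CARD('n) * R))" by (auto simp: K_def dist_norm)
    then show "compact K" using closed_Int_compact[OF closed_psd compact_cball] by metis
    note \<open>compact K\<close>
    show "psd_sqrt \<in> ?S \<rightarrow> K"
    proof
      fix A assume "A \<in> ?S"
      then have A: "psd A" "norm A \<le> R" by auto
      have "(norm (psd_sqrt A))\<^sup>2 \<le> real CARD('n) * R"
        using norm_psd_sqrt[OF A(1)] norm_trace_le[of A] complex_Re_le_cmod[of "trace A"] A(2)
        by (smt (verit) mult_left_mono of_nat_0_le_iff)
      then show "psd_sqrt A \<in> K" using psd_sqrt[OF A(1)] by (simp add: K_def real_le_rsqrt)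
    qed
    have "(\<lambda>x. (x, psd_sqrt x)) ` ?S = {p. snd p ** snd p = fst p} \<inter> (?S \<times> K)"
      using psd_sqrt psd_sqrt_unique \<open>psd_sqrt \<in> ?S \<rightarrow> K\<close> by (force simp: K_def image_iff)
    moreover have "closed {p :: (complex ^ 'n ^ 'n) \<times> (complex ^ 'n ^ 'n). snd p ** snd p = fst p}"
      by (intro closed_Collect_eq continuous_intros mm.continuous_on)
    moreover have "?S = {B. psd B} \<inter> cball 0 R" by (auto simp: dist_norm)
    then have "closed ?S" using closed_Int[OF closed_psd closed_cball] by metis
    ultimately show "closed ((\<lambda>x. (x, psd_sqrt x)) ` ?S)"
      using \<open>compact K\<close> by (simp add: closed_Int closed_Times compact_imp_closed)
  qed
  show ?thesis
    unfolding continuous_on_sequentially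
  proof (intro allI ballI impI, elim conjE)
    fix x and a :: "complex ^ 'n ^ 'n"
    assume a: "a \<in> {A. psd A}" and x: "\<forall>n. x n \<in> {A. psd A}" and lim: "x \<longlonglongrightarrow> a"
    obtain R where R': "\<And>n. norm (x n) \<le> R"
      using convergent_imp_Bseq[of x] lim by (auto simp: convergent_def Bseq_def)
    have "norm a \<le> R" by (rule LIMSEQ_le_const2[OF tendsto_norm[OF lim]]) (use R' in auto)
    with a x lim R' R[of R] show "(psd_sqrt \<circ> x) \<longlonglongrightarrow> psd_sqrt a"
      unfolding continuous_on_sequentially by auto
  qed
qed

section \<open>Fidelity and optimal cross spectra\<close>

lemma trace_scaleR: "trace (r *\<^sub>R A) = complex_of_real r * trace (A :: complex ^ 'n ^ 'n)"
  by (simp add: trace_def sum_distrib_left scaleR_conv_of_real[where 'a = complex])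

lemma joint_psd_trace:
  assumes "joint_psd A C B"
  shows "0 \<le> Re (trace (X\<^sup>\<dagger> ** A ** X)) + 2 * Re (trace (X\<^sup>\<dagger> ** C ** Y)) + Re (trace (Y\<^sup>\<dagger> ** B ** Y))"
proof -
  have "0 \<le> (\<Sum>j\<in>UNIV. Re (cip (column j X) (A *v column j X)) +
      2 * Re (cip (column j X) (C *v column j Y)) + Re (cip (column j Y) (B *v column j Y)))"
    using assms by (intro sum_nonneg) (simp add: joint_psd_def)
  then show ?thesis by (simp add: trace_eq_cip sum.distrib sum_distrib_left)
qed

lemma joint_psd_add_right:
  assumes "joint_psd A C B" "psd D" shows "joint_psd A C (B + D)"
  unfolding joint_psd_def
proof (intro allI)
  fix u v
  show "0 \<le> Re (cip u (A *v u)) + 2 * Re (cip u (C *v v)) + Re (cip v ((B + D) *v v))"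
    using assms(1)[unfolded joint_psd_def, rule_format, of u v] psdD(2)[OF assms(2), of v]
    by (simp add: mv.add_left cip_add_right)
qed

text \<open>A kernel vector \<open>v\<close> of the shifted matrix satisfies
  \<open>\<delta> * (norm v)\<^sup>2 \<le> 0\<close>. The inverse is positive semidefinite as the
  congruence of \<open>S\<close> by that inverse.\<close>

lemma psd_shift_inverse:
  fixes A :: "complex ^ 'n ^ 'n"
  assumes "psd A" "0 < \<delta>"
  defines "S \<equiv> A + \<delta> *\<^sub>R mat 1"
  shows "matrix_inv S ** S = mat 1" "S ** matrix_inv S = mat 1" "psd (matrix_inv S)"
proof -
  have psdS: "psd S" unfolding S_def using assms by (intro psd_add psd_scaleR psd_one) auto
  have "v = 0" if "S *v v = 0" for v
  proof -
    have "0 = Re (cip v (S *v v))" using that by simp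
    also have "\<dots> = Re (cip v (A *v v)) + \<delta> * (norm v)\<^sup>2"
      by (simp add: S_def mv.add_left mv.scaleR_left cip_add_right cip_scaleR_right cip_self)
    finally have "\<delta> * (norm v)\<^sup>2 \<le> 0" using psdD(2)[OF assms(1), of v] by linarith
    then show "v = 0" using \<open>0 < \<delta>\<close> by (simp add: mult_le_0_iff)
  qed
  then have "invertible S"
    by (simp add: invertible_left_inverse matrix_left_invertible_ker)
  then show 1: "matrix_inv S ** S = mat 1" and 2: "S ** matrix_inv S = mat 1"
    using someI_ex[of "\<lambda>B. S ** B = mat 1 \<and> B ** S = mat 1"]
    by (auto simp: matrix_inv_def invertible_def)
  have "(matrix_inv S)\<^sup>\<dagger> ** S = mat 1"
    using arg_cong[OF 2, of conj_transpose] psdD(1)[OF psdS] by (simp add: conj_transpose_mult)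
  then have "(matrix_inv S)\<^sup>\<dagger> = matrix_inv S"
    using 2 by (metis matrix_mul_assoc matrix_mul_lid matrix_mul_rid)
  then have "matrix_inv S = (matrix_inv S)\<^sup>\<dagger> ** S ** matrix_inv S" using 1 by simp
  then show "psd (matrix_inv S)" using psd_congruence[OF psdS] by metis
qed

lemma psd_sqrt_shift_inverse:
  assumes "psd A" "0 < \<delta>"
  obtains T where "T ** psd_sqrt (A + \<delta> *\<^sub>R mat 1) = mat 1" "psd_sqrt (A + \<delta> *\<^sub>R mat 1) ** T = mat 1" "T\<^sup>\<dagger> = T"
proof -
  define R where "R = psd_sqrt (A + \<delta> *\<^sub>R mat 1)"
  define T where "T = matrix_inv (A + \<delta> *\<^sub>R mat 1) ** R"
  have "psd (A + \<delta> *\<^sub>R mat 1)" using assms by (intro psd_add psd_scaleR psd_one) auto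
  note R = psd_sqrt[OF this, folded R_def]
  have TR: "T ** R = mat 1"
    using psd_shift_inverse(1)[OF assms] R(2) by (simp add: T_def matrix_mul_assoc[symmetric])
  then have RT: "R ** T = mat 1" by (simp add: matrix_left_right_inverse)
  have "T\<^sup>\<dagger> ** R = mat 1"
    using arg_cong[OF RT, of conj_transpose] psdD(1)[OF R(1)] by (simp add: conj_transpose_mult)
  then have "T\<^sup>\<dagger> = T"
    using RT by (metis matrix_mul_assoc matrix_mul_lid matrix_mul_rid)
  with TR RT show ?thesis using that unfolding R_def by blast
qed

text \<open>Squaring is not monotone in general; a multiple of the identity commutes with
  \<open>A\<close>, however, and the difference is \<open>2 \<delta> A + \<delta>^2\<close>.\<close>

lemma psd_shift_square_diff:
  assumes "psd A" "0 < \<delta>"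
  shows "psd ((A + \<delta> *\<^sub>R mat 1) ** (A + \<delta> *\<^sub>R mat 1) - A ** A)"
proof -
  have "(A + \<delta> *\<^sub>R mat 1) ** (A + \<delta> *\<^sub>R mat 1) - A ** A = \<delta> *\<^sub>R (A + A) + (\<delta> * \<delta>) *\<^sub>R mat 1"
    by (simp only: mm.add_left mm.add_right mm.scaleR_left mm.scaleR_right matrix_mul_lid matrix_mul_rid
        scaleR_add_right scaleR_scaleR) (simp add: add_ac)
  moreover have "psd \<dots>" using assms by (intro psd_add psd_scaleR psd_one) auto
  ultimately show ?thesis by simp
qed

text \<open>The trace norm of \<open>A^(1/2) \<Omega> B^(1/2)\<close> for Hermitian
  \<open>\<Omega>\<close>. With identity weight it is the term subtracted in the Bures-Wasserstein
  distance of two covariance matrices.\<close>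

definition fidelity :: "complex ^ 'n ^ 'n \<Rightarrow> complex ^ 'n ^ 'n \<Rightarrow> complex ^ 'n ^ 'n \<Rightarrow> real" where
  "fidelity A \<Omega> B = Re (trace (psd_sqrt (psd_sqrt B ** \<Omega> ** A ** \<Omega> ** psd_sqrt B)))"

lemma psd_fidelity_arg:
  assumes "psd A" "\<Omega>\<^sup>\<dagger> = \<Omega>" "psd B"
  shows "psd (psd_sqrt B ** \<Omega> ** A ** \<Omega> ** psd_sqrt B)"
  using psd_congruence[OF assms(1), of "\<Omega> ** psd_sqrt B"] psd_sqrt(1)[OF assms(3)] assms(2)
  by (simp add: conj_transpose_mult psdD matrix_mul_assoc)

text \<open>The joint form is tested on \<open>X = - \<Omega> R Q\<inverse>\<close> and \<open>Y = R\<inverse> Q\<close> with \<open>R = B\<^sup>1\<^sup>/\<^sup>2\<close> and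
  \<open>Q = (S + \<delta>)\<^sup>1\<^sup>/\<^sup>2\<close>, where \<open>S\<close> is the square root in the fidelity, so that
  \<open>Y X\<^sup>* = - \<Omega>\<close> and both diagonal terms are at most \<open>tr (S + \<delta>)\<close>.\<close>

lemma joint_psd_le_fidelity_pos:
  fixes A C B :: "complex ^ 'n ^ 'n"
  assumes A: "psd A" and B0: "psd B0" and "0 < \<epsilon>" and B: "B = B0 + \<epsilon> *\<^sub>R mat 1"
    and \<Omega>: "\<Omega>\<^sup>\<dagger> = \<Omega>" and J: "joint_psd A C B"
  shows "Re (trace (\<Omega> ** C)) \<le> fidelity A \<Omega> B"
proof (rule field_le_epsilon)
  fix e :: real assume "0 < e"
  \<comment> \<open>The shift by \<open>\<delta>\<close> raises the trace of \<open>S\<close> by the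
    dimension times \<open>\<delta>\<close>, that is by \<open>e\<close>.\<close>
  define \<delta> where "\<delta> = e / real CARD('n)"
  have \<delta>: "0 < \<delta>" using \<open>0 < e\<close> by (simp add: \<delta>_def)
  define R where "R = psd_sqrt B"
  have psdB: "psd B" unfolding B using B0 \<open>0 < \<epsilon>\<close> by (intro psd_add psd_scaleR psd_one) auto
  note R = psd_sqrt[OF psdB, folded R_def]
  obtain Ri where Ri: "Ri ** R = mat 1" "R ** Ri = mat 1" "Ri\<^sup>\<dagger> = Ri"
    using psd_sqrt_shift_inverse[OF B0 \<open>0 < \<epsilon>\<close>] unfolding R_def B by metis
  define S where "S = psd_sqrt (R ** \<Omega> ** A ** \<Omega> ** R)"
  have S: "psd S" "S ** S = R ** \<Omega> ** A ** \<Omega> ** R"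
    using psd_sqrt[OF psd_fidelity_arg[OF A \<Omega> psdB]] by (simp_all add: S_def R_def)
  define T where "T = S + \<delta> *\<^sub>R mat 1"
  define Q where "Q = psd_sqrt T"
  have psdT: "psd T" unfolding T_def using S \<delta> by (intro psd_add psd_scaleR psd_one) auto
  note Q = psd_sqrt[OF psdT, folded Q_def]
  obtain Qi where Qi: "Qi ** Q = mat 1" "Q ** Qi = mat 1" "Qi\<^sup>\<dagger> = Qi"
    using psd_sqrt_shift_inverse[OF S(1) \<delta>] unfolding Q_def T_def by metis
  define X where "X = - (\<Omega> ** R ** Qi)"
  define Y where "Y = Ri ** Q"
  have Xt: "X\<^sup>\<dagger> = - (Qi ** R ** \<Omega>)" and Yt: "Y\<^sup>\<dagger> = Q ** Ri"
    using Q R \<Omega> Qi Ri by (simp_all add: X_def Y_def conj_transpose_mult conj_transpose_linear psdD matrix_mul_assoc)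
  have "X\<^sup>\<dagger> ** A ** X = Qi ** (R ** \<Omega> ** A ** \<Omega> ** R) ** Qi"
    unfolding Xt unfolding X_def by (simp add: mm.minus_left mm.minus_right matrix_mul_assoc)
  then have XAX: "X\<^sup>\<dagger> ** A ** X = Qi ** (S ** S) ** Qi" using S by simp
  have "Qi ** (T ** T) ** Qi = (Qi ** Q) ** Q ** Q ** (Q ** Qi)"
    unfolding Q(2)[symmetric] by (simp add: matrix_mul_assoc)
  then have QTQ: "Qi ** (T ** T) ** Qi = T" using Q Qi by simp
  \<comment> \<open>\<open>Qi ** (S ** S) ** Qi\<close> is compared with
    \<open>Qi ** (T ** T) ** Qi\<close>, which is \<open>T\<close> because
    \<open>T = Q ** Q\<close>.\<close>
  have "psd (Qi\<^sup>\<dagger> ** (T ** T - S ** S) ** Qi)"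
    unfolding T_def by (intro psd_congruence psd_shift_square_diff S \<delta>)
  then have "psd (T - X\<^sup>\<dagger> ** A ** X)"
    unfolding Qi(3) XAX mm.diff_left mm.diff_right QTQ .
  then have 1: "Re (trace (X\<^sup>\<dagger> ** A ** X)) \<le> Re (trace T)"
    using psd_trace(1) by (fastforce simp: trace_sub)
  have "X\<^sup>\<dagger> ** C ** Y = - ((Qi ** R) ** (\<Omega> ** C ** Ri ** Q))"
    unfolding Xt Y_def by (simp add: mm.minus_left matrix_mul_assoc)
  moreover have "trace ((Qi ** R) ** (\<Omega> ** C ** Ri ** Q)) = trace (\<Omega> ** C)"
  proof -
    have "trace ((Qi ** R) ** (\<Omega> ** C ** Ri ** Q)) = trace ((\<Omega> ** C ** Ri ** Q) ** (Qi ** R))"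
      by (rule trace_mul_sym)
    also have "(\<Omega> ** C ** Ri ** Q) ** (Qi ** R) = \<Omega> ** C ** (Ri ** (Q ** Qi) ** R)"
      by (simp add: matrix_mul_assoc)
    finally show ?thesis using Ri Qi by simp
  qed
  ultimately have 2: "trace (X\<^sup>\<dagger> ** C ** Y) = - trace (\<Omega> ** C)"
    by (simp add: trace_def sum_negf)
  have "Y\<^sup>\<dagger> ** B ** Y = Q ** (Ri ** R) ** (R ** Ri) ** Q"
    unfolding Yt R(2)[symmetric] unfolding Y_def by (simp add: matrix_mul_assoc)
  then have 3: "Y\<^sup>\<dagger> ** B ** Y = T" using Ri Q by simp
  have "Re (trace (\<Omega> ** C)) \<le> Re (trace T)"
    using joint_psd_trace[OF J, of X Y] 1 unfolding 2 3 by simp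
  also have "trace T = trace S + of_real \<delta> * of_nat CARD('n)"
    by (simp add: T_def trace_add trace_scaleR trace_I)
  also have "Re \<dots> = fidelity A \<Omega> B + e"
    by (simp add: fidelity_def S_def R_def \<delta>_def)
  finally show "Re (trace (\<Omega> ** C)) \<le> fidelity A \<Omega> B + e" .
qed

lemma fidelity_tendsto:
  assumes "(f \<longlongrightarrow> A) F" "(g \<longlongrightarrow> \<Omega>) F" "(h \<longlongrightarrow> B) F"
    and ev: "\<And>x. psd (f x)" "\<And>x. (g x)\<^sup>\<dagger> = g x" "\<And>x. psd (h x)"
    and lim: "psd A" "\<Omega>\<^sup>\<dagger> = \<Omega>" "psd B"
  shows "((\<lambda>x. fidelity (f x) (g x) (h x)) \<longlongrightarrow> fidelity A \<Omega> B) F"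
proof -
  have R: "((\<lambda>x. psd_sqrt (h x)) \<longlongrightarrow> psd_sqrt B) F"
    using assms by (intro continuous_on_tendsto_compose[OF continuous_on_psd_sqrt]) auto
  show ?thesis
    unfolding fidelity_def using assms
    by (intro tendsto_intros bounded_linear.tendsto[OF bounded_linear_trace]
        continuous_on_tendsto_compose[OF continuous_on_psd_sqrt] mm.tendsto R)
      (auto intro!: psd_fidelity_arg always_eventually)
qed

text \<open>The test matrices of the definite case use the inverse of the root of \<open>B\<close>.
  Enlarging \<open>B\<close> by a multiple of the identity preserves the joint form, and the
  fidelity is continuous in \<open>B\<close>.\<close>

lemma joint_psd_le_fidelity:
  fixes A C B :: "complex ^ 'n ^ 'n"
  assumes A: "psd A" and B: "psd B" and \<Omega>: "\<Omega>\<^sup>\<dagger> = \<Omega>" and J: "joint_psd A C B"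
  shows "Re (trace (\<Omega> ** C)) \<le> fidelity A \<Omega> B"
proof (rule LIMSEQ_le_const)
  let ?B = "\<lambda>n::nat. B + inverse (real (Suc n)) *\<^sub>R mat 1"
  have "?B \<longlonglongrightarrow> B + 0 *\<^sub>R mat 1"
    by (intro tendsto_intros LIMSEQ_inverse_real_of_nat)
  then show "(\<lambda>n. fidelity A \<Omega> (?B n)) \<longlonglongrightarrow> fidelity A \<Omega> B"
    using A B \<Omega> by (intro fidelity_tendsto tendsto_const) (auto intro!: psd_add psd_scaleR psd_one)
  have "Re (trace (\<Omega> ** C)) \<le> fidelity A \<Omega> (?B n)" for n
    by (rule joint_psd_le_fidelity_pos[OF A B _ refl \<Omega>])
      (auto intro!: joint_psd_add_right[OF J] psd_scaleR psd_one)
  then show "\<exists>N. \<forall>n\<ge>N. Re (trace (\<Omega> ** C)) \<le> fidelity A \<Omega> (?B n)" by blast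
qed

text \<open>Crude bounds whose purpose is uniformity in the frequency: they become constant
  majorants for dominated convergence. Each passage from a trace to a Frobenius norm costs a factor
  of the dimension.\<close>

lemma
  fixes A \<Omega> B :: "complex ^ 'n ^ 'n"
  assumes "psd A" "\<Omega>\<^sup>\<dagger> = \<Omega>" "psd B" "norm A \<le> a" "norm B \<le> a" "norm \<Omega> \<le> w"
  shows fidelity_nonneg: "0 \<le> fidelity A \<Omega> B"
    and fidelity_le: "fidelity A \<Omega> B \<le> (real CARD('n))\<^sup>2 * w * a"
    and norm_psd_sqrt_fidelity_arg_le:
      "norm (psd_sqrt (psd_sqrt B ** \<Omega> ** A ** \<Omega> ** psd_sqrt B)) \<le> real CARD('n) * w * a"
proof -
  let ?n = "real CARD('n)"
  define R where "R = psd_sqrt B"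
  define M where "M = R ** \<Omega> ** A ** \<Omega> ** R"
  have nonneg: "0 \<le> a" "0 \<le> w" using assms norm_ge_zero order_trans by blast+
  have M: "psd M" unfolding M_def R_def by (rule psd_fidelity_arg) fact+
  show "0 \<le> fidelity A \<Omega> B"
    using psd_trace(1)[OF psd_sqrt(1)[OF M]] by (simp add: fidelity_def M_def R_def)
  have R: "(norm R)\<^sup>2 \<le> ?n * a"
  proof -
    have "(norm R)\<^sup>2 \<le> norm (trace B)"
      unfolding R_def norm_psd_sqrt[OF assms(3)] by (rule complex_Re_le_cmod)
    also have "\<dots> \<le> ?n * a"
      using norm_trace_le[of B] assms(5) by (smt (verit) mult_left_mono of_nat_0_le_iff)
    finally show ?thesis .
  qed
  have "norm M \<le> norm R * norm \<Omega> * norm A * norm \<Omega> * norm R"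
    unfolding M_def by (intro norm_matrix_mult_le[THEN order_trans] mult_mono) auto
  also have "\<dots> = (norm R)\<^sup>2 * ((norm \<Omega>)\<^sup>2 * norm A)" by (simp add: power2_eq_square)
  also have "\<dots> \<le> (?n * a) * (w\<^sup>2 * a)"
    using R assms nonneg by (intro mult_mono power_mono) auto
  finally have nM: "norm M \<le> ?n * w\<^sup>2 * a\<^sup>2" by (simp add: power2_eq_square mult_ac)
  have "(norm (psd_sqrt M))\<^sup>2 \<le> norm (trace M)"
    unfolding norm_psd_sqrt[OF M] by (rule complex_Re_le_cmod)
  also have "\<dots> \<le> ?n * norm M" by (rule norm_trace_le)
  also have "\<dots> \<le> ?n * (?n * w\<^sup>2 * a\<^sup>2)" by (intro mult_left_mono nM) simp
  also have "\<dots> = (?n * w * a)\<^sup>2" by (simp add: power2_eq_square mult_ac)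
  finally have nS: "norm (psd_sqrt M) \<le> ?n * w * a"
    by (rule power2_le_imp_le) (use nonneg in simp)
  then show "norm (psd_sqrt (psd_sqrt B ** \<Omega> ** A ** \<Omega> ** psd_sqrt B)) \<le> ?n * w * a"
    by (simp add: M_def R_def)
  from nS have "?n * norm (psd_sqrt M) \<le> ?n * (?n * w * a)" by (intro mult_left_mono) auto
  moreover have "fidelity A \<Omega> B \<le> ?n * norm (psd_sqrt M)"
    unfolding fidelity_def M_def R_def by (rule order_trans[OF complex_Re_le_cmod norm_trace_le])
  moreover have "?n * (?n * w * a) = ?n\<^sup>2 * w * a" by (simp add: power2_eq_square)
  ultimately show "fidelity A \<Omega> B \<le> ?n\<^sup>2 * w * a" by linarith
qed

text \<open>Formally, for \<open>\<delta> = 0\<close> and invertible \<open>S\<close>, this is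
  \<open>A ** Z\<close> where the congruence of \<open>A\<close> by
  \<open>Z = \<Omega> R S^(-1) R\<close> equals \<open>B\<close>: the cross spectrum of a field with
  its image under the filter adjoint to \<open>Z\<close>, a deterministic coupling. Where the weight
  is singular so is \<open>S\<close>, hence the shift.\<close>

definition optimal_cross ::
  "real \<Rightarrow> complex ^ 'n ^ 'n \<Rightarrow> complex ^ 'n ^ 'n \<Rightarrow> complex ^ 'n ^ 'n \<Rightarrow> complex ^ 'n ^ 'n" where
  "optimal_cross \<delta> A \<Omega> B = A ** \<Omega> ** psd_sqrt B
     ** matrix_inv (psd_sqrt (psd_sqrt B ** \<Omega> ** A ** \<Omega> ** psd_sqrt B) + \<delta> *\<^sub>R mat 1) ** psd_sqrt B"

text \<open>The cross matrix is \<open>A ** Z\<close>, and the congruence of \<open>A\<close> by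
  \<open>Z\<close> is at most \<open>B\<close>. The joint form is thus the form of \<open>A\<close>
  at \<open>u + Z *v v\<close> plus a nonnegative form in \<open>v\<close>. In the trace, cyclicity
  leaves \<open>S ** S ** T\<close> with \<open>T\<close> the inverse of
  \<open>S + \<delta>\<close>; this equals \<open>S - \<delta> + \<delta>^2 T\<close>, whose last
  term has nonnegative trace.\<close>

lemma
  fixes A \<Omega> B :: "complex ^ 'n ^ 'n"
  assumes A: "psd A" and \<Omega>: "\<Omega>\<^sup>\<dagger> = \<Omega>" and B: "psd B" and \<delta>: "0 < \<delta>"
  shows joint_psd_optimal_cross: "joint_psd A (optimal_cross \<delta> A \<Omega> B) B"
    and optimal_cross_ge: "fidelity A \<Omega> B - \<delta> * real CARD('n) \<le> Re (trace (\<Omega> ** optimal_cross \<delta> A \<Omega> B))"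
proof -
  define R where "R = psd_sqrt B"
  define S where "S = psd_sqrt (R ** \<Omega> ** A ** \<Omega> ** R)"
  define T where "T = matrix_inv (S + \<delta> *\<^sub>R mat 1)"
  note R = psd_sqrt[OF B, folded R_def]
  have S: "psd S" "S ** S = R ** \<Omega> ** A ** \<Omega> ** R"
    using psd_sqrt[OF psd_fidelity_arg[OF A \<Omega> B]] by (simp_all add: S_def R_def)
  note T = psd_shift_inverse[OF S(1) \<delta>, folded T_def]
  have C: "optimal_cross \<delta> A \<Omega> B = A ** \<Omega> ** R ** T ** R"
    by (simp add: optimal_cross_def R_def S_def T_def)
  define Z where "Z = \<Omega> ** R ** T ** R"
  have Zt: "Z\<^sup>\<dagger> = R ** T ** R ** \<Omega>"
    using R T \<Omega> by (simp add: Z_def conj_transpose_mult psdD matrix_mul_assoc)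
  let ?S = "S + \<delta> *\<^sub>R mat 1"
  have "T\<^sup>\<dagger> ** (?S ** ?S - S ** S) ** T = (T ** ?S) ** (?S ** T) - T ** (S ** S) ** T"
    unfolding psdD(1)[OF T(3)] mm.diff_left mm.diff_right by (simp add: matrix_mul_assoc)
  also have "\<dots> = mat 1 - T ** (S ** S) ** T" using T by simp
  finally have "psd (mat 1 - T ** (S ** S) ** T)"
    using psd_congruence[OF psd_shift_square_diff[OF S(1) \<delta>], of T] by simp
  from psd_congruence[OF this, of R] have "psd (R ** R - R ** T ** (S ** S) ** T ** R)"
    using R by (simp add: psdD mm.diff_left mm.diff_right matrix_mul_assoc)
  also have "R ** R - R ** T ** (S ** S) ** T ** R = B - Z\<^sup>\<dagger> ** A ** Z"
    unfolding S(2) Zt unfolding Z_def R(2) by (simp add: matrix_mul_assoc)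
  finally have BZ: "psd (B - Z\<^sup>\<dagger> ** A ** Z)" .
  show "joint_psd A (optimal_cross \<delta> A \<Omega> B) B"
    unfolding joint_psd_def
  proof (intro allI)
    fix u v
    have C': "optimal_cross \<delta> A \<Omega> B *v v = A *v (Z *v v)"
      unfolding C Z_def by (simp add: matrix_vector_mul_assoc matrix_mul_assoc)
    have ZAZ: "cip v (Z\<^sup>\<dagger> ** A ** Z *v v) = cip (Z *v v) (A *v (Z *v v))"
      by (simp add: cip_mult_left matrix_vector_mul_assoc matrix_mul_assoc)
    have s: "Re (cip (Z *v v) (A *v u)) = Re (cip u (A *v (Z *v v)))"
      using cip_mult_left[of A u "Z *v v"] cip_commute[of "Z *v v" "A *v u"] psdD(1)[OF A] by simp
    have "0 \<le> Re (cip (u + Z *v v) (A *v (u + Z *v v))) + Re (cip v ((B - Z\<^sup>\<dagger> ** A ** Z) *v v))"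
      using psdD(2)[OF A] psdD(2)[OF BZ] by (intro add_nonneg_nonneg)
    then show "0 \<le> Re (cip u (A *v u)) + 2 * Re (cip u (optimal_cross \<delta> A \<Omega> B *v v)) + Re (cip v (B *v v))"
      unfolding C' mv.diff_left mv.add_right cip_add_left cip_add_right cip_diff_right ZAZ
      using s by simp
  qed
  have "trace (\<Omega> ** optimal_cross \<delta> A \<Omega> B) = trace ((\<Omega> ** A ** \<Omega> ** R ** T) ** R)"
    unfolding C by (simp add: matrix_mul_assoc)
  also have "\<dots> = trace (R ** (\<Omega> ** A ** \<Omega> ** R ** T))" by (rule trace_mul_sym)
  also have "R ** (\<Omega> ** A ** \<Omega> ** R ** T) = S ** S ** T"
    unfolding S(2) by (simp add: matrix_mul_assoc)
  also have "S ** S ** T = S - \<delta> *\<^sub>R mat 1 + (\<delta> * \<delta>) *\<^sub>R T"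
  proof -
    have e: "S ** S = (S - \<delta> *\<^sub>R mat 1) ** ?S + (\<delta> * \<delta>) *\<^sub>R mat 1"
      by (simp add: mm.diff_left mm.add_right mm.scaleR_left mm.scaleR_right algebra_simps)
    have "S ** S ** T = (S - \<delta> *\<^sub>R mat 1) ** (?S ** T) + (\<delta> * \<delta>) *\<^sub>R T"
      unfolding e mm.add_left[of "(S - \<delta> *\<^sub>R mat 1) ** ?S"] mm.scaleR_left[of _ "mat 1"] matrix_mul_lid
        matrix_mul_assoc[of "S - \<delta> *\<^sub>R mat 1" ?S T] ..
    then show ?thesis using T(2) by simp
  qed
  also have "Re (trace (S - \<delta> *\<^sub>R mat 1 + (\<delta> * \<delta>) *\<^sub>R T)) =
      Re (trace S) - \<delta> * real CARD('n) + \<delta> * \<delta> * Re (trace T)"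
    by (simp add: trace_add trace_sub trace_scaleR trace_I)
  finally show "fidelity A \<Omega> B - \<delta> * real CARD('n) \<le> Re (trace (\<Omega> ** optimal_cross \<delta> A \<Omega> B))"
    using psd_trace(1)[OF T(3)] \<delta> by (simp add: fidelity_def S_def R_def)
qed

text \<open>Congruence of \<open>A ** (A + \<delta>)\<close> by the inverse \<open>T\<close> shows
  that \<open>mat 1 - \<delta> T\<close> is positive semidefinite, so the trace of \<open>T\<close>
  is at most the dimension over \<open>\<delta>\<close>. The other two powers of the dimension come
  from \<open>norm_le_trace\<close>.\<close>

lemma norm_shift_inverse_le:
  fixes A :: "complex ^ 'n ^ 'n"
  assumes "psd A" "0 < \<delta>"
  shows "norm (matrix_inv (A + \<delta> *\<^sub>R mat 1)) \<le> (real CARD('n)) ^ 3 / \<delta>"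
proof -
  define S T where "S = A + \<delta> *\<^sub>R mat 1" and "T = matrix_inv S"
  note T = psd_shift_inverse[OF assms, folded S_def, folded T_def]
  have "A ** S = A\<^sup>\<dagger> ** A + \<delta> *\<^sub>R A"
    using assms by (simp add: S_def mm.add_right mm.scaleR_right psdD)
  then have "psd (A ** S)" using assms by (auto intro!: psd_add psd_scaleR psd_conj_transpose_mult)
  from psd_congruence[OF this, of T] have "psd (T ** A ** (S ** T))"
    unfolding psdD(1)[OF T(3)] by (simp only: matrix_mul_assoc)
  also have "T ** A ** (S ** T) = T ** S - \<delta> *\<^sub>R T"
    using T unfolding S_def mm.add_right mm.scaleR_right by (simp add: algebra_simps)
  finally have "psd (mat 1 - \<delta> *\<^sub>R T)" using T by simp
  from psd_trace(1)[OF this] have "\<delta> * Re (trace T) \<le> real CARD('n)"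
    by (simp add: trace_sub trace_scaleR trace_I)
  then have "Re (trace T) \<le> real CARD('n) / \<delta>" using assms by (simp add: field_simps)
  then have "(real CARD('n))\<^sup>2 * Re (trace T) \<le> (real CARD('n))\<^sup>2 * (real CARD('n) / \<delta>)"
    by (intro mult_left_mono) auto
  then show ?thesis using norm_le_trace[OF T(3)]
    by (simp add: S_def T_def power2_eq_square power3_eq_cube)
qed

text \<open>The resolvent identity combined with the uniform bound on the inverses. Continuity is
  wanted for the measurability of \<open>optimal_cross\<close> in the frequency.\<close>

lemma continuous_on_shift_inverse:
  fixes \<delta> :: real
  assumes "0 < \<delta>"
  shows "continuous_on {A :: complex ^ 'n ^ 'n. psd A} (\<lambda>A. matrix_inv (A + \<delta> *\<^sub>R mat 1))"
proof (rule continuous_on_sequentiallyI)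
  fix X and A :: "complex ^ 'n ^ 'n"
  assume X: "\<forall>n. X n \<in> {A. psd A}" and A: "A \<in> {A. psd A}" and lim: "X \<longlonglongrightarrow> A"
  define K where "K = (real CARD('n)) ^ 3 / \<delta>"
  define g where "g = (\<lambda>A :: complex ^ 'n ^ 'n. matrix_inv (A + \<delta> *\<^sub>R mat 1))"
  have g: "norm (g A) \<le> K" "g A ** (A + \<delta> *\<^sub>R mat 1) = mat 1" "(A + \<delta> *\<^sub>R mat 1) ** g A = mat 1"
    if "psd A" for A
    unfolding g_def K_def using that assms by (auto intro: norm_shift_inverse_le psd_shift_inverse)
  have "norm (g (X n) - g A) \<le> K * norm (A - X n) * K" for n
  proof -
    have "g (X n) ** ((A + \<delta> *\<^sub>R mat 1) - (X n + \<delta> *\<^sub>R mat 1)) ** g A = g (X n) - g A"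
      unfolding mm.diff_right mm.diff_left using X A g
      by (simp add: matrix_mul_assoc[symmetric])
    then have "norm (g (X n) - g A) = norm (g (X n) ** (A - X n) ** g A)" by simp
    also have "\<dots> \<le> norm (g (X n)) * norm (A - X n) * norm (g A)"
      by (intro norm_matrix_mult_le[THEN order_trans] mult_mono) auto
    also have "\<dots> \<le> K * norm (A - X n) * K"
      using g[of A] g[of "X n"] X A order_trans[OF norm_ge_zero, of "g A" K] by (intro mult_mono) auto
    finally show ?thesis .
  qed
  note bound = this
  have "(\<lambda>n. K * norm (A - X n) * K) \<longlonglongrightarrow> K * norm (A - A) * K"
    by (intro tendsto_intros lim)
  then have "(\<lambda>n. K * norm (A - X n) * K) \<longlonglongrightarrow> 0" by simp
  then have "(\<lambda>n. g (X n) - g A) \<longlonglongrightarrow> 0"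
    by (rule Lim_null_comparison[OF always_eventually[OF allI[OF bound]]])
  then show "(\<lambda>n. matrix_inv (X n + \<delta> *\<^sub>R mat 1)) \<longlonglongrightarrow> matrix_inv (A + \<delta> *\<^sub>R mat 1)"
    unfolding g_def LIM_zero_iff .
qed

section \<open>Trigonometric polynomials on the torus\<close>

abbreviation torus_box :: "(real ^ 'd) set" where
  "torus_box \<equiv> cbox 0 (\<chi> k. 2 * pi)"

lemma mem_torus_box: "\<theta> \<in> torus_box \<longleftrightarrow> (\<forall>k. 0 \<le> \<theta> $ k \<and> \<theta> $ k \<le> 2 * pi)"
  by (simp add: mem_box_cart)

lemma sets_torus_measure [measurable_cong]: "sets torus_measure = sets (lebesgue_on torus_box)"
  by (simp add: torus_measure_def)

lemma space_torus_measure [simp]: "space torus_measure = torus_box"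
  by (simp add: torus_measure_def)

lemma inner_Basis_const:
  assumes "b \<in> (Basis :: (real ^ 'd) set)" shows "(\<chi> k. c) \<bullet> b = c"
proof -
  obtain i where "b = axis i 1" using assms by (auto simp: Basis_vec_def)
  then show ?thesis by (simp add: inner_axis)
qed

lemma emeasure_torus_box: "emeasure lebesgue (torus_box :: (real ^ 'd) set) = ennreal ((2 * pi) ^ CARD('d))"
proof -
  have "emeasure lebesgue (torus_box :: (real ^ 'd) set) = emeasure lborel (torus_box :: (real ^ 'd) set)"
    by simp
  also have "\<dots> = (\<Prod>b\<in>(Basis :: (real ^ 'd) set). ((\<chi> k. 2 * pi) - 0) \<bullet> b)"
    by (rule emeasure_lborel_cbox) (simp add: inner_Basis_const)
  also have "\<dots> = ennreal ((2 * pi) ^ CARD('d))"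
    by (simp add: inner_Basis_const)
  finally show ?thesis .
qed

lemma prob_space_torus_measure: "prob_space (torus_measure :: (real ^ 'd) measure)"
proof
  have "emeasure torus_measure (space torus_measure :: (real ^ 'd) set) =
      ennreal (1 / (2 * pi) ^ CARD('d)) * emeasure (lebesgue_on torus_box) (torus_box :: (real ^ 'd) set)"
    unfolding space_torus_measure unfolding torus_measure_def
    by (subst emeasure_density_const) (auto simp: sets_restrict_space)
  also have "emeasure (lebesgue_on torus_box) (torus_box :: (real ^ 'd) set) = ennreal ((2 * pi) ^ CARD('d))"
    by (subst emeasure_restrict_space) (auto simp: emeasure_torus_box)
  finally show "emeasure torus_measure (space torus_measure :: (real ^ 'd) set) = 1"
    by (simp add: ennreal_mult'[symmetric])
qed

interpretation torus: prob_space "torus_measure :: (real ^ 'd) measure"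
  by (rule prob_space_torus_measure)

lemma measure_torus_box [simp]: "measure torus_measure torus_box = 1"
  using torus.prob_space by simp

lemma AE_torus_measure: "(AE \<theta> in torus_measure. P \<theta>) \<longleftrightarrow> (AE \<theta> in lebesgue_on torus_box. P \<theta>)"
  unfolding torus_measure_def by (subst AE_density) auto

lemma AE_torus_negligible:
  assumes "negligible N" shows "AE \<theta> in torus_measure. \<theta> \<notin> N"
proof -
  have "AE \<theta> in lebesgue. \<theta> \<notin> N"
    using assms by (intro AE_not_in) (simp add: negligible_iff_null_sets)
  then show ?thesis unfolding AE_torus_measure by (subst AE_restrict_space_iff) auto
qed

lemma borel_measurable_torus: "f \<in> borel_measurable borel \<Longrightarrow> f \<in> borel_measurable torus_measure"
  unfolding measurable_cong_sets[OF sets_torus_measure refl]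
  by (rule measurable_restrict_space1) (rule measurable_completion, simp)

lemma borel_measurable_torus_continuous:
  "continuous_on UNIV f \<Longrightarrow> f \<in> borel_measurable torus_measure"
  by (intro borel_measurable_torus borel_measurable_continuous_onI)

text \<open>The torus carries a completed measure, while the splitting into one-dimensional
  integrals is available for \<open>lborel\<close>.\<close>

lemma integral_torus_borel:
  fixes f :: "real ^ 'd \<Rightarrow> 'b::{banach, second_countable_topology}"
  assumes [measurable]: "f \<in> borel_measurable borel"
  shows "(LINT \<theta>|torus_measure. f \<theta>) =
    (1 / (2 * pi) ^ CARD('d)) *\<^sub>R (LINT \<theta>|lborel. indicator torus_box \<theta> *\<^sub>R f \<theta>)"
proof -
  have "(LINT \<theta>|torus_measure. f \<theta>) = (LINT \<theta>|lebesgue_on torus_box. (1 / (2 * pi) ^ CARD('d)) *\<^sub>R f \<theta>)"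
    unfolding torus_measure_def
    by (subst integral_density) (auto intro!: measurable_restrict_space1 measurable_completion)
  also have "\<dots> = (1 / (2 * pi) ^ CARD('d)) *\<^sub>R (LINT \<theta>|lebesgue_on torus_box. f \<theta>)"
    by (rule integral_scaleR_right)
  also have "(LINT \<theta>|lebesgue_on torus_box. f \<theta>) = (LINT \<theta>|lebesgue. indicator torus_box \<theta> *\<^sub>R f \<theta>)"
    by (subst integral_restrict_space) auto
  also have "\<dots> = (LINT \<theta>|lborel. indicator torus_box \<theta> *\<^sub>R f \<theta>)"
    by (rule integral_completion) simp
  finally show ?thesis .
qed

lemma pairing_linear:
  "pairing \<theta> (s + t) = pairing \<theta> s + pairing \<theta> t" "pairing \<theta> (s - t) = pairing \<theta> s - pairing \<theta> t"
  "pairing \<theta> 0 = 0" "pairing \<theta> (- s) = - pairing \<theta> s" "pairing (\<theta> - \<phi>) s = pairing \<theta> s - pairing \<phi> s"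
  by (simp_all add: pairing_def algebra_simps sum.distrib sum_subtractf sum_negf)

lemma continuous_on_pairing [continuous_intros]: "continuous_on A (\<lambda>\<theta>. pairing \<theta> s)"
  unfolding pairing_def by (intro continuous_intros)

lemma continuous_on_cis [continuous_intros]: "continuous_on A f \<Longrightarrow> continuous_on A (\<lambda>x. cis (f x))"
  unfolding cis_conv_exp by (intro continuous_intros)

lemma measurable_cis_pairing [measurable]: "(\<lambda>\<theta>. cis (pairing \<theta> s)) \<in> borel_measurable torus_measure"
  by (intro borel_measurable_torus_continuous continuous_intros)

lemma integrable_torus_bounded:
  fixes f :: "real ^ 'd \<Rightarrow> 'b::{banach, second_countable_topology}"
  assumes "f \<in> borel_measurable torus_measure" "\<And>\<theta>. norm (f \<theta>) \<le> C"
  shows "integrable torus_measure f"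
  by (rule torus.integrable_const_bound[of _ C]) (use assms in auto)

lemma integral_cis_int:
  fixes n :: int
  assumes "n \<noteq> 0"
  shows "(LINT x|lborel. indicator {0..2 * pi} x *\<^sub>R cis (x * of_int n)) = 0"
proof -
  define w where "w = \<i> * complex_of_int n"
  have w: "w \<noteq> 0" using assms by (simp add: w_def)
  have cis: "cis (x * of_int n) = exp (complex_of_real x * w)" for x
    by (simp add: cis_conv_exp w_def mult_ac)
  define F where "F x = cis (x * of_int n) / w" for x
  have "(F has_vector_derivative cis (x * of_int n)) (at x within A)" for x A
  proof -
    have "((\<lambda>z. exp (z * w) / w) has_field_derivative exp (complex_of_real x * w)) (at (complex_of_real x))"
      using w by (auto intro!: derivative_eq_intros)
    then show ?thesis
      unfolding F_def cis by (rule has_vector_derivative_real_field)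
  qed
  then have "(LINT x|lborel. indicator {0..2 * pi} x *\<^sub>R cis (x * of_int n)) = F (2 * pi) - F 0"
    by (intro integral_FTC_Icc continuous_intros) auto
  also have "cis (2 * pi * of_int n) = 1"
    by (simp add: complex_eq_iff cos_int_2pin sin_int_2pin)
  then have "F (2 * pi) - F 0 = 0" by (simp add: F_def)
  finally show ?thesis .
qed

lemma indicator_scaleR_complex: "indicator A x *\<^sub>R (c :: complex) = indicator A x * c"
  by (simp add: indicator_def)

text \<open>The indicator of the cube and the character both factor over the coordinates. A
  coordinate where \<open>u\<close> is nonzero gives an integral over full periods, and that factor
  vanishes.\<close>

lemma integral_torus_cis:
  "(LINT \<theta>|torus_measure. cis (pairing \<theta> u)) = (if u = (0 :: int ^ 'd) then 1 else 0)"
proof (cases "u = 0")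
  case True
  then show ?thesis by (simp add: pairing_linear)
next
  case False
  define U :: "real ^ 'd" where "U = (\<chi> k. of_int (u $ k))"
  define g where "g b x = indicator {0..2 * pi} x *\<^sub>R cis (x * (U \<bullet> b))" for b :: "real ^ 'd" and x
  have gm[measurable]: "g b \<in> borel_measurable borel" for b
    unfolding g_def
    by (intro borel_measurable_scaleR borel_measurable_indicator) (auto intro!: borel_measurable_continuous_onI continuous_intros)
  have gi: "integrable lborel (g b)" for b
    unfolding g_def by (rule borel_integrable_compact) (auto intro!: continuous_intros)
  have U: "\<exists>n. U \<bullet> b = of_int n" if "b \<in> Basis" for b
    using that by (auto simp: Basis_vec_def U_def inner_axis)
  obtain k where k: "u $ k \<noteq> 0" using False by (auto simp: vec_eq_iff)
  have eq: "indicator torus_box \<theta> *\<^sub>R cis (pairing \<theta> u) = (\<Prod>b\<in>Basis. g b (\<theta> \<bullet> b))" for \<theta> :: "real ^ 'd"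
  proof -
    have "pairing \<theta> u = \<theta> \<bullet> U" by (simp add: pairing_def U_def inner_vec_def)
    also have "\<dots> = (\<Sum>b\<in>Basis. (\<theta> \<bullet> b) * (U \<bullet> b))" by (rule euclidean_inner)
    finally have "cis (pairing \<theta> u) = (\<Prod>b\<in>Basis. cis ((\<theta> \<bullet> b) * (U \<bullet> b)))"
      by (simp add: cis_conv_exp sum_distrib_left exp_sum)
    moreover have "(indicator torus_box \<theta> :: complex) = (\<Prod>b\<in>Basis. indicator {0..2 * pi} (\<theta> \<bullet> b))"
      by (auto simp: indicator_def mem_box inner_Basis_const)
    ultimately show ?thesis by (simp add: g_def prod.distrib indicator_scaleR_complex)
  qed
  interpret P: product_sigma_finite "\<lambda>_::real ^ 'd. lborel :: real measure"
    by unfold_locales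
  have "(LINT \<theta>|lborel. indicator torus_box \<theta> *\<^sub>R cis (pairing \<theta> u)) =
      (LINT \<theta>|lborel. (\<Prod>b\<in>Basis. g b (\<theta> \<bullet> b)))" unfolding eq ..
  also have "\<dots> = (LINT f|(\<Pi>\<^sub>M b\<in>Basis. lborel). (\<Prod>b\<in>Basis. g b ((\<Sum>b\<in>Basis. f b *\<^sub>R b) \<bullet> b)))"
    by (subst lborel_eq) (rule integral_distr; measurable)
  also have "\<dots> = (LINT f|(\<Pi>\<^sub>M b\<in>Basis. lborel). (\<Prod>b\<in>Basis. g b (f b)))"
    by (intro Bochner_Integration.integral_cong refl prod.cong) (simp add: inner_sum_left_Basis)
  also have "\<dots> = (\<Prod>b\<in>Basis. integral\<^sup>L lborel (g b))"
    by (rule P.product_integral_prod) (auto simp: gi)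
  also have "\<dots> = 0"
  proof (rule prod_zero)
    show "\<exists>b\<in>Basis. integral\<^sup>L lborel (g b) = 0"
    proof
      show "axis k 1 \<in> (Basis :: (real ^ 'd) set)" by simp
      have "U \<bullet> axis k 1 = of_int (u $ k)" by (simp add: U_def inner_axis)
      then show "integral\<^sup>L lborel (g (axis k 1)) = 0"
        using integral_cis_int[OF k] by (simp add: g_def[abs_def])
    qed
  qed simp
  finally show ?thesis
    using False by (subst integral_torus_borel) (auto intro!: borel_measurable_continuous_onI continuous_intros)
qed

section \<open>Density of trigonometric polynomials in the mean\<close>

inductive trig_polynomial :: "(real ^ 'd \<Rightarrow> complex) \<Rightarrow> bool" where
  monomial: "trig_polynomial (\<lambda>\<theta>. c * cis (pairing \<theta> u))"
| add: "trig_polynomial p \<Longrightarrow> trig_polynomial q \<Longrightarrow> trig_polynomial (\<lambda>\<theta>. p \<theta> + q \<theta>)"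

lemma trig_polynomial_const: "trig_polynomial (\<lambda>\<theta>. c)"
  using trig_polynomial.monomial[of c 0] by (simp add: pairing_linear)

lemma trig_polynomial_mult:
  assumes "trig_polynomial p" "trig_polynomial q" shows "trig_polynomial (\<lambda>\<theta>. p \<theta> * q \<theta>)"
  using assms
proof (induction arbitrary: q rule: trig_polynomial.induct)
  case (monomial c u)
  from monomial show ?case
  proof (induction rule: trig_polynomial.induct)
    case (monomial d v)
    have "(\<lambda>\<theta>. c * cis (pairing \<theta> u) * (d * cis (pairing \<theta> v))) = (\<lambda>\<theta>. c * d * cis (pairing \<theta> (u + v)))"
      by (simp add: fun_eq_iff pairing_linear flip: cis_mult)
    then show ?case by (simp add: trig_polynomial.monomial)
  qed (simp add: distrib_left trig_polynomial.add)
qed (simp add: distrib_right trig_polynomial.add)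

lemma trig_polynomial_sum:
  "finite A \<Longrightarrow> (\<And>a. a \<in> A \<Longrightarrow> trig_polynomial (p a)) \<Longrightarrow> trig_polynomial (\<lambda>\<theta>. \<Sum>a\<in>A. p a \<theta>)"
  by (induction A rule: finite_induct) (auto intro: trig_polynomial_const trig_polynomial.add)

lemma trig_polynomial_bounded:
  assumes "trig_polynomial p"
  shows "continuous_on UNIV p" "\<exists>C. \<forall>\<theta>. norm (p \<theta>) \<le> C"
proof -
  show "continuous_on UNIV p"
    using assms by induction (auto intro!: continuous_intros)
  show "\<exists>C. \<forall>\<theta>. norm (p \<theta>) \<le> C"
    using assms
  proof induction
    case (monomial c u)
    then show ?case by (intro exI[of _ "norm c"]) (simp add: norm_mult)
  next
    case (add p q)
    then show ?case by (meson add_mono norm_triangle_le)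
  qed
qed

lemma trig_polynomial_integrable: "trig_polynomial p \<Longrightarrow> integrable torus_measure p"
  using trig_polynomial_bounded[of p]
  by (auto intro!: integrable_torus_bounded borel_measurable_torus_continuous)

text \<open>Maps the cube onto a product of circles in a Euclidean space, from which real
  polynomials pull back to trigonometric polynomials.\<close>

definition torus_map :: "real ^ 'd \<Rightarrow> complex ^ 'd" where
  "torus_map \<theta> = (\<chi> k. cis (\<theta> $ k))"

lemma continuous_on_torus_map: "continuous_on A torus_map"
  unfolding torus_map_def by (intro continuous_on_vec_lambda continuous_intros)

lemma trig_polynomial_torus_map:
  fixes g :: "complex ^ 'd \<Rightarrow> real"
  assumes "real_polynomial_function g"
  shows "trig_polynomial (\<lambda>\<theta>. complex_of_real (g (torus_map \<theta>)))"
  using assms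
proof induction
  case (linear f)
  have e: "complex_of_real (f (torus_map \<theta>)) = (\<Sum>b\<in>Basis. complex_of_real (f b) * complex_of_real (torus_map \<theta> \<bullet> b))" for \<theta> :: "real ^ 'd"
  proof -
    interpret bounded_linear f by fact
    have "f (torus_map \<theta>) = f (\<Sum>b\<in>Basis. (torus_map \<theta> \<bullet> b) *\<^sub>R b)" by (simp add: euclidean_representation)
    also have "\<dots> = (\<Sum>b\<in>Basis. f b * (torus_map \<theta> \<bullet> b))" by (simp add: sum scaleR mult.commute)
    finally show ?thesis by simp
  qed
  have "trig_polynomial (\<lambda>\<theta>. complex_of_real (torus_map \<theta> \<bullet> b))" if b: "b \<in> Basis" for b :: "complex ^ 'd"
  proof -
    obtain k c where b: "b = axis k c" using b by (auto simp: Basis_vec_def)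
    have p: "pairing \<theta> (axis k 1) = \<theta> $ k" for \<theta> :: "real ^ 'd"
      by (simp add: pairing_def axis_def if_distrib cong: if_cong)
    \<comment> \<open>A coordinate is the real part of \<open>cnj c\<close> times
      \<open>cis\<close>, where \<open>c\<close> is 1 or the imaginary unit; it is split into the
      two conjugate exponentials.\<close>
    have "complex_of_real (torus_map \<theta> \<bullet> b) =
        cnj c / 2 * cis (pairing \<theta> (axis k 1)) + c / 2 * cis (pairing \<theta> (- axis k 1))" for \<theta> :: "real ^ 'd"
      unfolding pairing_linear p b
      by (simp add: inner_axis torus_map_def inner_complex_def complex_eq_iff) (simp add: field_simps)
    note e = this
    show ?thesis unfolding e by (intro trig_polynomial.intros)
  qed
  then show ?case unfolding e by (intro trig_polynomial_sum trig_polynomial_mult trig_polynomial_const) auto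
qed (auto intro: trig_polynomial_const trig_polynomial.add trig_polynomial_mult)

lemma cis_eq_imp:
  assumes "cis a = cis b" "0 \<le> a" "a \<le> 2 * pi" "0 \<le> b" "b \<le> 2 * pi" "a \<noteq> b"
  shows "a \<in> {0, 2 * pi}" "b \<in> {0, 2 * pi}"
proof -
  have "sin a = sin b \<and> cos a = cos b" using assms(1) by (simp add: complex_eq_iff)
  then obtain n :: int where n: "a = b + 2 * pi * n" using sin_cos_eq_iff[of a b] by auto
  have "\<bar>2 * pi * n\<bar> \<le> 2 * pi * 1" using n assms(2-5) by auto
  then have "\<bar>real_of_int n\<bar> \<le> 1" by (simp add: abs_mult)
  then have "n = 0 \<or> n = 1 \<or> n = - 1" by linarith
  then show "a \<in> {0, 2 * pi}" "b \<in> {0, 2 * pi}" using n assms by auto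
qed

text \<open>A continuous function on the cube that vanishes on its boundary descends to the product of
  circles, where the Stone-Weierstrass theorem applies.\<close>

lemma trig_polynomial_approx_continuous:
  fixes h :: "real ^ 'd \<Rightarrow> real"
  assumes h: "continuous_on torus_box h"
    and bd: "\<And>\<theta> k. \<theta> \<in> torus_box \<Longrightarrow> \<theta> $ k \<in> {0, 2 * pi} \<Longrightarrow> h \<theta> = 0"
    and "0 < \<epsilon>"
  obtains p where "trig_polynomial p" "\<And>\<theta>. \<theta> \<in> torus_box \<Longrightarrow> norm (complex_of_real (h \<theta>) - p \<theta>) < \<epsilon>"
proof -
  define T :: "(complex ^ 'd) set" where "T = torus_map ` torus_box"
  have T: "compact T" unfolding T_def by (intro compact_continuous_image continuous_on_torus_map compact_cbox)
  have inj: "h \<theta> = h \<phi>" if "\<theta> \<in> torus_box" "\<phi> \<in> torus_box" "torus_map \<theta> = torus_map \<phi>" for \<theta> \<phi> :: "real ^ 'd"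
  proof (cases "\<theta> = \<phi>")
    case False
    then obtain k where "\<theta> $ k \<noteq> \<phi> $ k" by (auto simp: vec_eq_iff)
    moreover have "cis (\<theta> $ k) = cis (\<phi> $ k)" using that(3) by (simp add: torus_map_def vec_eq_iff)
    ultimately have "\<theta> $ k \<in> {0, 2 * pi}" "\<phi> $ k \<in> {0, 2 * pi}"
      using cis_eq_imp[of "\<theta> $ k" "\<phi> $ k"] that(1,2) unfolding mem_torus_box by blast+
    then show ?thesis using bd that by metis
  qed simp
  \<comment> \<open>An arbitrary preimage is chosen; by \<open>inj\<close> the value of
    \<open>h\<close> does not depend on the choice.\<close>
  define F where "F w = h (inv_into torus_box torus_map w)" for w
  have F: "F (torus_map \<theta>) = h \<theta>" if "\<theta> \<in> torus_box" for \<theta>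
    unfolding F_def using that by (intro inj inv_into_into f_inv_into_f) auto
  \<comment> \<open>By compactness \<open>torus_map\<close> sends closed subsets of the cube to
    closed sets, so preimages of closed sets under \<open>F\<close> are closed without any
    continuous choice of preimages.\<close>
  have "continuous_on T F"
    unfolding continuous_on_closed_vimage[OF compact_imp_closed[OF T]]
  proof (intro allI impI)
    fix B :: "real set" assume "closed B"
    then have "closed (h -` B \<inter> torus_box)"
      using h continuous_on_closed_vimage[OF closed_cbox] by metis
    then have "compact (h -` B \<inter> torus_box)"
      by (metis Int_commute closed_Int_compact compact_cbox inf.right_idem)
    then have "compact (torus_map ` (h -` B \<inter> torus_box))"
      by (intro compact_continuous_image continuous_on_torus_map)
    moreover have "F -` B \<inter> T = torus_map ` (h -` B \<inter> torus_box)"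
      using F by (auto simp: T_def)
    ultimately show "closed (F -` B \<inter> T)" by (simp add: compact_imp_closed)
  qed
  then obtain g where g: "real_polynomial_function g" "\<And>w. w \<in> T \<Longrightarrow> \<bar>F w - g w\<bar> < \<epsilon>"
    using Stone_Weierstrass_real_polynomial_function[OF T _ \<open>0 < \<epsilon>\<close>] by blast
  show thesis
  proof
    show "trig_polynomial (\<lambda>\<theta>. complex_of_real (g (torus_map \<theta>)))"
      by (rule trig_polynomial_torus_map) fact
    fix \<theta> :: "real ^ 'd" assume "\<theta> \<in> torus_box"
    then have "\<bar>h \<theta> - g (torus_map \<theta>)\<bar> < \<epsilon>" using g(2)[of "torus_map \<theta>"] F by (auto simp: T_def)
    then show "norm (complex_of_real (h \<theta>) - complex_of_real (g (torus_map \<theta>))) < \<epsilon>"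
      by (simp flip: of_real_diff)
  qed
qed

text \<open>A measurable function is almost everywhere a limit of continuous ones. Clipping these to
  \<open>[-C, C]\<close> permits dominated convergence, and a cutoff makes them vanish on the
  boundary of the cube, a null set, so that uniform approximation is available.\<close>

lemma trig_polynomial_dense_real:
  fixes f :: "real ^ 'd \<Rightarrow> real"
  assumes f: "f \<in> borel_measurable torus_measure" and C: "AE \<theta> in torus_measure. \<bar>f \<theta>\<bar> \<le> C" and "0 < \<epsilon>"
  obtains p where "trig_polynomial p" "(LINT \<theta>|torus_measure. norm (complex_of_real (f \<theta>) - p \<theta>)) < \<epsilon>"
proof -
  have "f \<in> borel_measurable (lebesgue_on torus_box)"
    using f by (simp cong: measurable_cong_sets add: sets_torus_measure)
  then have "f measurable_on torus_box"
    by (subst measurable_on_iff_borel_measurable) auto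
  then obtain N and g :: "nat \<Rightarrow> real ^ 'd \<Rightarrow> real" where N: "negligible N"
    and g: "\<And>n. continuous_on UNIV (g n)"
    and lim: "\<And>x. x \<notin> N \<Longrightarrow> (\<lambda>n. g n x) \<longlonglongrightarrow> (if x \<in> torus_box then f x else 0)"
    unfolding measurable_on_def by auto
  have C0: "0 \<le> C"
  proof -
    have "AE \<theta> in (torus_measure :: (real ^ 'd) measure). 0 \<le> C"
      by (rule eventually_mono[OF C]) (erule order_trans[OF abs_ge_zero])
    then show ?thesis by simp
  qed
  \<comment> \<open>Positive inside the cube and zero on its boundary, so that
    \<open>min 1 (real n * d \<theta>)\<close> is a cutoff that reaches 1 from some \<open>n\<close>
    on at each interior point.\<close>
  define d where "d \<theta> = (\<Prod>k\<in>UNIV. \<theta> $ k * (2 * pi - \<theta> $ k))" for \<theta> :: "real ^ 'd"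
  define h where "h n \<theta> = min 1 (real n * d \<theta>) * max (- C) (min C (g n \<theta>))" for n \<theta>
  have hc: "continuous_on UNIV (h n)" for n
    unfolding h_def d_def by (intro continuous_intros g)
  have d0: "0 \<le> d \<theta>" if "\<theta> \<in> torus_box" for \<theta>
    unfolding d_def using that by (intro prod_nonneg) (auto simp: mem_torus_box)
  have hC: "\<bar>h n \<theta>\<bar> \<le> C" if "\<theta> \<in> torus_box" for n \<theta>
  proof -
    have "\<bar>min 1 (real n * d \<theta>)\<bar> \<le> 1" using d0[OF that] by auto
    moreover have "\<bar>max (- C) (min C (g n \<theta>))\<bar> \<le> C" using C0 by auto
    ultimately have "\<bar>h n \<theta>\<bar> \<le> 1 * C" unfolding h_def abs_mult by (intro mult_mono) auto
    then show ?thesis by simp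
  qed
  have bd: "h n \<theta> = 0" if "\<theta> $ k \<in> {0, 2 * pi}" for n \<theta> k
  proof -
    have "d \<theta> = 0" unfolding d_def by (rule prod_zero) (use that in \<open>auto intro!: exI[of _ k]\<close>)
    then show ?thesis by (simp add: h_def)
  qed
  have hlim: "AE \<theta> in torus_measure. (\<lambda>n. h n \<theta>) \<longlonglongrightarrow> f \<theta>"
    using AE_torus_negligible[OF N] AE_torus_negligible[OF negligible_frontier_interval[of 0 "\<chi> k. 2 * pi"]] C AE_space
  proof eventually_elim
    case (elim \<theta>)
    then have box: "\<theta> \<in> box 0 (\<chi> k. 2 * pi)" "\<theta> \<in> torus_box" by auto
    then have d: "0 < d \<theta>" unfolding d_def by (intro prod_pos) (auto simp: mem_box_cart)
    have "(\<lambda>n. max (- C) (min C (g n \<theta>))) \<longlonglongrightarrow> max (- C) (min C (f \<theta>))"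
      using lim[of \<theta>] elim box by (intro tendsto_intros) auto
    moreover have "max (- C) (min C (f \<theta>)) = f \<theta>" using elim by auto
    moreover have "(\<lambda>n. min 1 (real n * d \<theta>)) \<longlonglongrightarrow> 1"
    proof (rule tendsto_eventually)
      obtain n0 where n0: "1 / d \<theta> \<le> real n0" using real_arch_simple by blast
      have "min 1 (real n * d \<theta>) = 1" if "n0 \<le> n" for n
      proof -
        have "1 / d \<theta> \<le> real n" using n0 that by simp
        then have "1 \<le> real n * d \<theta>" using d by (simp add: field_simps)
        then show ?thesis by simp
      qed
      then show "\<forall>\<^sub>F n in sequentially. min 1 (real n * d \<theta>) = 1"
        by (auto simp: eventually_sequentially)
    qed
    ultimately show ?case unfolding h_def using tendsto_mult by force
  qed
  have hm: "h n \<in> borel_measurable torus_measure" for n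
    by (intro borel_measurable_torus_continuous hc)
  have fhC: "AE \<theta> in torus_measure. norm \<bar>f \<theta> - h n \<theta>\<bar> \<le> 2 * C" for n
    using C AE_space
  proof eventually_elim
    case (elim \<theta>)
    then show ?case using hC[of \<theta> n] by auto
  qed
  have "(\<lambda>n. LINT \<theta>|torus_measure. \<bar>f \<theta> - h n \<theta>\<bar>) \<longlonglongrightarrow> (LINT \<theta>|(torus_measure :: (real ^ 'd) measure). (0::real))"
  proof (rule integral_dominated_convergence[where w = "\<lambda>_. 2 * C"])
    show "AE \<theta> in torus_measure. (\<lambda>n. \<bar>f \<theta> - h n \<theta>\<bar>) \<longlonglongrightarrow> 0"
      using hlim
    proof eventually_elim
      case (elim \<theta>)
      have "(\<lambda>n. \<bar>f \<theta> - h n \<theta>\<bar>) \<longlonglongrightarrow> \<bar>f \<theta> - f \<theta>\<bar>" by (intro tendsto_intros elim)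
      then show ?case by simp
    qed
  qed (use f hm fhC in auto)
  then have "(\<lambda>n. LINT \<theta>|torus_measure. \<bar>f \<theta> - h n \<theta>\<bar>) \<longlonglongrightarrow> 0" by simp
  then have "\<forall>\<^sub>F n in sequentially. (LINT \<theta>|torus_measure. \<bar>f \<theta> - h n \<theta>\<bar>) < \<epsilon> / 2"
    using \<open>0 < \<epsilon>\<close> by (intro order_tendstoD(2)) auto
  then obtain n where n: "(LINT \<theta>|torus_measure. \<bar>f \<theta> - h n \<theta>\<bar>) < \<epsilon> / 2"
    by (auto simp: eventually_sequentially)
  obtain p where p: "trig_polynomial p" "\<And>\<theta>. \<theta> \<in> torus_box \<Longrightarrow> norm (complex_of_real (h n \<theta>) - p \<theta>) < \<epsilon> / 2"
    by (rule trig_polynomial_approx_continuous[of "h n" "\<epsilon> / 2"])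
      (use continuous_on_subset[OF hc] bd \<open>0 < \<epsilon>\<close> in auto)
  have ifh: "integrable torus_measure (\<lambda>\<theta>. \<bar>f \<theta> - h n \<theta>\<bar>)"
    using f hm fhC by (intro torus.integrable_const_bound[of _ "2 * C"]) auto
  have "(LINT \<theta>|torus_measure. norm (complex_of_real (f \<theta>) - p \<theta>)) \<le> (LINT \<theta>|torus_measure. \<bar>f \<theta> - h n \<theta>\<bar> + \<epsilon> / 2)"
  proof (rule integral_mono_AE')
    show "integrable torus_measure (\<lambda>\<theta>. \<bar>f \<theta> - h n \<theta>\<bar> + \<epsilon> / 2)" using ifh by simp
    show "AE \<theta> in torus_measure. norm (complex_of_real (f \<theta>) - p \<theta>) \<le> \<bar>f \<theta> - h n \<theta>\<bar> + \<epsilon> / 2"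
    proof (rule AE_I2)
      fix \<theta> :: "real ^ 'd" assume "\<theta> \<in> space torus_measure"
      then have "norm (complex_of_real (h n \<theta>) - p \<theta>) < \<epsilon> / 2" using p by simp
      moreover have "norm (complex_of_real (f \<theta>) - complex_of_real (h n \<theta>)) = \<bar>f \<theta> - h n \<theta>\<bar>"
        by (simp flip: of_real_diff)
      moreover have "norm (complex_of_real (f \<theta>) - p \<theta>) \<le>
          norm (complex_of_real (f \<theta>) - complex_of_real (h n \<theta>)) + norm (complex_of_real (h n \<theta>) - p \<theta>)"
        by norm
      ultimately show "norm (complex_of_real (f \<theta>) - p \<theta>) \<le> \<bar>f \<theta> - h n \<theta>\<bar> + \<epsilon> / 2" by linarith
    qed
  qed (use \<open>0 < \<epsilon>\<close> in auto)
  also have "\<dots> = (LINT \<theta>|torus_measure. \<bar>f \<theta> - h n \<theta>\<bar>) + \<epsilon> / 2"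
    using ifh by (simp add: torus.prob_space)
  also have "\<dots> < \<epsilon>" using n by simp
  finally show thesis using that p(1) by blast
qed

lemma trig_polynomial_dense:
  fixes f :: "real ^ 'd \<Rightarrow> complex"
  assumes f[measurable]: "f \<in> borel_measurable torus_measure" and C: "AE \<theta> in torus_measure. norm (f \<theta>) \<le> C" and "0 < \<epsilon>"
  obtains p where "trig_polynomial p" "(LINT \<theta>|torus_measure. norm (f \<theta> - p \<theta>)) < \<epsilon>"
proof -
  have "AE \<theta> in torus_measure. \<bar>Re (f \<theta>)\<bar> \<le> C" "AE \<theta> in torus_measure. \<bar>Im (f \<theta>)\<bar> \<le> C"
    using C by (auto elim!: eventually_mono intro: order_trans[OF abs_Re_le_cmod] order_trans[OF abs_Im_le_cmod])
  note bounds = this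
  obtain p where p: "trig_polynomial p" "(LINT \<theta>|torus_measure. norm (complex_of_real (Re (f \<theta>)) - p \<theta>)) < \<epsilon> / 2"
    by (rule trig_polynomial_dense_real[OF _ bounds(1), of "\<epsilon> / 2"]) (use \<open>0 < \<epsilon>\<close> in auto)
  obtain q where q: "trig_polynomial q" "(LINT \<theta>|torus_measure. norm (complex_of_real (Im (f \<theta>)) - q \<theta>)) < \<epsilon> / 2"
    by (rule trig_polynomial_dense_real[OF _ bounds(2), of "\<epsilon> / 2"]) (use \<open>0 < \<epsilon>\<close> in auto)
  have fi: "integrable torus_measure f" using C by (intro torus.integrable_const_bound[of _ C]) auto
  have i: "integrable torus_measure (\<lambda>\<theta>. norm (complex_of_real (Re (f \<theta>)) - p \<theta>))"
    "integrable torus_measure (\<lambda>\<theta>. norm (complex_of_real (Im (f \<theta>)) - q \<theta>))"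
    using fi trig_polynomial_integrable[OF p(1)] trig_polynomial_integrable[OF q(1)] by auto
  have "(LINT \<theta>|torus_measure. norm (f \<theta> - (p \<theta> + \<i> * q \<theta>))) \<le>
      (LINT \<theta>|torus_measure. norm (complex_of_real (Re (f \<theta>)) - p \<theta>) + norm (complex_of_real (Im (f \<theta>)) - q \<theta>))"
  proof (rule integral_mono')
    fix \<theta> :: "real ^ 'd"
    have "f \<theta> = complex_of_real (Re (f \<theta>)) + \<i> * complex_of_real (Im (f \<theta>))" by (simp add: complex_eq_iff)
    then have "f \<theta> - (p \<theta> + \<i> * q \<theta>) = (complex_of_real (Re (f \<theta>)) - p \<theta>) + \<i> * (complex_of_real (Im (f \<theta>)) - q \<theta>)"
      by (simp add: algebra_simps)
    then show "norm (f \<theta> - (p \<theta> + \<i> * q \<theta>)) \<le> norm (complex_of_real (Re (f \<theta>)) - p \<theta>) + norm (complex_of_real (Im (f \<theta>)) - q \<theta>)"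
      using norm_triangle_ineq[of "complex_of_real (Re (f \<theta>)) - p \<theta>" "\<i> * (complex_of_real (Im (f \<theta>)) - q \<theta>)"]
      by (simp only: norm_mult norm_ii mult_1_left)
  qed (use i in auto)
  also have "\<dots> = (LINT \<theta>|torus_measure. norm (complex_of_real (Re (f \<theta>)) - p \<theta>)) + (LINT \<theta>|torus_measure. norm (complex_of_real (Im (f \<theta>)) - q \<theta>))"
    using i by simp
  also have "\<dots> < \<epsilon>" using p q by simp
  finally have "(LINT \<theta>|torus_measure. norm (f \<theta> - (p \<theta> + \<i> * q \<theta>))) < \<epsilon>" .
  moreover have "trig_polynomial (\<lambda>\<theta>. p \<theta> + \<i> * q \<theta>)"
    by (intro trig_polynomial.add trig_polynomial_mult trig_polynomial_const p q)
  ultimately show thesis using that by blast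
qed

section \<open>Fejer means\<close>

definition lattice_box :: "int \<Rightarrow> int \<Rightarrow> (int ^ 'd) set" where
  "lattice_box a b = {s. \<forall>k. a \<le> s $ k \<and> s $ k < b}"

lemma finite_card_lattice_box:
  "finite (lattice_box a b :: (int ^ 'd) set) \<and> card (lattice_box a b :: (int ^ 'd) set) = nat (b - a) ^ CARD('d)"
proof -
  have "bij_betw vec_nth (lattice_box a b :: (int ^ 'd) set) (PiE UNIV (\<lambda>_. {a..<b}))"
    by (rule bij_betw_byWitness[where f' = vec_lambda]) (auto simp: lattice_box_def PiE_UNIV_domain)
  moreover have "finite (PiE (UNIV :: 'd set) (\<lambda>_. {a..<b}))" by (intro finite_PiE) auto
  moreover have "card (PiE (UNIV :: 'd set) (\<lambda>_. {a..<b})) = nat (b - a) ^ CARD('d)"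
    by (simp add: card_PiE)
  ultimately show ?thesis by (metis bij_betw_finite bij_betw_same_card)
qed

text \<open>With \<open>N + 1\<close> points on each side no window is empty, and averages over it
  never divide by zero.\<close>

definition window :: "nat \<Rightarrow> (int ^ 'd) set" where
  "window N = lattice_box 0 (int (Suc N))"

lemma finite_window [simp]: "finite (window N)"
  unfolding window_def using finite_card_lattice_box by blast

lemma card_window: "card (window N :: (int ^ 'd) set) = Suc N ^ CARD('d)"
proof -
  have "card (window N :: (int ^ 'd) set) = nat (int (Suc N) - 0) ^ CARD('d)"
    unfolding window_def using finite_card_lattice_box by blast
  then show ?thesis by (simp only: diff_0_right nat_int)
qed

lemma card_window_neq_0 [simp]: "card (window N) \<noteq> 0"
  unfolding card_window by simp

text \<open>A double sum over a window, rather than a weighted single sum, is the shape in which the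
  second moment of windowed data appears. Grouping by lag multiplies \<open>c u\<close> by
  \<open>fejer_weight N u\<close>.\<close>

definition fejer_mean :: "nat \<Rightarrow> (int ^ 'd \<Rightarrow> complex) \<Rightarrow> real ^ 'd \<Rightarrow> complex" where
  "fejer_mean N c \<theta> = (\<Sum>s\<in>window N. \<Sum>t\<in>window N. c (s - t) * cis (- pairing \<theta> (s - t))) / card (window N :: (int ^ 'd) set)"

text \<open>In closed form this is the product over the coordinates \<open>k\<close> of
  \<open>max 0 (1 - |u_k| / (N + 1))\<close>.\<close>

definition fejer_weight :: "nat \<Rightarrow> int ^ 'd \<Rightarrow> real" where
  "fejer_weight N u = (\<Sum>s\<in>window N. \<Sum>t\<in>window N. if s - t = u then 1 else 0) / card (window N :: (int ^ 'd) set)"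

text \<open>The exponent has the sign of the inversion formula in \<open>spectral_density\<close>,
  so that coefficients of a density are covariances.\<close>

definition fourier_coeff :: "(real ^ 'd \<Rightarrow> complex) \<Rightarrow> int ^ 'd \<Rightarrow> complex" where
  "fourier_coeff f u = (LINT \<theta>|torus_measure. f \<theta> * cis (pairing \<theta> u))"

lemma fejer_weight_minus: "fejer_weight N (- u) = fejer_weight N u"
  unfolding fejer_weight_def
  by (subst sum.swap) (intro arg_cong2[of _ _ _ _ "(/)"] sum.cong refl, auto simp: algebra_simps)

text \<open>Let \<open>c\<close> dominate every coordinate of \<open>u\<close>. Points of the window
  at distance at least \<open>c\<close> from its faces stay in the window after a shift by
  \<open>- u\<close>; their proportion is \<open>(1 - 2 c / (N + 1))^d\<close>, which tends to
  1.\<close>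

lemma fejer_weight_tendsto:
  fixes u :: "int ^ 'd"
  shows "(\<lambda>N. fejer_weight N u) \<longlonglongrightarrow> 1"
proof -
  define c where "c = nat (\<Sum>k\<in>UNIV. \<bar>u $ k\<bar>)"
  have c: "\<bar>u $ k\<bar> \<le> int c" for k
  proof -
    have "\<bar>u $ k\<bar> \<le> (\<Sum>k\<in>UNIV. \<bar>u $ k\<bar>)" by (rule member_le_sum) auto
    then show ?thesis by (simp add: c_def)
  qed
  have inner: "(\<Sum>t\<in>window N. if s - t = u then 1 else (0::real)) = (if s - u \<in> window N then 1 else 0)" for s N
  proof -
    have "(\<Sum>t\<in>window N. if s - t = u then 1 else (0::real)) = (\<Sum>t\<in>window N. if t = s - u then 1 else 0)"
      by (intro sum.cong) (auto simp: algebra_simps)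
    then show ?thesis by simp
  qed
  have le: "fejer_weight N u \<le> 1" for N
  proof -
    have "(\<Sum>s\<in>window N. \<Sum>t\<in>window N. if s - t = u then 1 else (0::real)) \<le> (\<Sum>s\<in>(window N :: (int ^ 'd) set). 1)"
      unfolding inner by (intro sum_mono) auto
    then show ?thesis unfolding fejer_weight_def by (simp add: divide_le_eq card_window)
  qed
  have ge: "((real N + 1 - 2 * real c) / (real N + 1)) ^ CARD('d) \<le> fejer_weight N u" if "2 * c \<le> N" for N
  proof -
    define I :: "(int ^ 'd) set" where "I = lattice_box (int c) (int (Suc N) - int c)"
    have I: "s \<in> window N" "s - u \<in> window N" if "s \<in> I" for s
    proof -
      have "0 \<le> s $ k \<and> s $ k < int (Suc N) \<and> 0 \<le> s $ k - u $ k \<and> s $ k - u $ k < int (Suc N)" for k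
      proof -
        have "int c \<le> s $ k" "s $ k < int (Suc N) - int c" using that unfolding I_def lattice_box_def by blast+
        then show ?thesis using c[of k] by linarith
      qed
      then show "s \<in> window N" "s - u \<in> window N" unfolding window_def lattice_box_def by auto
    qed
    have "real (card I) = (\<Sum>s\<in>I. 1)" by simp
    also have "\<dots> = (\<Sum>s\<in>I. if s - u \<in> window N then 1 else 0)" using I by (intro sum.cong) auto
    also have "\<dots> \<le> (\<Sum>s\<in>window N. if s - u \<in> window N then 1 else 0)"
      using I by (intro sum_mono2) auto
    finally have "real (card I) / real (card (window N :: (int ^ 'd) set)) \<le> fejer_weight N u"
      unfolding fejer_weight_def inner by (intro divide_right_mono) auto
    moreover have "real (card I) = (real N + 1 - 2 * real c) ^ CARD('d)"
    proof -
      have "int (Suc N) - int c - int c = int (Suc N - 2 * c)" using that by simp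
      then have "nat (int (Suc N) - int c - int c) = Suc N - 2 * c" by (simp only: nat_int)
      then have "card I = (Suc N - 2 * c) ^ CARD('d)"
        using finite_card_lattice_box[where 'd = 'd, of "int c" "int (Suc N) - int c"] that
        by (simp only: I_def)
      then show ?thesis using that by (simp add: of_nat_diff add.commute)
    qed
    moreover have "real (card (window N :: (int ^ 'd) set)) = (real N + 1) ^ CARD('d)"
      by (simp add: card_window add.commute)
    ultimately show ?thesis by (simp add: power_divide)
  qed
  have "(\<lambda>N. 1 - 2 * real c * inverse (real (Suc N))) \<longlonglongrightarrow> 1 - 2 * real c * 0"
    by (intro tendsto_intros LIMSEQ_inverse_real_of_nat)
  moreover have "1 - 2 * real c * inverse (real (Suc N)) = (real N + 1 - 2 * real c) / (real N + 1)" for N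
    by (simp add: field_simps)
  ultimately have "(\<lambda>N. (real N + 1 - 2 * real c) / (real N + 1)) \<longlonglongrightarrow> 1" by simp
  from tendsto_power[OF this, of "CARD('d)"]
  have low: "(\<lambda>N. ((real N + 1 - 2 * real c) / (real N + 1)) ^ CARD('d)) \<longlonglongrightarrow> 1" by simp
  show ?thesis
    by (rule tendsto_sandwich[OF _ _ low tendsto_const])
      (use ge le in \<open>auto simp: eventually_sequentially\<close>)
qed

lemma integrable_mult_bounded:
  fixes f g :: "real ^ 'd \<Rightarrow> complex"
  assumes "integrable torus_measure f" "g \<in> borel_measurable torus_measure" "\<And>\<theta>. norm (g \<theta>) \<le> C"
  shows "integrable torus_measure (\<lambda>\<theta>. f \<theta> * g \<theta>)"
proof (rule Bochner_Integration.integrable_bound)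
  show "integrable torus_measure (\<lambda>\<theta>. C * norm (f \<theta>))" using assms by simp
  show "AE \<theta> in torus_measure. norm (f \<theta> * g \<theta>) \<le> norm (C * norm (f \<theta>))"
  proof (rule AE_I2)
    fix \<theta>
    have "norm (f \<theta>) * norm (g \<theta>) \<le> norm (f \<theta>) * C" by (intro mult_left_mono assms) simp
    moreover have "0 \<le> C" using assms(3) norm_ge_zero order_trans by blast
    ultimately show "norm (f \<theta> * g \<theta>) \<le> norm (C * norm (f \<theta>))"
      by (simp add: norm_mult abs_mult mult.commute)
  qed
qed (use assms in auto)

lemma integrable_mult_cis:
  "integrable torus_measure f \<Longrightarrow> integrable torus_measure (\<lambda>\<theta>. f \<theta> * cis (pairing \<theta> u))"
  by (rule integrable_mult_bounded[where C = 1]) auto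

lemma fourier_coeff_linear:
  "integrable torus_measure f \<Longrightarrow> integrable torus_measure g \<Longrightarrow>
    fourier_coeff (\<lambda>\<theta>. f \<theta> + g \<theta>) u = fourier_coeff f u + fourier_coeff g u"
  "integrable torus_measure f \<Longrightarrow> integrable torus_measure g \<Longrightarrow>
    fourier_coeff (\<lambda>\<theta>. f \<theta> - g \<theta>) u = fourier_coeff f u - fourier_coeff g u"
  by (simp_all add: fourier_coeff_def distrib_right left_diff_distrib integrable_mult_cis)

lemma fejer_mean_linear:
  "fejer_mean N (\<lambda>u. c u + d u) \<theta> = fejer_mean N c \<theta> + fejer_mean N d \<theta>"
  "fejer_mean N (\<lambda>u. c u - d u) \<theta> = fejer_mean N c \<theta> - fejer_mean N d \<theta>"
  by (simp_all add: fejer_mean_def distrib_right left_diff_distrib sum.distrib sum_subtractf add_divide_distrib diff_divide_distrib)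

lemma continuous_on_fejer_mean: "continuous_on A (fejer_mean N c)"
  unfolding fejer_mean_def by (intro continuous_intros) simp

lemma measurable_fejer_mean [measurable]: "fejer_mean N c \<in> borel_measurable torus_measure"
  by (intro borel_measurable_torus_continuous continuous_on_fejer_mean)

text \<open>The kernel is a normalized squared modulus, hence nonnegative; truncated Fourier series
  lack this property.\<close>

lemma fejer_mean_fourier_coeff:
  fixes f :: "real ^ 'd \<Rightarrow> complex"
  assumes f: "integrable torus_measure f"
  shows "fejer_mean N (fourier_coeff f) \<theta> =
    (LINT \<phi>|torus_measure. f \<phi> * of_real ((norm (\<Sum>s\<in>window N. cis (pairing (\<phi> - \<theta>) s)))\<^sup>2 / card (window N :: (int ^ 'd) set)))"
    (is "_ = (LINT \<phi>|_. f \<phi> * of_real (?K \<phi>))")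
proof -
  have e: "f \<phi> * of_real (?K \<phi>) = (\<Sum>s\<in>window N. \<Sum>t\<in>window N.
      f \<phi> * cis (pairing \<phi> (s - t)) * cis (- pairing \<theta> (s - t))) / card (window N :: (int ^ 'd) set)" for \<phi>
  proof -
    have "complex_of_real ((norm (\<Sum>s\<in>window N. cis (pairing (\<phi> - \<theta>) s)))\<^sup>2) =
        (\<Sum>s\<in>window N. \<Sum>t\<in>window N. cis (pairing (\<phi> - \<theta>) s) * cis (- pairing (\<phi> - \<theta>) t))"
      unfolding complex_norm_square by (simp add: cis_cnj sum_product)
    also have "\<dots> = (\<Sum>s\<in>window N. \<Sum>t\<in>window N. cis (pairing \<phi> (s - t)) * cis (- pairing \<theta> (s - t)))"
      by (intro sum.cong refl) (simp add: cis_mult pairing_linear algebra_simps)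
    finally show ?thesis by (simp add: sum_distrib_left mult.assoc)
  qed
  show ?thesis unfolding e
    by (simp add: fejer_mean_def fourier_coeff_def integrable_mult_cis[OF f])
qed

text \<open>An average against a nonnegative kernel of total mass 1. The mass is the Fejer mean of
  the constant function 1, computed from its coefficients.\<close>

lemma fejer_mean_norm_le:
  fixes f :: "real ^ 'd \<Rightarrow> complex"
  assumes f: "f \<in> borel_measurable torus_measure" and C: "AE \<theta> in torus_measure. norm (f \<theta>) \<le> C"
  shows "norm (fejer_mean N (fourier_coeff f) \<theta>) \<le> C"
proof -
  let ?K = "\<lambda>\<phi>. (norm (\<Sum>s\<in>window N. cis (pairing (\<phi> - \<theta>) s)))\<^sup>2 / card (window N :: (int ^ 'd) set)"
  have fi: "integrable torus_measure f" using f C by (intro torus.integrable_const_bound[of _ C]) auto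
  have one: "fejer_mean N (fourier_coeff (\<lambda>_. 1)) \<theta> = 1"
  proof -
    have "fejer_mean N (fourier_coeff (\<lambda>_. 1)) \<theta> =
        (\<Sum>s\<in>(window N :: (int ^ 'd) set). \<Sum>t\<in>window N. if t = s then 1 else (0 :: complex)) / of_nat (card (window N :: (int ^ 'd) set))"
    proof -
      have "fourier_coeff (\<lambda>_. 1) (s - t) * cis (- pairing \<theta> (s - t)) = (if t = s then 1 else 0)" for s t
        unfolding fourier_coeff_def mult_1_left integral_torus_cis by (auto simp: pairing_linear(3))
      then show ?thesis unfolding fejer_mean_def by simp
    qed
    then show ?thesis by simp
  qed
  then have K1: "(LINT \<phi>|torus_measure. ?K \<phi>) = 1"
    unfolding fejer_mean_fourier_coeff[OF torus.integrable_const] mult_1_left integral_complex_of_real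
    by (simp only: of_real_eq_1_iff)
  \<comment> \<open>The integral of a non-integrable function is 0, so the value 1 already yields
    integrability.\<close>
  have Ki: "integrable torus_measure ?K"
    using K1 not_integrable_integral_eq by fastforce
  have "norm (fejer_mean N (fourier_coeff f) \<theta>) \<le> (LINT \<phi>|torus_measure. C * ?K \<phi>)"
    unfolding fejer_mean_fourier_coeff[OF fi]
  proof (rule order_trans[OF integral_norm_bound integral_mono_AE'])
    show "integrable torus_measure (\<lambda>\<phi>. C * ?K \<phi>)" using Ki by (rule integrable_mult_right)
    show "AE \<phi> in torus_measure. norm (f \<phi> * of_real (?K \<phi>)) \<le> C * ?K \<phi>"
      using C
    proof eventually_elim
      case (elim \<phi>)
      have "norm (f \<phi> * of_real (?K \<phi>)) = norm (f \<phi>) * ?K \<phi>"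
        unfolding norm_mult norm_of_real by simp
      also have "\<dots> \<le> C * ?K \<phi>" by (intro mult_right_mono elim) simp
      finally show ?case .
    qed
    have "AE \<phi> in (torus_measure :: (real ^ 'd) measure). 0 \<le> C"
      by (rule eventually_mono[OF C]) (erule order_trans[OF norm_ge_zero])
    then have "0 \<le> C" by simp
    then show "AE \<phi> in torus_measure. 0 \<le> C * ?K \<phi>" by simp
  qed
  also have "\<dots> = C * (LINT \<phi>|torus_measure. ?K \<phi>)" by (rule integral_mult_right_zero)
  also have "\<dots> = C" unfolding K1 by simp
  finally show ?thesis .
qed

text \<open>The means are symmetric operators, so the bound in the supremum norm dualizes to one in the
  \<open>L\<^sup>1\<close> norm.\<close>

lemma fejer_mean_symmetric:
  fixes f g :: "real ^ 'd \<Rightarrow> complex"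
  assumes f: "integrable torus_measure f" and g: "integrable torus_measure g"
  shows "(LINT \<theta>|torus_measure. g \<theta> * fejer_mean N (fourier_coeff f) \<theta>) =
    (LINT \<theta>|torus_measure. f \<theta> * fejer_mean N (fourier_coeff g) \<theta>)"
proof -
  have *: "(LINT \<theta>|torus_measure. g \<theta> * fejer_mean N c \<theta>) =
      (\<Sum>s\<in>window N. \<Sum>t\<in>window N. c (s - t) * fourier_coeff g (t - s)) / card (window N :: (int ^ 'd) set)"
    if g: "integrable torus_measure g" for g :: "real ^ 'd \<Rightarrow> complex" and c
  proof -
    have "g \<theta> * fejer_mean N c \<theta> = (\<Sum>s\<in>window N. \<Sum>t\<in>window N. c (s - t) * (g \<theta> * cis (pairing \<theta> (t - s)))) / card (window N :: (int ^ 'd) set)" for \<theta>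
    proof -
      have "- pairing \<theta> (s - t) = pairing \<theta> (t - s)" for s t by (simp add: pairing_linear)
      then show ?thesis by (simp add: fejer_mean_def sum_distrib_left mult_ac)
    qed
    then show ?thesis by (simp add: fourier_coeff_def integrable_mult_cis[OF g])
  qed
  show ?thesis unfolding *[OF f] *[OF g] by (subst sum.swap) (simp add: mult.commute)
qed

lemma fejer_mean_L1_le:
  assumes f: "integrable torus_measure f"
  shows "(LINT \<theta>|torus_measure. norm (fejer_mean N (fourier_coeff f) \<theta>)) \<le> (LINT \<theta>|torus_measure. norm (f \<theta>))"
proof -
  define F where "F = fejer_mean N (fourier_coeff f)"
  \<comment> \<open>The conjugate phase of \<open>F\<close>, with value 0 where \<open>F\<close>
    vanishes; pairing it with \<open>F\<close> gives the mean norm of \<open>F\<close>.\<close>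
  define g where "g \<theta> = cnj (F \<theta>) / norm (F \<theta>)" for \<theta>
  have Fm: "F \<in> borel_measurable torus_measure" unfolding F_def by measurable
  have gm: "g \<in> borel_measurable torus_measure"
  proof -
    have "(\<lambda>\<theta>. cnj (F \<theta>)) \<in> borel_measurable torus_measure"
      unfolding F_def by (intro borel_measurable_torus_continuous continuous_intros continuous_on_fejer_mean)
    with Fm show ?thesis unfolding g_def by measurable
  qed
  have g1: "norm (g \<theta>) \<le> 1" for \<theta> by (simp add: g_def norm_divide)
  have gF: "g \<theta> * F \<theta> = of_real (norm (F \<theta>))" for \<theta>
    using complex_norm_square[of "F \<theta>"] by (cases "F \<theta> = 0") (auto simp: g_def power2_eq_square field_simps)
  have gi: "integrable torus_measure g" using gm g1 by (rule integrable_torus_bounded)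
  have Tg: "norm (fejer_mean N (fourier_coeff g) \<theta>) \<le> 1" for \<theta>
    using gm g1 by (intro fejer_mean_norm_le) auto
  have "complex_of_real (LINT \<theta>|torus_measure. norm (F \<theta>)) = (LINT \<theta>|torus_measure. g \<theta> * F \<theta>)"
    unfolding gF by simp
  also have "\<dots> = (LINT \<theta>|torus_measure. f \<theta> * fejer_mean N (fourier_coeff g) \<theta>)"
    unfolding F_def by (rule fejer_mean_symmetric[OF f gi])
  finally have "(LINT \<theta>|torus_measure. norm (F \<theta>)) = Re (LINT \<theta>|torus_measure. f \<theta> * fejer_mean N (fourier_coeff g) \<theta>)"
    by (metis Re_complex_of_real)
  also have "\<dots> \<le> norm (LINT \<theta>|torus_measure. f \<theta> * fejer_mean N (fourier_coeff g) \<theta>)"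
    by (rule complex_Re_le_cmod)
  also have "\<dots> \<le> (LINT \<theta>|torus_measure. norm (f \<theta>))"
  proof (rule order_trans[OF integral_norm_bound integral_mono'])
    fix \<theta>
    show "norm (f \<theta> * fejer_mean N (fourier_coeff g) \<theta>) \<le> norm (f \<theta>)"
      using mult_left_mono[OF Tg[of \<theta>], of "norm (f \<theta>)"] by (simp add: norm_mult)
  qed (use f in auto)
  finally show ?thesis by (simp add: F_def)
qed

lemma integrable_fejer_mean:
  fixes c :: "int ^ 'd \<Rightarrow> complex"
  shows "integrable torus_measure (fejer_mean N c)"
proof -
  have "norm (fejer_mean N c \<theta>) \<le> (\<Sum>s\<in>window N. \<Sum>t\<in>window N. norm (c (s - t))) / card (window N :: (int ^ 'd) set)" for \<theta>
    unfolding fejer_mean_def norm_divide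
    by (auto intro!: divide_right_mono sum_norm_le simp: norm_mult)
  then show ?thesis by (intro integrable_torus_bounded) auto
qed

lemma fejer_mean_monomial:
  fixes v :: "int ^ 'd"
  shows "fejer_mean N (fourier_coeff (\<lambda>\<theta>. c * cis (pairing \<theta> v))) \<theta> = fejer_weight N v * (c * cis (pairing \<theta> v))"
proof -
  \<comment> \<open>Under the sign convention of \<open>fourier_coeff\<close>, the monomial of
    frequency \<open>v\<close> has its only coefficient at \<open>- v\<close>; the symmetry of the
    weights removes the sign.\<close>
  have "fourier_coeff (\<lambda>\<theta>. c * cis (pairing \<theta> v)) u = (if u = - v then c else 0)" for u :: "int ^ 'd"
  proof -
    have e: "c * cis (pairing \<theta> v) * cis (pairing \<theta> u) = c * cis (pairing \<theta> (v + u))" for \<theta>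
      by (simp add: pairing_linear cis_mult)
    have "v + u = 0 \<longleftrightarrow> u = - v" by (metis add.commute add_eq_0_iff)
    then show ?thesis unfolding fourier_coeff_def e by (simp add: integral_torus_cis)
  qed
  then have "fejer_mean N (fourier_coeff (\<lambda>\<theta>. c * cis (pairing \<theta> v))) \<theta> =
      (\<Sum>s\<in>window N. \<Sum>t\<in>window N. (if s - t = - v then 1 else 0) * (c * cis (pairing \<theta> v))) / card (window N :: (int ^ 'd) set)"
    unfolding fejer_mean_def by (intro arg_cong2[of _ _ _ _ "(/)"] sum.cong refl) (auto simp: pairing_linear(4))
  also have "\<dots> = fejer_weight N (- v) * (c * cis (pairing \<theta> v))"
    by (simp add: fejer_weight_def sum_distrib_right if_distrib[of complex_of_real] cong: if_cong)
  finally show ?thesis by (simp add: fejer_weight_minus)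
qed

lemma fejer_mean_trig_polynomial_tendsto:
  assumes "trig_polynomial p"
  shows "(\<lambda>N. LINT \<theta>|torus_measure. norm (fejer_mean N (fourier_coeff p) \<theta> - p \<theta>)) \<longlonglongrightarrow> 0"
  using assms
proof induction
  case (monomial c u)
  have "norm (fejer_mean N (fourier_coeff (\<lambda>\<theta>. c * cis (pairing \<theta> u))) \<theta> - c * cis (pairing \<theta> u)) =
      \<bar>fejer_weight N u - 1\<bar> * norm c" for N \<theta>
  proof -
    have "fejer_mean N (fourier_coeff (\<lambda>\<theta>. c * cis (pairing \<theta> u))) \<theta> - c * cis (pairing \<theta> u) =
        complex_of_real (fejer_weight N u - 1) * (c * cis (pairing \<theta> u))"
      unfolding fejer_mean_monomial by (simp add: algebra_simps)
    then show ?thesis by (simp only: norm_mult norm_of_real norm_cis mult_1_right)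
  qed
  then have "(\<lambda>N. LINT \<theta>|torus_measure. norm (fejer_mean N (fourier_coeff (\<lambda>\<theta>. c * cis (pairing \<theta> u))) \<theta> - c * cis (pairing \<theta> u))) =
      (\<lambda>N. \<bar>fejer_weight N u - 1\<bar> * norm c)" by simp
  moreover have "(\<lambda>N. \<bar>fejer_weight N u - 1\<bar> * norm c) \<longlonglongrightarrow> \<bar>1 - 1\<bar> * norm c"
    by (intro tendsto_intros fejer_weight_tendsto)
  ultimately show ?case by simp
next
  case (add p q)
  note pi = trig_polynomial_integrable[OF add.hyps(1)] and qi = trig_polynomial_integrable[OF add.hyps(2)]
  have i: "integrable torus_measure (\<lambda>\<theta>. norm (fejer_mean N (fourier_coeff p) \<theta> - p \<theta>))"
    "integrable torus_measure (\<lambda>\<theta>. norm (fejer_mean N (fourier_coeff q) \<theta> - q \<theta>))" for N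
    using pi qi integrable_fejer_mean[of N] by (auto intro!: integrable_norm Bochner_Integration.integrable_diff)
  have e: "fejer_mean N (fourier_coeff (\<lambda>\<theta>. p \<theta> + q \<theta>)) \<theta> - (p \<theta> + q \<theta>) =
      (fejer_mean N (fourier_coeff p) \<theta> - p \<theta>) + (fejer_mean N (fourier_coeff q) \<theta> - q \<theta>)" for N \<theta>
    unfolding fourier_coeff_linear(1)[OF pi qi] fejer_mean_linear by simp
  have "(LINT \<theta>|torus_measure. norm (fejer_mean N (fourier_coeff (\<lambda>\<theta>. p \<theta> + q \<theta>)) \<theta> - (p \<theta> + q \<theta>))) \<le>
      (LINT \<theta>|torus_measure. norm (fejer_mean N (fourier_coeff p) \<theta> - p \<theta>) + norm (fejer_mean N (fourier_coeff q) \<theta> - q \<theta>))" for N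
    unfolding e using i by (intro integral_mono') (simp_all add: norm_triangle_ineq)
  then have le: "(LINT \<theta>|torus_measure. norm (fejer_mean N (fourier_coeff (\<lambda>\<theta>. p \<theta> + q \<theta>)) \<theta> - (p \<theta> + q \<theta>))) \<le>
      (LINT \<theta>|torus_measure. norm (fejer_mean N (fourier_coeff p) \<theta> - p \<theta>)) +
      (LINT \<theta>|torus_measure. norm (fejer_mean N (fourier_coeff q) \<theta> - q \<theta>))" for N
    using i by simp
  show ?case
    by (rule tendsto_sandwich[OF _ _ tendsto_const tendsto_add_zero[OF add.IH]]) (use le in auto)
qed

text \<open>A trigonometric polynomial \<open>p\<close> close to \<open>f\<close> in the mean has
  convergent Fejer means. The mean of the remainder \<open>f - p\<close> is controlled uniformly in
  \<open>N\<close> by the contraction \<open>fejer_mean_L1_le\<close>.\<close>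

theorem fejer_mean_tendsto:
  assumes f[measurable]: "f \<in> borel_measurable torus_measure" and C: "AE \<theta> in torus_measure. norm (f \<theta>) \<le> C"
  shows "(\<lambda>N. LINT \<theta>|torus_measure. norm (fejer_mean N (fourier_coeff f) \<theta> - f \<theta>)) \<longlonglongrightarrow> 0"
proof (rule order_tendstoI)
  fix e :: real assume "e < 0"
  then show "\<forall>\<^sub>F N in sequentially. e < (LINT \<theta>|torus_measure. norm (fejer_mean N (fourier_coeff f) \<theta> - f \<theta>))"
    by (intro always_eventually allI) (auto intro: less_le_trans)
next
  fix e :: real assume "0 < e"
  then obtain p where p: "trig_polynomial p" "(LINT \<theta>|torus_measure. norm (f \<theta> - p \<theta>)) < e / 3"
    using trig_polynomial_dense[OF f C, of "e / 3"] by auto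
  have fi: "integrable torus_measure f" using f C by (intro torus.integrable_const_bound[of _ C]) auto
  note pi = trig_polynomial_integrable[OF p(1)]
  note fm = integrable_fejer_mean
  have le: "(LINT \<theta>|torus_measure. norm (fejer_mean N (fourier_coeff f) \<theta> - f \<theta>)) \<le>
      (LINT \<theta>|torus_measure. norm (f \<theta> - p \<theta>)) + (LINT \<theta>|torus_measure. norm (fejer_mean N (fourier_coeff p) \<theta> - p \<theta>))
      + (LINT \<theta>|torus_measure. norm (f \<theta> - p \<theta>))" for N
  proof -
    let ?r = "\<lambda>\<theta>. f \<theta> - p \<theta>"
    have i: "integrable torus_measure (\<lambda>\<theta>. norm (fejer_mean N (fourier_coeff ?r) \<theta>))"
      "integrable torus_measure (\<lambda>\<theta>. norm (fejer_mean N (fourier_coeff p) \<theta> - p \<theta>))"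
      "integrable torus_measure (\<lambda>\<theta>. norm (f \<theta> - p \<theta>))"
      using fi pi fm by (auto intro!: integrable_norm Bochner_Integration.integrable_diff)
    have "norm (fejer_mean N (fourier_coeff f) \<theta> - f \<theta>) \<le>
        norm (fejer_mean N (fourier_coeff ?r) \<theta>) + norm (fejer_mean N (fourier_coeff p) \<theta> - p \<theta>) + norm (f \<theta> - p \<theta>)" for \<theta>
    proof -
      have "fejer_mean N (fourier_coeff f) \<theta> - f \<theta> =
          (fejer_mean N (fourier_coeff ?r) \<theta> + (fejer_mean N (fourier_coeff p) \<theta> - p \<theta>)) - (f \<theta> - p \<theta>)"
        unfolding fourier_coeff_linear(2)[OF fi pi] fejer_mean_linear by simp
      then show ?thesis
        by (metis (no_types, lifting) add_mono_thms_linordered_semiring(3) norm_triangle_ineq norm_triangle_ineq4 order_trans)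
    qed
    then have "(LINT \<theta>|torus_measure. norm (fejer_mean N (fourier_coeff f) \<theta> - f \<theta>)) \<le>
        (LINT \<theta>|torus_measure. norm (fejer_mean N (fourier_coeff ?r) \<theta>) + norm (fejer_mean N (fourier_coeff p) \<theta> - p \<theta>) + norm (f \<theta> - p \<theta>))"
      using i by (intro integral_mono') auto
    also have "\<dots> = (LINT \<theta>|torus_measure. norm (fejer_mean N (fourier_coeff ?r) \<theta>)) +
        (LINT \<theta>|torus_measure. norm (fejer_mean N (fourier_coeff p) \<theta> - p \<theta>)) + (LINT \<theta>|torus_measure. norm (f \<theta> - p \<theta>))"
      using i by simp
    finally show ?thesis
      using fejer_mean_L1_le[of ?r N] fi pi by auto
  qed
  have "\<forall>\<^sub>F N in sequentially. (LINT \<theta>|torus_measure. norm (fejer_mean N (fourier_coeff p) \<theta> - p \<theta>)) < e / 3"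
    using \<open>0 < e\<close> by (intro order_tendstoD(2)[OF fejer_mean_trig_polynomial_tendsto[OF p(1)]]) simp
  then show "\<forall>\<^sub>F N in sequentially. (LINT \<theta>|torus_measure. norm (fejer_mean N (fourier_coeff f) \<theta> - f \<theta>)) < e"
  proof eventually_elim
    case (elim N)
    then show ?case using le[of N] p(2) by linarith
  qed
qed

text \<open>The family \<open>c\<close> is arbitrary, so this applies to cross covariances, which
  need not be the Fourier coefficients of any function.\<close>

lemma fourier_coeff_fejer_mean:
  fixes u :: "int ^ 'd" and c :: "int ^ 'd \<Rightarrow> complex"
  shows "fourier_coeff (fejer_mean N c) u = fejer_weight N u * c u"
proof -
  have e: "fejer_mean N c \<theta> * cis (pairing \<theta> u) =
      (\<Sum>s\<in>window N. \<Sum>t\<in>window N. c (s - t) * cis (pairing \<theta> (u - (s - t)))) / card (window N :: (int ^ 'd) set)" for \<theta>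
  proof -
    have "cis (- pairing \<theta> (s - t)) * cis (pairing \<theta> u) = cis (pairing \<theta> (u - (s - t)))" for s t
      by (simp add: cis_mult pairing_linear algebra_simps)
    then show ?thesis by (simp add: fejer_mean_def sum_distrib_right mult.assoc)
  qed
  have i: "integrable torus_measure (\<lambda>\<theta>. cis (pairing \<theta> u))" for u :: "int ^ 'd"
    by (rule integrable_torus_bounded[where C = 1]) auto
  have "fourier_coeff (fejer_mean N c) u =
      (\<Sum>s\<in>window N. \<Sum>t\<in>window N. c (s - t) * (if u - (s - t) = 0 then 1 else 0)) / card (window N :: (int ^ 'd) set)"
    unfolding fourier_coeff_def e using i by (simp add: integral_torus_cis)
  also have "\<dots> = (\<Sum>s\<in>window N. \<Sum>t\<in>window N. (if s - t = u then 1 else 0) * c u) / card (window N :: (int ^ 'd) set)"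
    by (intro arg_cong2[of _ _ _ _ "(/)"] sum.cong refl) auto
  also have "\<dots> = fejer_weight N u * c u"
    by (simp add: fejer_weight_def sum_distrib_right if_distrib[of complex_of_real] cong: if_cong)
  finally show ?thesis .
qed

section \<open>Laws of Gaussian fields\<close>

lemma normal_distribution_moments:
  fixes a \<sigma> :: real
  assumes "0 < \<sigma>"
  defines "\<mu> \<equiv> density lborel (\<lambda>x. ennreal (normal_density a \<sigma> x))"
  shows "integrable \<mu> (\<lambda>x. x)" "(LINT x|\<mu>. x) = a" "integrable \<mu> (\<lambda>x. x\<^sup>2)" "(LINT x|\<mu>. x\<^sup>2) = \<sigma>\<^sup>2 + a\<^sup>2"
proof -
  show "integrable \<mu> (\<lambda>x. x)" "(LINT x|\<mu>. x) = a"
    unfolding \<mu>_def using integrable_normal_moment_nz_1[OF assms(1)] integral_normal_moment_nz_1[OF assms(1)]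
    by (auto simp: integrable_real_density integral_real_density)
  have e: "normal_density a \<sigma> x * x\<^sup>2 = normal_density a \<sigma> x * (x - a)^2 +
      (2 * a) * (normal_density a \<sigma> x * x) - a\<^sup>2 * normal_density a \<sigma> x" for x
    by (simp add: power2_eq_square algebra_simps)
  have i: "integrable lborel (\<lambda>x. normal_density a \<sigma> x * (x - a)^2)"
    using integrable_normal_moment[OF assms(1)] by simp
  note i = i integrable_normal_moment_nz_1[OF assms(1)] integrable_normal_density[OF assms(1)]
  have "integrable lborel (\<lambda>x. normal_density a \<sigma> x * x\<^sup>2)"
    unfolding e using i by (intro Bochner_Integration.integrable_add Bochner_Integration.integrable_diff integrable_mult_right)
  then show "integrable \<mu> (\<lambda>x. x\<^sup>2)"
    unfolding \<mu>_def by (simp add: integrable_real_density)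
  have "(LINT x|lborel. normal_density a \<sigma> x * x\<^sup>2) = \<sigma>\<^sup>2 + 2 * a * a - a\<^sup>2"
    unfolding e using i integral_normal_moment_nz_1[OF assms(1), of a]
      integral_normal_moment_even[OF assms(1), of a 1]
    by (simp add: integral_normal_density assms(1))
  then show "(LINT x|\<mu>. x\<^sup>2) = \<sigma>\<^sup>2 + a\<^sup>2"
    unfolding \<mu>_def by (simp add: integral_real_density power2_eq_square)
qed

lemma return_borel_moments:
  fixes a :: real
  shows "integrable (return borel a) (\<lambda>x. x)" "(LINT x|return borel a. x) = a"
    "integrable (return borel a) (\<lambda>x. x\<^sup>2)" "(LINT x|return borel a. x\<^sup>2) = a\<^sup>2"
proof -
  interpret prob_space "return borel a" by (rule prob_space_return) simp
  have "AE x in return borel a. norm x \<le> norm a" "AE x in return borel a. norm (x\<^sup>2) \<le> norm (a\<^sup>2)"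
    by (subst AE_return; simp)+
  then show "integrable (return borel a) (\<lambda>x. x)" "integrable (return borel a) (\<lambda>x. x\<^sup>2)"
    by (auto intro!: integrable_const_bound)
qed (simp_all add: integral_return)

lemma gaussian_distribution_integrable:
  assumes "gaussian_distribution \<mu>"
  shows "integrable \<mu> (\<lambda>x. x)" "integrable \<mu> (\<lambda>x. x\<^sup>2)"
  using assms normal_distribution_moments return_borel_moments
  unfolding gaussian_distribution_def by metis+

text \<open>For mean 0, a vanishing second moment singles out the point mass, and a positive one is
  the variance that fixes the normal law.\<close>

lemma gaussian_distribution_eqI:
  assumes "gaussian_distribution \<mu>" "gaussian_distribution \<nu>"
    and "(LINT x|\<mu>. x) = 0" "(LINT x|\<nu>. x) = 0" "(LINT x|\<mu>. x\<^sup>2) = (LINT x|\<nu>. x\<^sup>2)"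
  shows "\<mu> = \<nu>"
proof -
  have "(\<mu> = return borel 0 \<and> (LINT x|\<mu>. x\<^sup>2) = 0) \<or>
      (\<exists>\<sigma>. 0 < \<sigma> \<and> (LINT x|\<mu>. x\<^sup>2) = \<sigma>\<^sup>2 \<and> \<mu> = density lborel (\<lambda>x. ennreal (normal_density 0 \<sigma> x)))"
    if "gaussian_distribution \<mu>" "(LINT x|\<mu>. x) = 0" for \<mu>
    using that unfolding gaussian_distribution_def
    by (auto simp: normal_distribution_moments return_borel_moments)
  from this[OF assms(1,3)] this[OF assms(2,4)] assms(5) show ?thesis
    by (auto simp: power2_eq_iff_nonneg)
qed

lemma space_path_space [simp]: "space path_space = UNIV"
  by (simp add: path_space_def space_PiM)

lemma measurable_path [measurable]: "(\<lambda>z. z t) \<in> borel_measurable path_space"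
  unfolding path_space_def by (rule measurable_component_singleton) simp

lemma gaussian_field_functional:
  fixes P :: "(int ^ 'd \<Rightarrow> real ^ 'n) measure" and a :: "int ^ 'd \<Rightarrow> real ^ 'n"
  assumes "gaussian_field P" "zero_mean_field P" "sets P = sets path_space" "finite T"
  defines "L \<equiv> \<lambda>z. \<Sum>t\<in>T. a t \<bullet> z t"
  shows "gaussian_distribution (distr P borel L)" "L \<in> borel_measurable P"
    "integrable P L" "(LINT z|P. L z) = 0" "integrable P (\<lambda>z. (L z)\<^sup>2)"
proof -
  note [measurable_cong] = assms(3)
  show g: "gaussian_distribution (distr P borel L)"
    using assms unfolding gaussian_field_def by blast
  show [measurable]: "L \<in> borel_measurable P" unfolding L_def by measurable
  show "integrable P L" "integrable P (\<lambda>z. (L z)\<^sup>2)"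
    using gaussian_distribution_integrable[OF g] by (auto simp: integrable_distr_eq)
  show "(LINT z|P. L z) = 0"
    using assms(2) unfolding L_def zero_mean_field_def by simp
qed

lemma field_component_eq:
  fixes z :: "int ^ 'd \<Rightarrow> real ^ 'n"
  shows "z t $ i = (\<Sum>s\<in>{t}. axis i 1 \<bullet> z s)"
  by (simp add: inner_axis' )

lemma gaussian_field_component:
  fixes P :: "(int ^ 'd \<Rightarrow> real ^ 'n) measure"
  assumes "gaussian_field P" "zero_mean_field P" "sets P = sets path_space"
  shows "(\<lambda>z. z t $ i) \<in> borel_measurable P" "integrable P (\<lambda>z. (z t $ i)\<^sup>2)"
    "integrable P (\<lambda>z. z s $ i * z t $ j)"
proof -
  note f = gaussian_field_functional[OF assms, of "{_}" "\<lambda>_. axis _ 1", simplified field_component_eq[symmetric]]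
  show m: "(\<lambda>z. z t $ i) \<in> borel_measurable P" for t i using f(2) by simp
  show i: "integrable P (\<lambda>z. (z t $ i)\<^sup>2)" for t i using f(5) by simp
  have "norm (z s $ i * z t $ j) \<le> norm ((z s $ i)\<^sup>2 + (z t $ j)\<^sup>2)" for z :: "int ^ 'd \<Rightarrow> real ^ 'n"
  proof -
    have "norm (z s $ i * z t $ j) \<le> 2 * \<bar>z s $ i\<bar> * \<bar>z t $ j\<bar>" by (simp add: abs_mult)
    also have "\<dots> \<le> (z s $ i)\<^sup>2 + (z t $ j)\<^sup>2"
      using sum_squares_bound[of "\<bar>z s $ i\<bar>" "\<bar>z t $ j\<bar>"] by simp
    finally show ?thesis by simp
  qed
  then show "integrable P (\<lambda>z. z s $ i * z t $ j)"
    using m by (intro Bochner_Integration.integrable_bound[OF Bochner_Integration.integrable_add[OF i[of s i] i[of t j]]]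
        borel_measurable_times) auto
qed

lemma field_functional_second_moment:
  fixes P :: "(int ^ 'd \<Rightarrow> real ^ 'n) measure"
  assumes "gaussian_field P" "zero_mean_field P" "sets P = sets path_space"
  shows "(LINT z|P. (\<Sum>t\<in>T. a t \<bullet> z t) * (\<Sum>t\<in>T'. b t \<bullet> z t)) =
    (\<Sum>s\<in>T. \<Sum>t\<in>T'. \<Sum>i\<in>UNIV. \<Sum>j\<in>UNIV. a s $ i * b t $ j * covariance P s t $ i $ j)"
proof -
  have "(LINT z|P. (\<Sum>t\<in>T. a t \<bullet> z t) * (\<Sum>t\<in>T'. b t \<bullet> z t)) =
    (LINT z|P. (\<Sum>s\<in>T. \<Sum>t\<in>T'. \<Sum>i\<in>UNIV. \<Sum>j\<in>UNIV. a s $ i * b t $ j * (z s $ i * z t $ j)))"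
    by (simp add: inner_vec_def sum_product mult_ac)
  then show ?thesis
    using gaussian_field_component(3)[OF assms] by (simp add: covariance_def)
qed

section \<open>Laws of fields determined by characteristic functions\<close>

lemma measurable_cis [measurable]: "cis \<in> borel_measurable borel"
  unfolding cis_conv_exp by measurable

text \<open>Weighting both measures by \<open>h / m\<close>, with \<open>m\<close> the common mass
  of \<open>h\<close>, gives two probability measures under which \<open>f\<close> has the same
  characteristic function. For \<open>m = 0\<close> there is no normalization, and both sides
  vanish.\<close>

lemma integral_indicator_eq_of_char_eq_nonneg:
  fixes P Q :: "'a measure" and f h :: "'a \<Rightarrow> real"
  assumes "prob_space P" "prob_space Q" and s: "sets Q = sets P"
    and f[measurable]: "f \<in> borel_measurable P" and h[measurable]: "h \<in> borel_measurable P"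
    and h0: "\<And>x. 0 \<le> h x" and h2: "\<And>x. h x \<le> c"
    and eq: "\<And>s. (LINT x|P. complex_of_real (h x) * cis (s * f x)) = (LINT x|Q. complex_of_real (h x) * cis (s * f x))"
    and B[measurable]: "B \<in> sets borel"
  shows "(LINT x|P. h x * indicator B (f x)) = (LINT x|Q. h x * indicator B (f x))"
proof -
  interpret P: prob_space P by fact
  interpret Q: prob_space Q by fact
  note [measurable_cong] = s
  have iP: "integrable P h" and iQ: "integrable Q h"
    using h0 h2 by (auto intro!: P.integrable_const_bound[of _ c] Q.integrable_const_bound[of _ c])
  define m where "m = (LINT x|P. h x)"
  have mQ: "m = (LINT x|Q. h x)"
    using eq[of 0] unfolding m_def by simp
  have "0 \<le> m" unfolding m_def using h0 by simp
  show ?thesis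
  proof (cases "m = 0")
    case True
    then have "AE x in P. h x = 0" "AE x in Q. h x = 0"
      using mQ m_def iP iQ h0 integral_nonneg_eq_0_iff_AE[of P h] integral_nonneg_eq_0_iff_AE[of Q h] by auto
    then have "(LINT x|P. h x * indicator B (f x)) = 0" "(LINT x|Q. h x * indicator B (f x)) = 0"
      by (auto intro!: integral_eq_zero_AE)
    then show ?thesis by simp
  next
    case False
    then have m: "m > 0" using \<open>0 \<le> m\<close> by simp
    have dist: "real_distribution (distr (density M (\<lambda>x. ennreal (h x / m))) borel f)" (is "real_distribution ?D")
      and ch: "char (distr (density M (\<lambda>x. ennreal (h x / m))) borel f) t = (LINT x|M. complex_of_real (h x) * cis (t * f x)) / m"
      and me: "measure (distr (density M (\<lambda>x. ennreal (h x / m))) borel f) B = (LINT x|M. h x * indicator B (f x)) / m"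
      if M: "prob_space M" "sets M = sets P" "integrable M h" "m = (LINT x|M. h x)" for M t
    proof -
      interpret M: prob_space M by fact
      note [measurable_cong] = M(2)
      have "emeasure (density M (\<lambda>x. ennreal (h x / m))) (space M) = (\<integral>\<^sup>+x. ennreal (h x / m) \<partial>M)"
        by (subst emeasure_density) (auto intro!: nn_integral_cong)
      also have "\<dots> = ennreal (LINT x|M. h x / m)"
        using M m h0 by (intro nn_integral_eq_integral) auto
      also have "\<dots> = 1" using m M(4) by simp
      finally have p: "prob_space (density M (\<lambda>x. ennreal (h x / m)))"
        by (intro prob_spaceI) simp
      have fm: "f \<in> borel_measurable (density M (\<lambda>x. ennreal (h x / m)))" by measurable
      have "prob_space ?D" by (rule prob_space.prob_space_distr[OF p fm])
      then show "real_distribution ?D" by (simp add: real_distribution_def real_distribution_axioms_def)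
      have "char ?D t = (LINT x|density M (\<lambda>x. ennreal (h x / m)). cis (t * f x))"
        unfolding char_def cis_conv_exp[symmetric] by (rule integral_distr) (use fm in measurable)
      also have "\<dots> = (LINT x|M. (h x / m) *\<^sub>R cis (t * f x))"
        using h0 m by (intro integral_density) auto
      also have "\<dots> = (LINT x|M. complex_of_real (h x) * cis (t * f x) / m)"
        by (simp add: scaleR_conv_of_real)
      finally show "char ?D t = (LINT x|M. complex_of_real (h x) * cis (t * f x)) / m" by simp
      interpret D: prob_space ?D by fact
      have "measure ?D B = (LINT x|?D. indicator B x)" by simp
      also have "\<dots> = (LINT x|density M (\<lambda>x. ennreal (h x / m)). indicator B (f x))"
        by (rule integral_distr) (use fm in measurable)
      also have "\<dots> = (LINT x|M. (h x / m) *\<^sub>R indicator B (f x))"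
        using h0 m by (intro integral_density) auto
      finally show "measure ?D B = (LINT x|M. h x * indicator B (f x)) / m" by simp
    qed
    note P = dist[OF \<open>prob_space P\<close> refl iP m_def] ch[OF \<open>prob_space P\<close> refl iP m_def] me[OF \<open>prob_space P\<close> refl iP m_def]
    note Q = dist[OF \<open>prob_space Q\<close> s iQ mQ] ch[OF \<open>prob_space Q\<close> s iQ mQ] me[OF \<open>prob_space Q\<close> s iQ mQ]
    have "distr (density P (\<lambda>x. ennreal (h x / m))) borel f = distr (density Q (\<lambda>x. ennreal (h x / m))) borel f"
      by (rule Levy_uniqueness[OF P(1) Q(1)]) (simp add: fun_eq_iff P(2) Q(2) eq)
    then show ?thesis using P(3) Q(3) m by simp
  qed
qed

text \<open>A complex weight is recovered from the nonnegative weights \<open>1 + Re (c * g)\<close>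
  for \<open>c = 1\<close> and \<open>c = - \<i>\<close>, which give its real and imaginary parts.
  The conjugated weight is covered by replacing \<open>s\<close> with \<open>- s\<close>, the
  constant 1 by \<open>eq1\<close>.\<close>

lemma integral_indicator_eq_of_char_eq:
  fixes P Q :: "'a measure" and f :: "'a \<Rightarrow> real" and g :: "'a \<Rightarrow> complex"
  assumes "prob_space P" "prob_space Q" and s: "sets Q = sets P"
    and f[measurable]: "f \<in> borel_measurable P" and g[measurable]: "g \<in> borel_measurable P"
    and g1: "\<And>x. norm (g x) \<le> 1"
    and eq: "\<And>s. (LINT x|P. g x * cis (s * f x)) = (LINT x|Q. g x * cis (s * f x))"
    and eq1: "\<And>s. (LINT x|P. cis (s * f x)) = (LINT x|Q. cis (s * f x))"
    and B[measurable]: "B \<in> sets borel"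
  shows "(LINT x|P. g x * indicator B (f x)) = (LINT x|Q. g x * indicator B (f x))"
proof -
  interpret P: prob_space P by fact
  interpret Q: prob_space Q by fact
  note [measurable_cong] = s
  have int: "integrable M (\<lambda>x. u x * v x)"
    if "prob_space M" "u \<in> borel_measurable M" "v \<in> borel_measurable M" "\<And>x. norm (u x) \<le> 1" "\<And>x. norm (v x) \<le> 1"
    for M :: "'a measure" and u v :: "'a \<Rightarrow> complex"
  proof -
    interpret M: prob_space M by fact
    show ?thesis using that
      by (intro M.integrable_const_bound[of _ 1]) (auto simp: norm_mult intro!: mult_le_one)
  qed
  have [measurable]: "(\<lambda>x. cnj (g x)) \<in> borel_measurable P"
    by (rule measurable_compose[OF g]) (intro borel_measurable_continuous_onI continuous_intros)
  have cnj_eq: "(LINT x|P. cnj (g x) * cis (s * f x)) = (LINT x|Q. cnj (g x) * cis (s * f x))" for s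
  proof -
    have "(LINT x|M. cnj (g x) * cis (s * f x)) = cnj (LINT x|M. g x * cis (- s * f x))" for M
    proof -
      have "cnj (g x) * cis (s * f x) = cnj (g x * cis (- s * f x))" for x
        by (simp add: cis_cnj)
      then show ?thesis by (simp only: Bochner_Integration.integral_cnj)
    qed
    then show ?thesis using eq[of "- s"] by simp
  qed
  have comb: "(LINT x|M. complex_of_real (1 + Re (c * g x)) * cis (s * f x)) =
      (LINT x|M. cis (s * f x)) + (c / 2) * (LINT x|M. g x * cis (s * f x)) + (cnj c / 2) * (LINT x|M. cnj (g x) * cis (s * f x))"
    if M: "prob_space M" "sets M = sets P" for M c s
  proof -
    note [measurable_cong] = M(2)
    have i: "integrable M (\<lambda>x. g x * cis (s * f x))" "integrable M (\<lambda>x. cnj (g x) * cis (s * f x))"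
      using g1 by (auto intro!: int M(1))
    have i1: "integrable M (\<lambda>x. cis (s * f x))"
      using int[OF M(1), of "\<lambda>_. 1" "\<lambda>x. cis (s * f x)"] by simp
    have "complex_of_real (1 + Re (c * g x)) * cis (s * f x) =
        cis (s * f x) + (c / 2) * (g x * cis (s * f x)) + (cnj c / 2) * (cnj (g x) * cis (s * f x))" for x
    proof -
      have Re_eq: "complex_of_real (Re w) = (w + cnj w) / 2" for w
        by (simp add: complex_eq_iff)
      show ?thesis
        unfolding of_real_add of_real_1 Re_eq complex_cnj_mult by (simp add: algebra_simps add_divide_distrib)
    qed
    then have "(LINT x|M. complex_of_real (1 + Re (c * g x)) * cis (s * f x)) = (LINT x|M. cis (s * f x) +
        (c / 2) * (g x * cis (s * f x)) + (cnj c / 2) * (cnj (g x) * cis (s * f x)))" by (simp only:)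
    also have "\<dots> = (LINT x|M. cis (s * f x)) + (c / 2) * (LINT x|M. g x * cis (s * f x)) +
        (cnj c / 2) * (LINT x|M. cnj (g x) * cis (s * f x))"
      using i i1 by (simp only: Bochner_Integration.integral_add Bochner_Integration.integrable_add
          integrable_mult_right integral_mult_right_zero)
    finally show ?thesis .
  qed
  have le: "\<bar>Re (c * g x)\<bar> \<le> 1" if "norm c = 1" for c x
    using abs_Re_le_cmod[of "c * g x"] g1[of x] that by (simp add: norm_mult)
  have r: "(LINT x|P. (1 + Re (c * g x)) * indicator B (f x)) = (LINT x|Q. (1 + Re (c * g x)) * indicator B (f x))"
    if "norm c = 1" for c
  proof (rule integral_indicator_eq_of_char_eq_nonneg[of _ _ _ _ 2])
    fix s
    show "(LINT x|P. complex_of_real (1 + Re (c * g x)) * cis (s * f x)) = (LINT x|Q. complex_of_real (1 + Re (c * g x)) * cis (s * f x))"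
      unfolding comb[OF \<open>prob_space P\<close> refl] comb[OF \<open>prob_space Q\<close> s] eq eq1 cnj_eq ..
    fix x show "0 \<le> 1 + Re (c * g x)" "1 + Re (c * g x) \<le> 2" using le[OF that, of x] by (auto simp: abs_le_iff)
  qed (use assms in auto)
  have one: "(LINT x|P. indicator B (f x)) = (LINT x|Q. indicator B (f x) :: real)"
    using integral_indicator_eq_of_char_eq_nonneg[of P Q f "\<lambda>_. 1" 1 B] assms by simp
  have iB: "integrable M (\<lambda>x. indicator B (f x) :: real)" "integrable M (\<lambda>x. Re (c * g x) * indicator B (f x))"
     if M: "prob_space M" "sets M = sets P" "norm c = 1" for M c
  proof -
    interpret M: prob_space M by fact
    note [measurable_cong] = M(2)
    show "integrable M (\<lambda>x. indicator B (f x) :: real)"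
      by (rule M.integrable_const_bound[of _ 1]) (auto simp: indicator_def)
    show "integrable M (\<lambda>x. Re (c * g x) * indicator B (f x))"
      using le[OF M(3)] by (intro M.integrable_const_bound[of _ 1]) (auto simp: indicator_def simp del: times_complex.sel)
  qed
  have re: "(LINT x|P. Re (c * g x) * indicator B (f x)) = (LINT x|Q. Re (c * g x) * indicator B (f x))"
    if "norm c = 1" for c
    using r[OF that] one iB[OF \<open>prob_space P\<close> refl that] iB[OF \<open>prob_space Q\<close> s that]
    by (simp add: distrib_right del: times_complex.sel)
  have i: "integrable M (\<lambda>x. g x * indicator B (f x))" if M: "prob_space M" "sets M = sets P" for M
  proof -
    note [measurable_cong] = M(2)
    show ?thesis using g1 by (intro int M(1)) (auto simp: indicator_def)
  qed
  have Re_ind: "Re (x * indicator B y) = Re x * indicator B y" for x y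
    by (simp add: indicator_def)
  have rr: "Re (LINT x|P. c * (g x * indicator B (f x))) = Re (LINT x|Q. c * (g x * indicator B (f x)))" if "norm c = 1" for c
  proof -
    have *: "(LINT x|M. Re (c * g x) * indicator B (f x)) = Re (LINT x|M. c * (g x * indicator B (f x)))"
      if M: "prob_space M" "sets M = sets P" for M
    proof -
      have "(LINT x|M. Re (c * g x) * indicator B (f x)) = (LINT x|M. Re (c * (g x * indicator B (f x))))"
        by (simp only: mult.assoc[symmetric] Re_ind)
      also have "\<dots> = Re (LINT x|M. c * (g x * indicator B (f x)))"
        by (intro integral_Re integrable_mult_right i M)
      finally show ?thesis .
    qed
    show ?thesis
      using re[OF that] unfolding *[OF \<open>prob_space P\<close> refl] *[OF \<open>prob_space Q\<close> s] .
  qed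
  show ?thesis
    using rr[of 1] rr[of "- \<i>"] unfolding integral_mult_right_zero by (simp add: complex_eq_iff)
qed

text \<open>Exponential factors are traded for indicators one coordinate at a time, so that only
  uniqueness for laws on the real line is used. Once all factors are indicators, the laws agree on
  an intersection-stable generator of the path space.\<close>

lemma field_law_eqI:
  fixes P Q :: "(int ^ 'd \<Rightarrow> real ^ 'n) measure"
  assumes "prob_space P" "prob_space Q" and sP: "sets P = sets path_space" and sQ: "sets Q = sets path_space"
    and eq: "\<And>T a. finite T \<Longrightarrow> (LINT z|P. cis (\<Sum>t\<in>T. a t \<bullet> z t)) = (LINT z|Q. cis (\<Sum>t\<in>T. a t \<bullet> z t))"
  shows "P = Q"
proof -
  interpret P: prob_space P by fact
  interpret Q: prob_space Q by fact
  note [measurable_cong] = sP sQ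
  define X where "X c z = z (fst c) $ snd c" for c and z :: "int ^ 'd \<Rightarrow> real ^ 'n"
  have X[measurable]: "X c \<in> borel_measurable path_space" for c
    unfolding X_def by (rule measurable_compose[OF measurable_path]) (auto intro: borel_measurable_continuous_onI continuous_intros)
  have eqX: "(LINT z|P. cis (\<Sum>c\<in>K. a c * X c z)) = (LINT z|Q. cis (\<Sum>c\<in>K. a c * X c z))"
    if "finite K" for K a
  proof -
    have "(\<Sum>c\<in>K. a c * X c z) = (\<Sum>t\<in>fst ` K. (\<chi> i. if (t, i) \<in> K then a (t, i) else 0) \<bullet> z t)" for z
    proof -
      have "(\<Sum>t\<in>fst ` K. (\<chi> i. if (t, i) \<in> K then a (t, i) else 0) \<bullet> z t) =
          (\<Sum>t\<in>fst ` K. \<Sum>i\<in>UNIV. if (t, i) \<in> K then a (t, i) * z t $ i else 0)"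
        by (auto simp: inner_vec_def intro!: sum.cong)
      also have "\<dots> = (\<Sum>c\<in>fst ` K \<times> UNIV. if c \<in> K then a c * X c z else 0)"
        by (subst sum.cartesian_product) (auto simp: X_def intro!: sum.cong)
      also have "\<dots> = (\<Sum>c\<in>(fst ` K \<times> UNIV) \<inter> K. a c * X c z)"
        using that by (intro sum.inter_restrict[symmetric]) auto
      also have "(fst ` K \<times> UNIV) \<inter> K = K" by force
      finally show ?thesis by simp
    qed
    then show ?thesis using eq[of "fst ` K"] that by simp
  qed
  \<comment> \<open>The exponent stays arbitrary in the induction, since treating one more indicator
    puts its coordinate into the exponent.\<close>
  have key: "(LINT z|P. (\<Prod>c\<in>J. indicator (B c) (X c z)) * cis (\<Sum>c\<in>K. a c * X c z)) =
      (LINT z|Q. (\<Prod>c\<in>J. indicator (B c) (X c z)) * cis (\<Sum>c\<in>K. a c * X c z))"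
    if "finite J" "finite K" "\<And>c. B c \<in> sets borel" for J K B a
    using that
  proof (induction J arbitrary: K a rule: finite_induct)
    case empty
    then show ?case using eqX by simp
  next
    case (insert k J)
    have [measurable]: "B c \<in> sets borel" for c by fact
    define g where "g z = (\<Prod>c\<in>J. indicator (B c) (X c z)) * cis (\<Sum>c\<in>K. a c * X c z)" for z
    have "(LINT z|P. g z * indicator (B k) (X k z)) = (LINT z|Q. g z * indicator (B k) (X k z))"
    proof (rule integral_indicator_eq_of_char_eq)
      show "g \<in> borel_measurable P" unfolding g_def by measurable
      fix z
      have "norm (\<Prod>c\<in>J. indicator (B c) (X c z) :: complex) \<le> 1"
        unfolding prod_norm[symmetric] by (intro prod_le_1) (auto simp: indicator_def)
      then show "norm (g z) \<le> 1" by (simp add: g_def norm_mult)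
    next
      fix s
      \<comment> \<open>The coordinate \<open>k\<close> may already occur in \<open>K\<close>, in
        which case the coefficients add.\<close>
      define a' where "a' c = (if c \<in> K then a c else 0) + (if c = k then s else 0)" for c
      have sum: "(\<Sum>c\<in>insert k K. a' c * X c z) = (\<Sum>c\<in>K. a c * X c z) + s * X k z" for z
      proof -
        have "(\<Sum>c\<in>insert k K. a' c * X c z) =
            (\<Sum>c\<in>insert k K. if c \<in> K then a c * X c z else 0) + (\<Sum>c\<in>insert k K. if c = k then s * X c z else 0)"
          unfolding a'_def sum.distrib[symmetric] by (intro sum.cong) (auto simp: algebra_simps)
        also have "(\<Sum>c\<in>insert k K. if c \<in> K then a c * X c z else 0) = (\<Sum>c\<in>insert k K \<inter> K. a c * X c z)"
          using insert.prems(1) by (intro sum.inter_restrict[symmetric]) auto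
        also have "insert k K \<inter> K = K" by auto
        finally show ?thesis using insert.prems(1) by simp
      qed
      have "g z * cis (s * X k z) = (\<Prod>c\<in>J. indicator (B c) (X c z)) * cis (\<Sum>c\<in>insert k K. a' c * X c z)" for z
        unfolding g_def sum by (simp add: cis_mult mult.assoc)
      then show "(LINT z|P. g z * cis (s * X k z)) = (LINT z|Q. g z * cis (s * X k z))"
        using insert.IH[of "insert k K" a'] insert.prems by simp
      show "(LINT z|P. cis (s * X k z)) = (LINT z|Q. cis (s * X k z))"
        using eqX[of "{k}" "\<lambda>_. s"] by simp
    qed (use assms in \<open>auto simp: sP sQ\<close>)
    then show ?case
      using insert.hyps by (simp add: g_def mult_ac)
  qed
  define E where "E = {{z. \<forall>c\<in>J. X c z \<in> B c} | J B. finite J \<and> (\<forall>c. B c \<in> sets borel)}"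
  have E_elim: "\<exists>J B. A = {z. \<forall>c\<in>J. X c z \<in> B c} \<and> finite J \<and> (\<forall>c. B c \<in> sets borel)" if "A \<in> E" for A
    using that unfolding E_def mem_Collect_eq .
  have E_intro: "{z. \<forall>c\<in>J. X c z \<in> B c} \<in> E" if "finite J" "\<And>c. B c \<in> sets borel" for J B
    unfolding E_def mem_Collect_eq by (rule exI[of _ J], rule exI[of _ B]) (use that in simp)
  have sub: "A \<in> sets path_space" if AE: "A \<in> E" for A
  proof -
    obtain J B where JB: "A = {z. \<forall>c\<in>J. X c z \<in> B c} \<and> finite J \<and> (\<forall>c. B c \<in> sets borel)"
      using E_elim[OF AE] by blast
    note A = JB[THEN conjunct1] JB[THEN conjunct2, THEN conjunct1] JB[THEN conjunct2, THEN conjunct2, rule_format]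
    note [measurable] = A(3)
    have "{z \<in> space path_space. \<forall>c\<in>J. X c z \<in> B c} \<in> sets path_space"
      using A(2) by measurable
    then show ?thesis by (simp add: A(1))
  qed
  have gen: "sets path_space = sigma_sets UNIV E"
  proof
    show "sigma_sets UNIV E \<subseteq> sets (path_space :: (int ^ 'd \<Rightarrow> real ^ 'n) measure)"
      using sets.sigma_sets_subset[of E path_space] sub by auto
    let ?S = "sigma UNIV E"
    have Xm: "X c \<in> borel_measurable ?S" for c
    proof (rule measurableI)
      fix A :: "real set" assume A: "A \<in> sets borel"
      have "X c -` A = {z. \<forall>c\<in>{c}. X c z \<in> A}" by auto
      also have "\<dots> \<in> E" using A by (intro E_intro) auto
      finally show "X c -` A \<inter> space ?S \<in> sets ?S" by (auto simp: space_measure_of_conv)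
    qed simp
    have "(\<lambda>z. z t) \<in> borel_measurable ?S" for t
    proof (subst borel_measurable_euclidean_space, intro ballI)
      fix b :: "real ^ 'n" assume "b \<in> Basis"
      then obtain i where "b = axis i 1" by (auto simp: Basis_vec_def)
      then show "(\<lambda>z. z t \<bullet> b) \<in> borel_measurable ?S"
        using Xm[of "(t, i)"] by (simp add: X_def[abs_def] inner_axis)
    qed
    then have m: "(\<lambda>z t. z t) \<in> measurable ?S (path_space :: (int ^ 'd \<Rightarrow> real ^ 'n) measure)"
      unfolding path_space_def by (intro measurable_PiM_single') auto
    show "sets (path_space :: (int ^ 'd \<Rightarrow> real ^ 'n) measure) \<subseteq> sigma_sets UNIV E"
    proof
      fix A :: "(int ^ 'd \<Rightarrow> real ^ 'n) set" assume "A \<in> sets path_space"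
      from measurable_sets[OF m this] show "A \<in> sigma_sets UNIV E"
        by (simp add: space_measure_of_conv)
    qed
  qed
  show "P = Q"
  proof (rule measure_eqI_generator_eq[where E = E and \<Omega> = UNIV and A = "\<lambda>_. UNIV"])
    show "Int_stable E"
    proof (rule Int_stableI)
      fix A A' assume "A \<in> E" "A' \<in> E"
      obtain J B J' B' where A: "A = {z. \<forall>c\<in>J. X c z \<in> B c} \<and> finite J \<and> (\<forall>c. B c \<in> sets borel)"
        "A' = {z. \<forall>c\<in>J'. X c z \<in> B' c} \<and> finite J' \<and> (\<forall>c. B' c \<in> sets borel)"
        using E_elim[OF \<open>A \<in> E\<close>] E_elim[OF \<open>A' \<in> E\<close>] by blast
      define D where "D c = (if c \<in> J then B c else UNIV) \<inter> (if c \<in> J' then B' c else UNIV)" for c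
      have "A \<inter> A' = {z. \<forall>c\<in>J \<union> J'. X c z \<in> D c}"
        unfolding A[THEN conjunct1] D_def by auto
      moreover have B: "B c \<in> sets borel" "B' c \<in> sets borel" for c using A by blast+
      have "D c \<in> sets borel" for c unfolding D_def by (simp add: B sets.Int)
      ultimately show "A \<inter> A' \<in> E" using A E_intro[of "J \<union> J'" D] by simp
    qed
    show "E \<subseteq> Pow UNIV" by simp
    fix A assume AE: "A \<in> E"
    obtain J B where JB: "A = {z. \<forall>c\<in>J. X c z \<in> B c} \<and> finite J \<and> (\<forall>c. B c \<in> sets borel)"
      using E_elim[OF AE] by blast
    note A = JB[THEN conjunct1] JB[THEN conjunct2, THEN conjunct1] JB[THEN conjunct2, THEN conjunct2, rule_format]
    have "(\<Prod>c\<in>J. indicator (B c) (X c z)) = (indicator A z :: complex)" for z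
      using A(2) by (cases "z \<in> A") (auto simp: A(1) indicator_def intro!: prod.neutral)
    then have "(LINT z|P. indicator A z :: complex) = (LINT z|Q. indicator A z)"
      using key[OF A(2), of "{}" B] A(3) by simp
    moreover have "(LINT z|M. indicator A z :: complex) = complex_of_real (LINT z|M. indicator A z)" for M
    proof -
      have "(indicator A z :: complex) = complex_of_real (indicator A z)" for z
        by (simp add: indicator_def)
      then show ?thesis by (simp only: integral_complex_of_real)
    qed
    ultimately have "(LINT z|P. indicator A z :: real) = (LINT z|Q. indicator A z)"
      by (simp only: of_real_eq_iff)
    then have "measure P A = measure Q A"
      using sub[OF AE] sets_eq_imp_space_eq[OF sP] sets_eq_imp_space_eq[OF sQ] by simp
    then show "emeasure P A = emeasure Q A"
      by (simp add: P.emeasure_eq_measure Q.emeasure_eq_measure)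
  next
    have "UNIV = {z. \<forall>c\<in>{}. X c z \<in> UNIV}" by simp
    also have "\<dots> \<in> E" by (intro E_intro) auto
    finally show "range (\<lambda>_. UNIV) \<subseteq> E" by auto
  qed (use gen sP sQ in auto)
qed

text \<open>Every finite linear functional has a centered Gaussian law, fixed by a variance that is
  a combination of covariances; equal laws of the functionals give equal characteristic
  functions.\<close>

theorem gaussian_field_unique:
  fixes P Q :: "(int ^ 'd \<Rightarrow> real ^ 'n) measure"
  assumes "prob_space P" "prob_space Q" and sP: "sets P = sets path_space" and sQ: "sets Q = sets path_space"
    and P: "gaussian_field P" "zero_mean_field P" and Q: "gaussian_field Q" "zero_mean_field Q"
    and cov: "\<And>s t. covariance P s t = covariance Q s t"
  shows "P = Q"
proof (rule field_law_eqI)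
  fix T :: "(int ^ 'd) set" and a :: "int ^ 'd \<Rightarrow> real ^ 'n" assume "finite T"
  define L where "L z = (\<Sum>t\<in>T. a t \<bullet> z t)" for z
  note p = gaussian_field_functional[OF P sP \<open>finite T\<close>, where a = a, folded L_def]
  note q = gaussian_field_functional[OF Q sQ \<open>finite T\<close>, where a = a, folded L_def]
  have "(LINT z|P. (L z)\<^sup>2) = (LINT z|Q. (L z)\<^sup>2)"
    unfolding L_def power2_eq_square field_functional_second_moment[OF P sP] field_functional_second_moment[OF Q sQ] cov ..
  then have e: "distr P borel L = distr Q borel L"
    using p q by (intro gaussian_distribution_eqI) (auto simp: integral_distr)
  have "(LINT z|P. cis (L z)) = (LINT x|distr P borel L. cis x)"
    using p by (simp add: integral_distr)
  also have "\<dots> = (LINT z|Q. cis (L z))" unfolding e using q by (simp add: integral_distr)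
  finally show "(LINT z|P. cis (\<Sum>t\<in>T. a t \<bullet> z t)) = (LINT z|Q. cis (\<Sum>t\<in>T. a t \<bullet> z t))"
    by (simp add: L_def)
qed fact+

section \<open>Gaussian fields with prescribed covariance\<close>

definition psd_kernel :: "('i \<Rightarrow> 'i \<Rightarrow> real) \<Rightarrow> bool" where
  "psd_kernel K \<longleftrightarrow> (\<forall>i j. K i j = K j i) \<and>
     (\<forall>F a. finite F \<longrightarrow> 0 \<le> (\<Sum>i\<in>F. \<Sum>j\<in>F. a i * a j * K i j))"

text \<open>The conditional covariance of a Gaussian family given its coordinate \<open>p\<close>.
  If \<open>K p p = 0\<close>, the quotient is 0 and \<open>K\<close> is unchanged, as it should be:
  row \<open>p\<close> of a positive semidefinite kernel then vanishes.\<close>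

definition schur_kernel :: "'i \<Rightarrow> ('i \<Rightarrow> 'i \<Rightarrow> real) \<Rightarrow> 'i \<Rightarrow> 'i \<Rightarrow> real" where
  "schur_kernel p K i j = K i j - K i p * K j p / K p p"

lemma psd_kernel_symmetric: "psd_kernel K \<Longrightarrow> K i j = K j i"
  by (simp add: psd_kernel_def)

text \<open>The form at the finite vector \<open>a\<close> with \<open>c\<close> added at
  \<open>p\<close>. Since \<open>p\<close> may or may not belong to \<open>F\<close>, the
  coefficients are merged over \<open>insert p F\<close>.\<close>

lemma psd_kernel_perturb:
  assumes K: "psd_kernel K" and F: "finite F"
  shows "0 \<le> (\<Sum>i\<in>F. \<Sum>j\<in>F. a i * a j * K i j) + 2 * c * (\<Sum>i\<in>F. a i * K i p) + c\<^sup>2 * K p p"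
proof -
  define G where "G = insert p F"
  define b where "b i = (if i \<in> F then a i else 0) + (if i = p then c else 0)" for i
  have G: "finite G" "p \<in> G" using F by (auto simp: G_def)
  have lin: "(\<Sum>i\<in>G. b i * f i) = (\<Sum>i\<in>F. a i * f i) + c * f p" for f
  proof -
    have "(\<Sum>i\<in>G. b i * f i) = (\<Sum>i\<in>G. if i \<in> F then a i * f i else 0) + (\<Sum>i\<in>G. if i = p then c * f i else 0)"
      unfolding sum.distrib[symmetric] b_def by (intro sum.cong) (auto simp: algebra_simps)
    also have "(\<Sum>i\<in>G. if i \<in> F then a i * f i else 0) = (\<Sum>i\<in>G \<inter> F. a i * f i)"
      using G by (intro sum.inter_restrict[symmetric])
    also have "G \<inter> F = F" by (auto simp: G_def)
    finally show ?thesis using G by simp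
  qed
  have "(\<Sum>i\<in>G. \<Sum>j\<in>G. b i * b j * K i j) = (\<Sum>i\<in>G. b i * (\<Sum>j\<in>G. b j * K i j))"
    by (simp add: sum_distrib_left mult.assoc)
  also have "\<dots> = (\<Sum>i\<in>F. a i * ((\<Sum>j\<in>F. a j * K i j) + c * K i p)) + c * ((\<Sum>j\<in>F. a j * K p j) + c * K p p)"
    unfolding lin ..
  also have "\<dots> = (\<Sum>i\<in>F. \<Sum>j\<in>F. a i * a j * K i j) + 2 * c * (\<Sum>i\<in>F. a i * K i p) + c\<^sup>2 * K p p"
  proof -
    have "(\<Sum>j\<in>F. a j * K p j) = (\<Sum>i\<in>F. a i * K i p)"
      using psd_kernel_symmetric[OF K, of p] by (intro sum.cong) auto
    then show ?thesis
      by (simp add: algebra_simps sum.distrib sum_distrib_left power2_eq_square)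
  qed
  finally have e: "(\<Sum>i\<in>G. \<Sum>j\<in>G. b i * b j * K i j) = \<dots>" .
  have "0 \<le> (\<Sum>i\<in>G. \<Sum>j\<in>G. b i * b j * K i j)"
    using K G(1) unfolding psd_kernel_def by blast
  then show ?thesis unfolding e .
qed

lemma psd_kernel_diag_nonneg: "psd_kernel K \<Longrightarrow> 0 \<le> K p p"
  using psd_kernel_perturb[of K "{}" _ 1 p] by simp

lemma psd_kernel_eq_0:
  assumes K: "psd_kernel K" and 0: "K p p = 0" shows "K i p = 0"
proof (rule ccontr)
  assume ne: "K i p \<noteq> 0"
  have "0 \<le> K i i + 2 * c * K i p" for c
    using psd_kernel_perturb[OF K, of "{i}" "\<lambda>_. 1" c p] 0 by simp
  \<comment> \<open>This value of \<open>c\<close> makes the affine function equal to -1.\<close>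
  from this[of "- (K i i + 1) / (2 * K i p)"] ne show False by (simp add: field_simps)
qed

lemma psd_kernel_schur:
  assumes K: "psd_kernel K" shows "psd_kernel (schur_kernel p K)"
  unfolding psd_kernel_def
proof (intro conjI allI impI)
  show "schur_kernel p K i j = schur_kernel p K j i" for i j
    using psd_kernel_symmetric[OF K] by (simp add: schur_kernel_def mult.commute)
  fix F :: "'a set" and a assume F: "finite F"
  define s where "s = (\<Sum>i\<in>F. a i * K i p)"
  have "(\<Sum>i\<in>F. \<Sum>j\<in>F. a i * a j * schur_kernel p K i j) =
      (\<Sum>i\<in>F. \<Sum>j\<in>F. a i * a j * K i j) - (\<Sum>i\<in>F. \<Sum>j\<in>F. (a i * K i p) * (a j * K j p)) / K p p"
    by (simp add: schur_kernel_def right_diff_distrib sum_subtractf sum_divide_distrib mult_ac)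
  also have "(\<Sum>i\<in>F. \<Sum>j\<in>F. (a i * K i p) * (a j * K j p)) = s * s"
    unfolding s_def sum_product ..
  finally have e: "(\<Sum>i\<in>F. \<Sum>j\<in>F. a i * a j * schur_kernel p K i j) =
      (\<Sum>i\<in>F. \<Sum>j\<in>F. a i * a j * K i j) - s * s / K p p" .
  \<comment> \<open>\<open>- s / K p p\<close> minimizes the quadratic polynomial in
    \<open>c\<close>. For a zero pivot it reads 0, and so does the quotient that is
    subtracted.\<close>
  have "0 \<le> (\<Sum>i\<in>F. \<Sum>j\<in>F. a i * a j * K i j) + 2 * (- s / K p p) * s + (- s / K p p)\<^sup>2 * K p p"
    unfolding s_def by (rule psd_kernel_perturb[OF K F])
  also have "\<dots> = (\<Sum>i\<in>F. \<Sum>j\<in>F. a i * a j * K i j) - s * s / K p p"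
    by (cases "K p p = 0") (auto simp: field_simps power2_eq_square)
  finally show "0 \<le> (\<Sum>i\<in>F. \<Sum>j\<in>F. a i * a j * schur_kernel p K i j)" unfolding e .
qed

text \<open>Cholesky factorization by successive Schur complements: complementing at \<open>p\<close> annihilates row
  and column \<open>p\<close>, so that every row is exhausted after finitely many pivots.\<close>

lemma psd_kernel_factorization:
  fixes K :: "'i::countable \<Rightarrow> 'i \<Rightarrow> real"
  assumes K: "psd_kernel K"
  obtains L :: "'i \<Rightarrow> nat \<Rightarrow> real"
  where "\<And>i k. to_nat i < k \<Longrightarrow> L i k = 0" "\<And>i j n. to_nat i < n \<Longrightarrow> K i j = (\<Sum>k<n. L i k * L j k)"
proof
  define S where "S = rec_nat K (\<lambda>n. schur_kernel (from_nat n))"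
  have S0: "S 0 = K" and SS: "S (Suc n) = schur_kernel (from_nat n) (S n)" for n
    by (simp_all add: S_def)
  have psd: "psd_kernel (S n)" for n
    by (induction n) (simp_all add: S0 SS K psd_kernel_schur)
  have z: "S n i j = 0" if "to_nat i < n" for n i j
    using that
  proof (induction n arbitrary: j)
    case (Suc n)
    show ?case
    proof (cases "to_nat i = n")
      case True
      then have i: "from_nat n = i" by (metis from_nat_to_nat)
      have "S n i j = S n j i" by (rule psd_kernel_symmetric[OF psd])
      then show ?thesis using psd_kernel_eq_0[OF psd, of n i j]
        by (cases "S n i i = 0") (auto simp: SS schur_kernel_def i)
    next
      case False
      then have "S n i j = 0" for j using Suc by simp
      then show ?thesis by (simp add: SS schur_kernel_def)
    qed
  qed simp
  \<comment> \<open>Column \<open>k\<close> is the normalized pivot column of the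
    \<open>k\<close>-th complement; a zero pivot gives the zero column, division by 0 being
    0.\<close>
  define L where "L i k = S k i (from_nat k) / sqrt (S k (from_nat k) (from_nat k))" for i k
  show "L i k = 0" if "to_nat i < k" for i k by (simp add: L_def z[OF that])
  have step: "S k i j - S (Suc k) i j = L i k * L j k" for k i j
    using psd_kernel_diag_nonneg[OF psd, of k "from_nat k"]
    by (simp add: SS schur_kernel_def L_def)
  have tel: "K i j = S n i j + (\<Sum>k<n. L i k * L j k)" for i j n
    by (induction n) (simp_all add: S0 step[symmetric])
  show "K i j = (\<Sum>k<n. L i k * L j k)" if "to_nat i < n" for i j n
    using tel[of i j n] z[OF that, of j] by simp
qed

section \<open>Realization by independent normal variables\<close>

definition gaussian_noise :: "(nat \<Rightarrow> real) measure" where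
  "gaussian_noise = (\<Pi>\<^sub>M k\<in>UNIV. std_normal_distribution)"

lemma prob_space_gaussian_noise: "prob_space gaussian_noise"
  unfolding gaussian_noise_def by (intro prob_space_PiM prob_space_normal_density) simp

lemma measurable_gaussian_noise [measurable]: "(\<lambda>w. w k) \<in> borel_measurable gaussian_noise"
proof -
  have "(\<lambda>w. w k) \<in> measurable (\<Pi>\<^sub>M k\<in>UNIV. std_normal_distribution) std_normal_distribution"
    by (rule measurable_component_singleton) simp
  then show ?thesis by (simp add: gaussian_noise_def cong: measurable_cong_sets)
qed

lemma distributed_gaussian_noise: "distributed gaussian_noise lborel (\<lambda>w. w k) std_normal_density"
proof -
  have "distr gaussian_noise std_normal_distribution (\<lambda>w. w k) = std_normal_distribution"
    unfolding gaussian_noise_def by (rule distr_PiM_component) (auto intro: prob_space_normal_density)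
  then have "distr gaussian_noise lborel (\<lambda>w. w k) = std_normal_distribution"
    by (subst distr_cong[OF refl _ refl, of _ std_normal_distribution]) auto
  then show ?thesis by (simp add: distributed_def)
qed

lemma indep_vars_gaussian_noise: "prob_space.indep_vars gaussian_noise (\<lambda>_. borel) (\<lambda>k w. w k) UNIV"
proof -
  interpret prob_space gaussian_noise by (rule prob_space_gaussian_noise)
  have "distr gaussian_noise borel (\<lambda>w. w k) = std_normal_distribution" for k
  proof -
    have "distr gaussian_noise borel (\<lambda>w. w k) = distr gaussian_noise lborel (\<lambda>w. w k)"
      by (intro distr_cong) auto
    also have "\<dots> = std_normal_distribution"
      by (rule distributed_distr_eq_density[OF distributed_gaussian_noise])
    finally show ?thesis .
  qed
  then have "(\<Pi>\<^sub>M i\<in>UNIV. distr gaussian_noise borel (\<lambda>w. w i)) = gaussian_noise"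
    by (simp add: gaussian_noise_def)
  moreover have "sets gaussian_noise = sets (\<Pi>\<^sub>M i\<in>UNIV. borel)"
    unfolding gaussian_noise_def by (intro sets_PiM_cong) auto
  then have "distr gaussian_noise (\<Pi>\<^sub>M i\<in>UNIV. borel) (\<lambda>x. \<lambda>i\<in>UNIV. x i) = gaussian_noise"
    by (simp add: restrict_UNIV distr_id2)
  ultimately show ?thesis
    by (subst indep_vars_iff_distr_eq_PiM') auto
qed

lemma gaussian_noise_functional:
  fixes c :: "nat \<Rightarrow> real"
  assumes "finite F"
  defines "L \<equiv> \<lambda>w. \<Sum>k\<in>F. c k * w k"
  shows "gaussian_distribution (distr gaussian_noise borel L)"
    "integrable gaussian_noise L" "(LINT w|gaussian_noise. L w) = 0"
    "integrable gaussian_noise (\<lambda>w. (L w)\<^sup>2)" "(LINT w|gaussian_noise. (L w)\<^sup>2) = (\<Sum>k\<in>F. (c k)\<^sup>2)"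
proof -
  interpret prob_space gaussian_noise by (rule prob_space_gaussian_noise)
  \<comment> \<open>A variable scaled by 0 has no normal density, so zero coefficients are dropped;
    if none is left, the law of the functional is the point mass at 0.\<close>
  define G where "G = {k\<in>F. c k \<noteq> 0}"
  define s where "s = (\<Sum>k\<in>F. (c k)\<^sup>2)"
  have G: "finite G" "\<And>f. (\<Sum>k\<in>G. c k * f k) = (\<Sum>k\<in>F. c k * f k)" "(\<Sum>k\<in>G. (c k)\<^sup>2) = s"
    unfolding G_def s_def using assms by (auto intro!: sum.mono_neutral_cong_left)
  have L: "L w = (\<Sum>k\<in>G. c k * w k)" for w by (simp add: L_def G)
  have m[measurable]: "L \<in> borel_measurable gaussian_noise" unfolding L_def by measurable
  define \<mu> where "\<mu> = distr gaussian_noise borel L"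
  have "\<mu> = return borel 0 \<and> s = 0 \<or> s > 0 \<and> \<mu> = density lborel (\<lambda>x. ennreal (normal_density 0 (sqrt s) x))"
  proof (cases "G = {}")
    case True
    then have "\<mu> = return borel 0" unfolding \<mu>_def L
      by (simp add: distr_const)
    then show ?thesis using G True by simp
  next
    case False
    have "indep_vars (\<lambda>_. borel) (\<lambda>k w. c k * w k) G"
      using indep_vars_compose2[OF indep_vars_subset[OF indep_vars_gaussian_noise, of G], of "\<lambda>k x. c k * x" "\<lambda>_. borel"]
      by simp
    moreover have "distributed gaussian_noise lborel (\<lambda>w. c k * w k) (normal_density 0 \<bar>c k\<bar>)" if "k \<in> G" for k
      using normal_density_affine[OF distributed_gaussian_noise, of "c k" 0] that by (simp add: G_def)
    ultimately have d: "distributed gaussian_noise lborel L (normal_density 0 (sqrt s))"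
      using sum_indep_normal[of G "\<lambda>k w. c k * w k" "\<lambda>k. \<bar>c k\<bar>" "\<lambda>_. 0"] False G
      by (simp add: L[abs_def] G_def)
    have "\<mu> = density lborel (\<lambda>x. ennreal (normal_density 0 (sqrt s) x))"
      unfolding \<mu>_def distributed_distr_eq_density[OF d, symmetric] by (rule distr_cong) auto
    moreover have "s > 0" unfolding G(3)[symmetric] using False G by (intro sum_pos) (auto simp: G_def)
    ultimately show ?thesis by simp
  qed
  then have "gaussian_distribution \<mu> \<and> (LINT x|\<mu>. x) = 0 \<and> (LINT x|\<mu>. x\<^sup>2) = s"
  proof (elim disjE conjE)
    assume "\<mu> = return borel 0" "s = 0"
    then show ?thesis using return_borel_moments[of 0] by (simp add: gaussian_distribution_def) blast
  next
    assume s: "s > 0" and \<mu>: "\<mu> = density lborel (\<lambda>x. ennreal (normal_density 0 (sqrt s) x))"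
    then have "gaussian_distribution \<mu>"
      unfolding gaussian_distribution_def by (intro disjI2 exI[of _ 0] exI[of _ "sqrt s"]) simp
    then show ?thesis
      using s normal_distribution_moments[of "sqrt s" 0] by (simp add: \<mu>)
  qed
  then have *: "gaussian_distribution \<mu>" "(LINT x|\<mu>. x) = 0" "(LINT x|\<mu>. x\<^sup>2) = s" by auto
  show "gaussian_distribution (distr gaussian_noise borel L)" using * by (simp add: \<mu>_def)
  show "integrable gaussian_noise L" "integrable gaussian_noise (\<lambda>w. (L w)\<^sup>2)"
    using gaussian_distribution_integrable[OF *(1)] unfolding \<mu>_def by (simp_all add: integrable_distr_eq)
  show "(LINT w|gaussian_noise. L w) = 0" "(LINT w|gaussian_noise. (L w)\<^sup>2) = (\<Sum>k\<in>F. (c k)\<^sup>2)"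
    using *(2,3) unfolding \<mu>_def by (simp_all add: integral_distr s_def)
qed

text \<open>Polarization, the second moments of single functionals being known.\<close>

lemma gaussian_noise_covariance:
  fixes c d :: "nat \<Rightarrow> real"
  assumes "finite F"
  shows "(LINT w|gaussian_noise. (\<Sum>k\<in>F. c k * w k) * (\<Sum>k\<in>F. d k * w k)) = (\<Sum>k\<in>F. c k * d k)"
proof -
  note f = gaussian_noise_functional[OF assms]
  have e: "(\<Sum>k\<in>F. c k * w k) * (\<Sum>k\<in>F. d k * w k) =
      ((\<Sum>k\<in>F. (c k + d k) * w k)\<^sup>2 - (\<Sum>k\<in>F. (c k - d k) * w k)\<^sup>2) / 4" for w
    by (simp add: distrib_right left_diff_distrib sum.distrib sum_subtractf power2_eq_square algebra_simps)
  have "(LINT w|gaussian_noise. ((\<Sum>k\<in>F. (c k + d k) * w k)\<^sup>2 - (\<Sum>k\<in>F. (c k - d k) * w k)\<^sup>2) / 4) =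
      ((\<Sum>k\<in>F. (c k + d k)\<^sup>2) - (\<Sum>k\<in>F. (c k - d k)\<^sup>2)) / 4"
    using f(4,5)[of "\<lambda>k. c k + d k"] f(4,5)[of "\<lambda>k. c k - d k"] by simp
  also have "\<dots> = (\<Sum>k\<in>F. ((c k + d k)\<^sup>2 - (c k - d k)\<^sup>2) / 4)"
    by (simp add: sum_subtractf flip: sum_divide_distrib)
  also have "\<dots> = (\<Sum>k\<in>F. c k * d k)"
    by (intro sum.cong) (simp_all add: power2_eq_square algebra_simps)
  finally show ?thesis unfolding e .
qed

text \<open>Rows of the Cholesky factor are finite, so each coordinate of the field is a finite
  combination of noise variables: no series has to converge, and every finite functional of the
  field is a finite functional of the noise.\<close>

theorem gaussian_stationary_law_exists:
  fixes K :: "(int ^ 'd::finite) \<times> 'n::finite \<Rightarrow> (int ^ 'd) \<times> 'n \<Rightarrow> real"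
  assumes K: "psd_kernel K" and st: "\<And>t s s' i j. K (t + s, i) (s, j) = K (t + s', i) (s', j)"
  obtains P :: "(int ^ 'd \<Rightarrow> real ^ 'n) measure"
  where "gaussian_stationary_law P" "\<And>s t i j. covariance P s t $ i $ j = K (s, i) (t, j)"
proof -
  obtain L where L: "\<And>i k. to_nat i < k \<Longrightarrow> L i k = 0"
      "\<And>i j n. to_nat i < n \<Longrightarrow> K i j = (\<Sum>k<n. L i k * L j k)"
    using psd_kernel_factorization[OF K] by blast
  interpret W: prob_space gaussian_noise by (rule prob_space_gaussian_noise)
  define Z :: "(nat \<Rightarrow> real) \<Rightarrow> int ^ 'd \<Rightarrow> real ^ 'n" where
    "Z = (\<lambda>w t. \<chi> i. \<Sum>k\<le>to_nat (t, i). L (t, i) k * w k)"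
  have Z_eq: "Z w t $ i = (\<Sum>k<n. L (t, i) k * w k)" if "to_nat (t, i) < n" for w t i n
  proof -
    have "L (t, i) k * w k = 0" if "k \<in> {..<n} - {..to_nat (t, i)}" for k
      using L(1)[of "(t, i)" k] that by simp
    then have "(\<Sum>k\<le>to_nat (t, i). L (t, i) k * w k) = (\<Sum>k<n. L (t, i) k * w k)"
      using that by (intro sum.mono_neutral_left) auto
    then show ?thesis by (simp add: Z_def)
  qed
  have Zm: "(\<lambda>w. Z w t) \<in> borel_measurable gaussian_noise" for t
  proof (subst borel_measurable_euclidean_space, intro ballI)
    fix b :: "real ^ 'n" assume "b \<in> Basis"
    then obtain i where "b = axis i 1" by (auto simp: Basis_vec_def)
    then show "(\<lambda>w. Z w t \<bullet> b) \<in> borel_measurable gaussian_noise"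
      by (simp add: inner_axis Z_def)
  qed
  then have m[measurable]: "Z \<in> measurable gaussian_noise path_space"
    unfolding path_space_def by (intro measurable_PiM_single'[of UNIV "\<lambda>t w. Z w t", simplified]) (auto simp: PiE_UNIV_domain)
  define P where "P = distr gaussian_noise path_space Z"
  have sP: "sets P = sets path_space" by (simp add: P_def)
  have pm: "(\<lambda>z. z t $ i) \<in> borel_measurable path_space" for t :: "int ^ 'd" and i :: 'n
    by (rule measurable_compose[OF measurable_path]) (auto intro: borel_measurable_continuous_onI continuous_intros)
  have cov: "covariance P s t $ i $ j = K (s, i) (t, j)" for s t i j
  proof -
    define n where "n = Suc (max (to_nat (s, i)) (to_nat (t, j)))"
    have n: "to_nat (s, i) < n" "to_nat (t, j) < n" by (auto simp: n_def)
    have "covariance P s t $ i $ j = (LINT w|gaussian_noise. Z w s $ i * Z w t $ j)"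
      unfolding covariance_def P_def using pm by (simp add: integral_distr)
    also have "\<dots> = K (s, i) (t, j)"
      unfolding Z_eq[OF n(1)] Z_eq[OF n(2)] gaussian_noise_covariance[OF finite_lessThan] L(2)[OF n(1)] ..
    finally show ?thesis .
  qed
  have lin: "\<exists>n c. \<forall>w. (\<Sum>t\<in>T. a t \<bullet> Z w t) = (\<Sum>k<n. c k * w k)" if T: "finite T" for T a
  proof -
    define n where "n = Suc (Max (insert 0 (to_nat ` (T \<times> (UNIV :: 'n set)))))"
    have n: "to_nat (t, i) < n" if "t \<in> T" for t and i :: 'n
    proof -
      have "to_nat (t, i) \<in> to_nat ` (T \<times> (UNIV :: 'n set))" using that by (intro imageI) auto
      then show ?thesis unfolding n_def less_Suc_eq_le using T by (intro Max_ge) auto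
    qed
    have "(\<Sum>t\<in>T. a t \<bullet> Z w t) = (\<Sum>k<n. (\<Sum>t\<in>T. \<Sum>i\<in>UNIV. a t $ i * L (t, i) k) * w k)" for w
    proof -
      have "(\<Sum>t\<in>T. a t \<bullet> Z w t) = (\<Sum>t\<in>T. \<Sum>i\<in>UNIV. \<Sum>k<n. a t $ i * L (t, i) k * w k)"
        unfolding inner_vec_def using Z_eq[OF n]
        by (intro sum.cong refl) (simp add: sum_distrib_left mult.assoc)
      also have "\<dots> = (\<Sum>t\<in>T. \<Sum>k<n. \<Sum>i\<in>UNIV. a t $ i * L (t, i) k * w k)"
        by (intro sum.cong refl sum.swap)
      also have "\<dots> = (\<Sum>k<n. \<Sum>t\<in>T. \<Sum>i\<in>UNIV. a t $ i * L (t, i) k * w k)"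
        by (rule sum.swap)
      finally show ?thesis by (simp add: sum_distrib_right)
    qed
    then show ?thesis by (intro exI allI)
  qed
  have "gaussian_field P"
    unfolding gaussian_field_def
  proof (intro allI impI)
    fix T :: "(int ^ 'd) set" and a :: "int ^ 'd \<Rightarrow> real ^ 'n" assume "finite T"
    then obtain n c where c: "\<And>w. (\<Sum>t\<in>T. a t \<bullet> Z w t) = (\<Sum>k<n. c k * w k)" using lin by blast
    have "distr P borel (\<lambda>z. \<Sum>t\<in>T. a t \<bullet> z t) = distr gaussian_noise borel (\<lambda>w. \<Sum>k<n. c k * w k)"
      unfolding P_def c[symmetric] by (subst distr_distr) (auto simp: comp_def)
    then show "gaussian_distribution (distr P borel (\<lambda>z. \<Sum>t\<in>T. a t \<bullet> z t))"
      using gaussian_noise_functional(1)[OF finite_lessThan] by metis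
  qed
  moreover have "zero_mean_field P"
    unfolding zero_mean_field_def
  proof
    fix t
    have comp: "integrable gaussian_noise (\<lambda>w. Z w t $ i)" "(LINT w|gaussian_noise. Z w t $ i) = 0" for i
      unfolding Z_eq[OF lessI] by (rule gaussian_noise_functional(2,3)[OF finite_lessThan])+
    have vec: "Z w t = (\<Sum>i\<in>UNIV. Z w t $ i *\<^sub>R axis i 1)" for w
      by (simp add: vec_eq_iff axis_def if_distrib cong: if_cong)
    have "integrable gaussian_noise (\<lambda>w. Z w t)" "(LINT w|gaussian_noise. Z w t) = 0"
      unfolding ext[of "\<lambda>w. Z w t", OF vec] using comp by simp_all
    then show "integrable P (\<lambda>z. z t) \<and> (LINT z|P. z t) = 0"
      unfolding P_def by (simp add: integrable_distr_eq integral_distr)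
  qed
  moreover have "stationary_field P"
    unfolding stationary_field_def by (simp add: vec_eq_iff cov) (use st in blast)
  moreover have "prob_space P" unfolding P_def by (rule W.prob_space_distr) simp
  ultimately have "gaussian_stationary_law P" using sP by (simp add: gaussian_stationary_law_def)
  then show ?thesis using cov that by blast
qed

section \<open>Periodograms\<close>

definition block_matrix :: "complex ^ 'n ^ 'n \<Rightarrow> complex ^ 'n ^ 'n \<Rightarrow> complex ^ 'n ^ 'n \<Rightarrow> complex ^ ('n + 'n) ^ ('n + 'n)" where
  "block_matrix A C B = (\<chi> k l. case k of
     Inl i \<Rightarrow> (case l of Inl j \<Rightarrow> A $ i $ j | Inr j \<Rightarrow> C $ i $ j)
   | Inr i \<Rightarrow> (case l of Inl j \<Rightarrow> cnj (C $ j $ i) | Inr j \<Rightarrow> B $ i $ j))"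

lemma block_matrix_nth [simp]:
  "block_matrix A C B $ Inl i $ Inl j = A $ i $ j" "block_matrix A C B $ Inl i $ Inr j = C $ i $ j"
  "block_matrix A C B $ Inr i $ Inl j = cnj (C $ j $ i)" "block_matrix A C B $ Inr i $ Inr j = B $ i $ j"
  by (simp_all add: block_matrix_def)

lemma sum_UNIV_Plus: "(\<Sum>k\<in>(UNIV :: ('a::finite + 'b::finite) set). f k) = (\<Sum>i\<in>UNIV. f (Inl i)) + (\<Sum>j\<in>UNIV. f (Inr j))"
  unfolding UNIV_Plus_UNIV[symmetric] by (subst sum.Plus) (auto simp: comp_def)

lemma cip_block_matrix:
  "Re (cip w (block_matrix A C B *v w)) =
    Re (cip (\<chi> i. w $ Inl i) (A *v (\<chi> i. w $ Inl i))) + 2 * Re (cip (\<chi> i. w $ Inl i) (C *v (\<chi> i. w $ Inr i)))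
      + Re (cip (\<chi> i. w $ Inr i) (B *v (\<chi> i. w $ Inr i)))"
proof -
  let ?u = "\<chi> i. w $ Inl i" and ?v = "\<chi> i. w $ Inr i"
  have "cip ?v (C\<^sup>\<dagger> *v ?u) = cnj (cip ?u (C *v ?v))"
    using cip_mult_left[of C ?v ?u] cip_commute[of "C *v ?v" ?u] by simp
  moreover have "cip w (block_matrix A C B *v w) =
      cip ?u (A *v ?u) + cip ?u (C *v ?v) + (cip ?v (C\<^sup>\<dagger> *v ?u) + cip ?v (B *v ?v))"
    by (simp add: cip_def matrix_vector_mult_def sum_UNIV_Plus sum.distrib algebra_simps)
  ultimately show ?thesis by simp
qed

lemma joint_psd_block:
  fixes A C B :: "complex ^ 'n ^ 'n"
  assumes "psd (block_matrix A C B)" shows "joint_psd A C B"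
  unfolding joint_psd_def
proof (intro allI)
  fix u v :: "complex ^ 'n"
  define w where "w = (\<chi> k. case k of Inl i \<Rightarrow> u $ i | Inr i \<Rightarrow> v $ i)"
  have "(\<chi> i. w $ Inl i) = u" "(\<chi> i. w $ Inr i) = v" by (simp_all add: w_def vec_eq_iff)
  then show "0 \<le> Re (cip u (A *v u)) + 2 * Re (cip u (C *v v)) + Re (cip v (B *v v))"
    using psdD(2)[OF assms, of w] by (simp add: cip_block_matrix)
qed

lemma psd_block:
  assumes "joint_psd A C B" "psd A" "psd B" shows "psd (block_matrix A C B)"
proof -
  have "cnj (A $ j $ i) = A $ i $ j" "cnj (B $ j $ i) = B $ i $ j" for i j
    using psdD(1)[OF assms(2)] psdD(1)[OF assms(3)] by (metis conj_transpose_nth)+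
  then have "(block_matrix A C B)\<^sup>\<dagger> = block_matrix A C B"
    unfolding vec_eq_iff conj_transpose_nth by (auto simp: block_matrix_def split: sum.split)
  then show ?thesis
    using assms(1) by (simp add: psd_cip cip_block_matrix joint_psd_def)
qed

lemma stationary_covariance: "stationary_field P \<Longrightarrow> covariance P s t = covariance P (s - t) 0"
  unfolding stationary_field_def by (metis add.right_neutral diff_add_cancel)

lemma covariance_symmetric: "covariance P s t $ i $ j = covariance P t s $ j $ i"
  by (simp add: covariance_def mult.commute)

definition periodogram ::
  "nat \<Rightarrow> (int ^ 'd \<Rightarrow> real ^ 'n) measure \<Rightarrow> real ^ 'd \<Rightarrow> complex ^ 'n ^ 'n" where
  "periodogram N P \<theta> = (\<chi> i j. fejer_mean N (\<lambda>u. complex_of_real (covariance P u 0 $ i $ j)) \<theta>)"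

text \<open>Up to the window size, the form at \<open>a\<close> is the second moment of
  \<open>Z\<close>, the Fourier sum over the window of the scalar field of inner products with
  \<open>a\<close>. Positivity thus comes from the field itself, without a joint density.\<close>

lemma psd_periodogram:
  fixes P :: "(int ^ 'd \<Rightarrow> real ^ 'n) measure"
  assumes "gaussian_stationary_law P" shows "psd (periodogram N P \<theta>)"
  unfolding psd_cip
proof (intro conjI allI)
  have P: "prob_space P" "sets P = sets path_space" "gaussian_field P" "zero_mean_field P" "stationary_field P"
    using assms by (auto simp: gaussian_stationary_law_def)
  let ?n = "real (card (window N :: (int ^ 'd) set))"
  have cov: "covariance P (s - t) 0 = covariance P s t" for s t
    using stationary_covariance[OF P(5)] by metis
  show "(periodogram N P \<theta>)\<^sup>\<dagger> = periodogram N P \<theta>"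
  proof -
    have "cnj (periodogram N P \<theta> $ j $ i) = periodogram N P \<theta> $ i $ j" for i j
    proof -
      have "cnj (cis (- pairing \<theta> (s - t))) = cis (- pairing \<theta> (t - s))" for s t
        by (simp add: cis_cnj pairing_linear)
      then have "cnj (periodogram N P \<theta> $ j $ i) =
          (\<Sum>s\<in>window N. \<Sum>t\<in>window N. complex_of_real (covariance P t s $ i $ j) * cis (- pairing \<theta> (t - s))) / ?n"
        by (simp add: periodogram_def fejer_mean_def cov covariance_symmetric[of P _ _ j i])
      also have "\<dots> = periodogram N P \<theta> $ i $ j"
        unfolding periodogram_def fejer_mean_def vec_lambda_beta cov by (subst sum.swap) simp
      finally show ?thesis .
    qed
    then show ?thesis by (simp add: vec_eq_iff)
  qed
  fix a :: "complex ^ 'n"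
  define Z where "Z z = (\<Sum>s\<in>window N. \<Sum>i\<in>UNIV. cis (- pairing \<theta> s) * cnj (a $ i) * complex_of_real (z s $ i))"
    for z :: "int ^ 'd \<Rightarrow> real ^ 'n"
  have e: "complex_of_real ((norm (Z z))\<^sup>2) = (\<Sum>s\<in>window N. \<Sum>i\<in>UNIV. \<Sum>t\<in>window N. \<Sum>j\<in>UNIV.
      cnj (a $ i) * a $ j * cis (- pairing \<theta> (s - t)) * complex_of_real (z s $ i * z t $ j))" for z
  proof -
    have "complex_of_real ((norm (Z z))\<^sup>2) = (\<Sum>s\<in>window N. \<Sum>i\<in>UNIV. \<Sum>t\<in>window N. \<Sum>j\<in>UNIV.
        (cis (- pairing \<theta> s) * cnj (a $ i) * complex_of_real (z s $ i)) * (cis (pairing \<theta> t) * a $ j * complex_of_real (z t $ j)))"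
    proof -
      have W: "cnj (Z z) = (\<Sum>t\<in>window N. \<Sum>j\<in>UNIV. cis (pairing \<theta> t) * a $ j * complex_of_real (z t $ j))"
        by (simp add: Z_def cis_cnj)
      show ?thesis
        unfolding complex_norm_square W unfolding Z_def sum_distrib_right unfolding sum_distrib_left ..
    qed
    also have "\<dots> = (\<Sum>s\<in>window N. \<Sum>i\<in>UNIV. \<Sum>t\<in>window N. \<Sum>j\<in>UNIV.
      cnj (a $ i) * a $ j * cis (- pairing \<theta> (s - t)) * complex_of_real (z s $ i * z t $ j))"
    proof (intro sum.cong refl)
      fix s t i j
      have "cis (- pairing \<theta> (s - t)) = cis (- pairing \<theta> s) * cis (pairing \<theta> t)"
        by (simp add: cis_mult pairing_linear)
      then show "(cis (- pairing \<theta> s) * cnj (a $ i) * complex_of_real (z s $ i)) * (cis (pairing \<theta> t) * a $ j * complex_of_real (z t $ j)) =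
          cnj (a $ i) * a $ j * cis (- pairing \<theta> (s - t)) * complex_of_real (z s $ i * z t $ j)"
        by simp
    qed
    finally show ?thesis .
  qed
  have "complex_of_real (LINT z|P. (norm (Z z))\<^sup>2) = (LINT z|P. complex_of_real ((norm (Z z))\<^sup>2))"
    by (rule integral_complex_of_real[symmetric])
  also have "\<dots> = (\<Sum>s\<in>window N. \<Sum>i\<in>UNIV. \<Sum>t\<in>window N. \<Sum>j\<in>UNIV.
      cnj (a $ i) * a $ j * cis (- pairing \<theta> (s - t)) * complex_of_real (covariance P s t $ i $ j))"
  proof -
    have "integrable P (\<lambda>z. complex_of_real (z s $ i * z t $ j))" for s t i j
      by (intro integrable_of_real gaussian_field_component(3)[OF P(3,4,2)])
    moreover have "(LINT z|P. complex_of_real (z s $ i * z t $ j)) = complex_of_real (covariance P s t $ i $ j)" for s t i j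
      by (simp only: integral_complex_of_real covariance_def vec_lambda_beta)
    ultimately show ?thesis unfolding e by (simp del: of_real_mult integral_complex_of_real)
  qed
  also have "\<dots> = (\<Sum>i\<in>UNIV. \<Sum>s\<in>window N. \<Sum>t\<in>window N. \<Sum>j\<in>UNIV.
      cnj (a $ i) * a $ j * cis (- pairing \<theta> (s - t)) * complex_of_real (covariance P s t $ i $ j))"
    by (rule sum.swap)
  also have "\<dots> = (\<Sum>i\<in>UNIV. \<Sum>s\<in>window N. \<Sum>j\<in>UNIV. \<Sum>t\<in>window N.
      cnj (a $ i) * a $ j * cis (- pairing \<theta> (s - t)) * complex_of_real (covariance P s t $ i $ j))"
    by (intro sum.cong refl sum.swap)
  also have "\<dots> = (\<Sum>i\<in>UNIV. \<Sum>j\<in>UNIV. \<Sum>s\<in>window N. \<Sum>t\<in>window N.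
      cnj (a $ i) * a $ j * cis (- pairing \<theta> (s - t)) * complex_of_real (covariance P s t $ i $ j))"
    by (intro sum.cong refl sum.swap)
  also have "\<dots> = (\<Sum>i\<in>UNIV. \<Sum>j\<in>UNIV. cnj (a $ i) * ((?n * periodogram N P \<theta> $ i $ j) * a $ j))"
  proof -
    have pe: "complex_of_real ?n * periodogram N P \<theta> $ i $ j =
        (\<Sum>s\<in>window N. \<Sum>t\<in>window N. complex_of_real (covariance P s t $ i $ j) * cis (- pairing \<theta> (s - t)))" for i j
      by (simp add: periodogram_def fejer_mean_def cov)
    show ?thesis unfolding pe by (simp add: sum_distrib_left sum_distrib_right mult_ac)
  qed
  also have "\<dots> = ?n * cip a (periodogram N P \<theta> *v a)"
    by (simp add: cip_def matrix_vector_mult_def sum_distrib_left mult_ac)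
  finally have "complex_of_real (LINT z|P. (norm (Z z))\<^sup>2) = complex_of_real ?n * cip a (periodogram N P \<theta> *v a)" by simp
  from arg_cong[OF this, of Re] have "(LINT z|P. (norm (Z z))\<^sup>2) = ?n * Re (cip a (periodogram N P \<theta> *v a))"
    by simp
  moreover have "0 \<le> (LINT z|P. (norm (Z z))\<^sup>2)" by simp
  ultimately show "0 \<le> Re (cip a (periodogram N P \<theta> *v a))"
    by (simp add: zero_le_mult_iff)
qed

section \<open>Second moments of finitely filtered fields\<close>

definition partial_transfer ::
  "(int ^ 'd \<Rightarrow> real ^ 'm ^ 'm) \<Rightarrow> (int ^ 'd) set \<Rightarrow> real ^ 'd \<Rightarrow> complex ^ 'm ^ 'm" where
  "partial_transfer H F \<theta> = (\<chi> l i. \<Sum>u\<in>F. complex_of_real (H u $ l $ i) * cis (- pairing \<theta> u))"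

text \<open>The expected inner product of two jointly stationary fields with cross covariances
  \<open>c\<close>, both filtered by the part of \<open>H\<close> on \<open>F\<close>. The matrix
  \<open>H u\<close> acts on the sample at \<open>t - u\<close>, so the lag between the two samples
  is \<open>v - u\<close>.\<close>

definition cross_term ::
  "(int ^ 'd \<Rightarrow> real ^ 'm ^ 'm) \<Rightarrow> (int ^ 'd) set \<Rightarrow> ('m \<Rightarrow> 'm \<Rightarrow> int ^ 'd \<Rightarrow> real) \<Rightarrow> real" where
  "cross_term H F c = (\<Sum>u\<in>F. \<Sum>v\<in>F. \<Sum>l\<in>UNIV. \<Sum>i\<in>UNIV. \<Sum>j\<in>UNIV. H u $ l $ i * H v $ l $ j * c i j (v - u))"

lemma sum_rotate_5:
  "(\<Sum>l\<in>A. \<Sum>j\<in>B. \<Sum>i\<in>C. \<Sum>u\<in>D. \<Sum>v\<in>E. f l j i u v) =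
    (\<Sum>u\<in>D. \<Sum>v\<in>E. \<Sum>l\<in>A. \<Sum>i\<in>C. \<Sum>j\<in>B. f l j i u v)"
  unfolding sum.cartesian_product
  by (rule sum.reindex_bij_witness[of _ "\<lambda>(u, v, l, i, j). (l, j, i, u, v)" "\<lambda>(l, j, i, u, v). (u, v, l, i, j)"]) auto

lemma integral_sum_5:
  fixes f :: "_ \<Rightarrow> _ \<Rightarrow> _ \<Rightarrow> _ \<Rightarrow> _ \<Rightarrow> _ \<Rightarrow> complex"
  assumes "\<And>u v l i j. integrable M (f u v l i j)"
  shows "(LINT x|M. (\<Sum>u\<in>A. \<Sum>v\<in>B. \<Sum>l\<in>C. \<Sum>i\<in>D. \<Sum>j\<in>E. f u v l i j x)) =
    (\<Sum>u\<in>A. \<Sum>v\<in>B. \<Sum>l\<in>C. \<Sum>i\<in>D. \<Sum>j\<in>E. (LINT x|M. f u v l i j x))"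
  using assms by simp

text \<open>Parseval for a finite filter. Because the entries of \<open>H\<close> are real,
  replacing the Fourier coefficients by their real parts amounts to taking the real part of the
  integral.\<close>

lemma cross_term_spectral:
  fixes \<Phi> :: "real ^ 'd \<Rightarrow> complex ^ 'm ^ 'm"
  assumes \<Phi>: "\<And>i j. integrable torus_measure (\<lambda>\<theta>. \<Phi> \<theta> $ i $ j)"
    and c: "\<And>i j u. c i j u = Re (fourier_coeff (\<lambda>\<theta>. \<Phi> \<theta> $ i $ j) u)"
  shows "cross_term H F c =
    Re (LINT \<theta>|torus_measure. trace (partial_transfer H F \<theta> ** \<Phi> \<theta> ** (partial_transfer H F \<theta>)\<^sup>\<dagger>))"
proof -
  have e: "trace (partial_transfer H F \<theta> ** \<Phi> \<theta> ** (partial_transfer H F \<theta>)\<^sup>\<dagger>) =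
      (\<Sum>u\<in>F. \<Sum>v\<in>F. \<Sum>l\<in>UNIV. \<Sum>i\<in>UNIV. \<Sum>j\<in>UNIV.
        complex_of_real (H u $ l $ i * H v $ l $ j) * (\<Phi> \<theta> $ i $ j * cis (pairing \<theta> (v - u))))" for \<theta>
  proof -
    let ?T = "partial_transfer H F \<theta>"
    have T: "?T $ l $ i = (\<Sum>u\<in>F. complex_of_real (H u $ l $ i) * cis (- pairing \<theta> u))"
      "cnj (?T $ l $ i) = (\<Sum>u\<in>F. complex_of_real (H u $ l $ i) * cis (pairing \<theta> u))" for l i
      by (simp_all add: partial_transfer_def cis_cnj)
    have "trace (?T ** \<Phi> \<theta> ** ?T\<^sup>\<dagger>) = (\<Sum>l\<in>UNIV. \<Sum>j\<in>UNIV. \<Sum>i\<in>UNIV. ?T $ l $ i * \<Phi> \<theta> $ i $ j * cnj (?T $ l $ j))"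
      by (simp add: trace_def matrix_matrix_mult_def sum_distrib_right)
    also have "\<dots> = (\<Sum>l\<in>UNIV. \<Sum>j\<in>UNIV. \<Sum>i\<in>UNIV. \<Sum>u\<in>F. \<Sum>v\<in>F.
        (H u $ l $ i * cis (- pairing \<theta> u)) * \<Phi> \<theta> $ i $ j * (H v $ l $ j * cis (pairing \<theta> v)))"
      unfolding T(2) unfolding T(1) sum_distrib_right unfolding sum_distrib_left ..
    also have "\<dots> = (\<Sum>l\<in>UNIV. \<Sum>j\<in>UNIV. \<Sum>i\<in>UNIV. \<Sum>u\<in>F. \<Sum>v\<in>F.
          complex_of_real (H u $ l $ i * H v $ l $ j) * (\<Phi> \<theta> $ i $ j * cis (pairing \<theta> (v - u))))"
    proof (intro sum.cong refl)
      fix l j i u v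
      have "cis (pairing \<theta> (v - u)) = cis (- pairing \<theta> u) * cis (pairing \<theta> v)"
        by (simp add: pairing_linear cis_mult)
      then show "(H u $ l $ i * cis (- pairing \<theta> u)) * \<Phi> \<theta> $ i $ j * (H v $ l $ j * cis (pairing \<theta> v)) =
          complex_of_real (H u $ l $ i * H v $ l $ j) * (\<Phi> \<theta> $ i $ j * cis (pairing \<theta> (v - u)))"
        by simp
    qed
    also have "\<dots> = (\<Sum>u\<in>F. \<Sum>v\<in>F. \<Sum>l\<in>UNIV. \<Sum>i\<in>UNIV. \<Sum>j\<in>UNIV.
          complex_of_real (H u $ l $ i * H v $ l $ j) * (\<Phi> \<theta> $ i $ j * cis (pairing \<theta> (v - u))))"
      by (rule sum_rotate_5)
    finally show ?thesis .
  qed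
  show ?thesis
  proof -
    note i = integrable_mult_cis[OF \<Phi>]
    have "(LINT \<theta>|torus_measure. trace (partial_transfer H F \<theta> ** \<Phi> \<theta> ** (partial_transfer H F \<theta>)\<^sup>\<dagger>)) =
        (LINT \<theta>|torus_measure. (\<Sum>u\<in>F. \<Sum>v\<in>F. \<Sum>l\<in>UNIV. \<Sum>i\<in>UNIV. \<Sum>j\<in>UNIV.
          complex_of_real (H u $ l $ i * H v $ l $ j) * (\<Phi> \<theta> $ i $ j * cis (pairing \<theta> (v - u)))))"
      by (rule Bochner_Integration.integral_cong[OF refl e])
    also have "\<dots> = (\<Sum>u\<in>F. \<Sum>v\<in>F. \<Sum>l\<in>UNIV. \<Sum>i\<in>UNIV. \<Sum>j\<in>UNIV.
          (LINT \<theta>|torus_measure. complex_of_real (H u $ l $ i * H v $ l $ j) * (\<Phi> \<theta> $ i $ j * cis (pairing \<theta> (v - u)))))"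
      by (rule integral_sum_5) (rule integrable_mult_right, rule i)
    also have "\<dots> = (\<Sum>u\<in>F. \<Sum>v\<in>F. \<Sum>l\<in>UNIV. \<Sum>i\<in>UNIV. \<Sum>j\<in>UNIV.
          complex_of_real (H u $ l $ i * H v $ l $ j) * fourier_coeff (\<lambda>\<theta>. \<Phi> \<theta> $ i $ j) (v - u))"
      by (simp only: fourier_coeff_def integral_mult_right_zero)
    finally show ?thesis by (simp add: cross_term_def c)
  qed
qed

section \<open>Convolution of a field with a summable kernel\<close>

lemma expectation_inner_partial_sums:
  fixes X Y :: "'a \<Rightarrow> int ^ 'd \<Rightarrow> real ^ 'm"
  assumes i: "\<And>s s' i j. integrable P (\<lambda>z. X z s $ i * Y z s' $ j)"
    and c: "\<And>s s' i j. (LINT z|P. X z s $ i * Y z s' $ j) = c i j (s - s')"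
  shows "integrable P (\<lambda>z. (\<Sum>u\<in>F. H u *v X z (t - u)) \<bullet> (\<Sum>u\<in>F. H u *v Y z (t - u)))"
    "(LINT z|P. (\<Sum>u\<in>F. H u *v X z (t - u)) \<bullet> (\<Sum>u\<in>F. H u *v Y z (t - u))) = cross_term H F c"
proof -
  have e: "(\<Sum>u\<in>F. H u *v x (t - u)) \<bullet> (\<Sum>u\<in>F. H u *v y (t - u)) =
      (\<Sum>u\<in>F. \<Sum>v\<in>F. \<Sum>l\<in>UNIV. \<Sum>i\<in>UNIV. \<Sum>j\<in>UNIV. H u $ l $ i * H v $ l $ j * (x (t - u) $ i * y (t - v) $ j))"
    for x y :: "int ^ 'd \<Rightarrow> real ^ 'm"
  proof -
    have "(H u *v a) \<bullet> (H v *v b) = (\<Sum>l\<in>UNIV. \<Sum>i\<in>UNIV. \<Sum>j\<in>UNIV. H u $ l $ i * H v $ l $ j * (a $ i * b $ j))"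
      for u v a b by (simp add: inner_vec_def matrix_vector_mult_def sum_product mult_ac)
    then show ?thesis unfolding inner_sum_left unfolding inner_sum_right by simp
  qed
  show "integrable P (\<lambda>z. (\<Sum>u\<in>F. H u *v X z (t - u)) \<bullet> (\<Sum>u\<in>F. H u *v Y z (t - u)))"
    unfolding e by (intro Bochner_Integration.integrable_sum integrable_mult_right i)
  show "(LINT z|P. (\<Sum>u\<in>F. H u *v X z (t - u)) \<bullet> (\<Sum>u\<in>F. H u *v Y z (t - u))) = cross_term H F c"
    unfolding e cross_term_def using i c by simp
qed

text \<open>A fixed enumeration of the lags turns unordered sums into limits of sequences, the
  setting of dominated convergence.\<close>

lemma lattice_enumeration:
  obtains b :: "nat \<Rightarrow> int ^ 'd" where "bij b"
proof -
  have "inj (\<lambda>n::int. (\<chi> k. n) :: int ^ 'd)" by (auto simp: inj_def vec_eq_iff)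
  then have "infinite (UNIV :: (int ^ 'd) set)"
    using infinite_UNIV_int finite_imageD by (metis finite_subset subset_UNIV)
  then show thesis
    using that bij_betw_from_nat_into[of "UNIV :: (int ^ 'd) set"] by auto
qed

lemma filterlim_enumeration:
  assumes "bij (b :: nat \<Rightarrow> 'a)"
  shows "filterlim (\<lambda>n. b ` {..<n}) (finite_subsets_at_top UNIV) sequentially"
  unfolding filterlim_finite_subsets_at_top
proof (intro allI impI)
  fix X :: "'a set" assume X: "finite X \<and> X \<subseteq> UNIV"
  have "X \<subseteq> b ` {..<n}" if "n > Max (insert 0 (inv b ` X))" for n
  proof
    fix x assume "x \<in> X"
    then have "inv b x \<le> Max (insert 0 (inv b ` X))" using X by (intro Max_ge) auto
    then have "inv b x < n" using that by simp
    moreover have "x = b (inv b x)" using assms by (simp add: bij_is_surj surj_f_inv_f)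
    ultimately show "x \<in> b ` {..<n}" by blast
  qed
  then show "\<forall>\<^sub>F n in sequentially. finite (b ` {..<n}) \<and> X \<subseteq> b ` {..<n} \<and> b ` {..<n} \<subseteq> UNIV"
    by (auto simp: eventually_at_top_dense intro!: exI[of _ "Max (insert 0 (inv b ` X))"])
qed

lemma has_sum_enumeration:
  assumes "bij b" "f summable_on UNIV"
  shows "(\<lambda>n. \<Sum>u\<in>b ` {..<n}. f u) \<longlonglongrightarrow> infsum f UNIV"
  using filterlim_compose[OF has_sum_infsum[OF assms(2), unfolded has_sum_def] filterlim_enumeration[OF assms(1)]] .

lemma sum_norm_square_le:
  fixes g :: "'a \<Rightarrow> real" and q :: "'a \<Rightarrow> real"
  assumes "\<And>u. u \<in> F \<Longrightarrow> 0 \<le> g u"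
  shows "(\<Sum>u\<in>F. g u * q u)\<^sup>2 \<le> (\<Sum>u\<in>F. g u) * (\<Sum>u\<in>F. g u * (q u)\<^sup>2)"
proof -
  have "(\<Sum>u\<in>F. g u * q u) = (\<Sum>u\<in>F. sqrt (g u) * (sqrt (g u) * q u))"
    by (intro sum.cong refl) (simp add: assms mult.assoc[symmetric])
  also have "\<dots>\<^sup>2 \<le> (\<Sum>u\<in>F. (sqrt (g u))\<^sup>2) * (\<Sum>u\<in>F. (sqrt (g u) * q u)\<^sup>2)"
    by (rule Cauchy_Schwarz_ineq_sum)
  also have "\<dots> = (\<Sum>u\<in>F. g u) * (\<Sum>u\<in>F. g u * (q u)\<^sup>2)"
    by (intro arg_cong2[of _ _ _ _ "(*)"] sum.cong refl) (simp_all add: assms power_mult_distrib)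
  finally show ?thesis .
qed

lemma sum_enumeration:
  "bij b \<Longrightarrow> (\<Sum>u\<in>b ` {..<n}. f u) = (\<Sum>k<n::nat. f (b k))"
  by (subst sum.reindex) (auto intro: inj_on_subset[OF bij_is_inj])

lemma summable_on_enumeration:
  fixes f :: "'a \<Rightarrow> real"
  assumes "bij b" "\<And>u. 0 \<le> f u"
  shows "f summable_on UNIV \<longleftrightarrow> summable (\<lambda>k. f (b k))"
  using summable_on_reindex_bij_betw[OF assms(1), of f] assms(2)
  by (subst (asm) summable_on_UNIV_nonneg_real_iff) auto

text \<open>An unordered sum in a Euclidean space has the value 0 as soon as one of its coordinates is not
  absolutely summable.\<close>

lemma infsum_vec_eq_suminf:
  fixes f :: "'a \<Rightarrow> real ^ 'm"
  assumes b: "bij b"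
  shows "infsum f UNIV =
    (if \<forall>i. (\<Sum>k. ennreal \<bar>f (b k) $ i\<bar>) < \<infinity> then \<Sum>k. f (b k) else 0)"
proof (cases "\<forall>i. (\<Sum>k. ennreal \<bar>f (b k) $ i\<bar>) < \<infinity>")
  case True
  have "summable (\<lambda>k. \<bar>f (b k) $ i\<bar>)" for i
    by (rule summable_suminf_not_top) (use True in \<open>auto simp: less_top[symmetric]\<close>)
  then have "summable (\<lambda>k. \<Sum>i\<in>UNIV. \<bar>f (b k) $ i\<bar>)"
    by (intro summable_sum)
  then have "(\<lambda>u. \<Sum>i\<in>UNIV. \<bar>f u $ i\<bar>) summable_on UNIV"
    by (subst summable_on_enumeration[OF b]) (auto intro: sum_nonneg)
  then have "(\<lambda>u. f u) summable_on UNIV"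
    by (rule abs_summable_summable[OF Infinite_Sum.abs_summable_on_comparison_test']) (rule norm_le_l1_cart)
  from has_sum_enumeration[OF b this] have "(\<lambda>k. f (b k)) sums infsum f UNIV"
    unfolding sums_def sum_enumeration[OF b] .
  then show ?thesis using True by (simp add: sums_iff)
next
  case False
  then obtain i where i: "\<not> (\<Sum>k. ennreal \<bar>f (b k) $ i\<bar>) < \<infinity>" by blast
  have "\<not> f summable_on UNIV"
  proof
    assume "f summable_on UNIV"
    then have "(\<lambda>u. f u $ i) summable_on UNIV"
      using summable_on_bounded_linear[OF bounded_linear_vec_nth] by (auto simp: comp_def)
    then have "(\<lambda>u. \<bar>f u $ i\<bar>) summable_on UNIV"
      using summable_on_iff_abs_summable_on_real[of "\<lambda>u. f u $ i" UNIV] by simp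
    then have "summable (\<lambda>k. \<bar>f (b k) $ i\<bar>)"
      by (subst (asm) summable_on_enumeration[OF b]) auto
    then have "(\<Sum>k. ennreal \<bar>f (b k) $ i\<bar>) = ennreal (\<Sum>k. \<bar>f (b k) $ i\<bar>)"
      by (intro suminf_ennreal2) auto
    with i show False by (simp add: less_top[symmetric])
  qed
  then show ?thesis unfolding if_not_P[OF False] by (rule infsum_not_exists)
qed

text \<open>By Cauchy-Schwarz with the weights \<open>norm (H u)\<close>, the squared norms of all
  partial sums lie below one function \<open>w\<close>. It is integrable because the second moments
  of \<open>V\<close> are uniformly bounded and the weights summable; wherever its series converges,
  the convolution converges absolutely.\<close>

lemma convolution_second_moment:
  fixes V :: "'a \<Rightarrow> int ^ 'd \<Rightarrow> real ^ 'm" and H :: "int ^ 'd \<Rightarrow> real ^ 'm ^ 'm"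
  assumes "prob_space P" and V[measurable]: "\<And>s. (\<lambda>z. V z s) \<in> borel_measurable P"
    and Vi: "\<And>s. integrable P (\<lambda>z. (norm (V z s))\<^sup>2)" and VK: "\<And>s. (LINT z|P. (norm (V z s))\<^sup>2) \<le> K"
    and H: "(\<lambda>s. norm (H s)) summable_on UNIV" and b: "bij b"
  shows "(\<lambda>n. LINT z|P. (norm (\<Sum>u\<in>b ` {..<n}. H u *v V z (t - u)))\<^sup>2)
    \<longlonglongrightarrow> (LINT z|P. (norm (convolution H (V z) t))\<^sup>2)"
proof -
  interpret prob_space P by fact
  \<comment> \<open>Summation over the lag \<open>t - s\<close> instead of the site
    \<open>s\<close>, so that truncation concerns \<open>H\<close> alone.\<close>
  have conv_lag: "(\<Sum>\<^sub>\<infinity>u\<in>UNIV. H u *v V z (t - u)) = convolution H (V z) t" for z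
  proof -
    have "bij (\<lambda>s. t - s)" by (rule bij_betw_byWitness[where f' = "\<lambda>s. t - s"]) auto
    then show ?thesis
      unfolding convolution_def
      using infsum_reindex_bij_betw[of "\<lambda>s. t - s" UNIV UNIV "\<lambda>s. H (t - s) *v V z s"] by simp
  qed
  define g where "g k = norm (H (b k))" for k
  define q where "q k z = norm (V z (t - b k))" for k z
  have g0: "0 \<le> g k" for k by (simp add: g_def)
  note sum_b = sum_enumeration[OF b]
  have gs: "summable g"
  proof -
    have "(\<lambda>k. norm (H (b k))) summable_on UNIV"
      using H summable_on_reindex_bij_betw[of b UNIV UNIV "\<lambda>s. norm (H s)"] b by simp
    then show ?thesis unfolding g_def[abs_def] by (subst (asm) summable_on_UNIV_nonneg_real_iff) auto
  qed

  have ai: "integrable P (\<lambda>z. g k * (q k z)\<^sup>2)" for k unfolding q_def using Vi by simp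
  have am: "(LINT z|P. g k * (q k z)\<^sup>2) \<le> g k * K" for k
    unfolding q_def using VK g0 by (simp add: mult_left_mono)
  have ms: "summable (\<lambda>k. LINT z|P. norm (g k * (q k z)\<^sup>2))"
  proof (rule summable_comparison_test'[of "\<lambda>k. g k * K" 0])
    show "summable (\<lambda>k. g k * K)" using gs by (rule summable_mult2)
    show "norm (LINT z|P. norm (g k * (q k z)\<^sup>2)) \<le> g k * K" for k
      using am[of k] g0 by (simp add: abs_mult)
  qed
  have ae: "AE z in P. summable (\<lambda>k. g k * (q k z)\<^sup>2)"
  proof -
    have "(\<integral>\<^sup>+z. (\<Sum>k. ennreal (g k * (q k z)\<^sup>2)) \<partial>P) = (\<Sum>k. \<integral>\<^sup>+z. ennreal (g k * (q k z)\<^sup>2) \<partial>P)"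
      unfolding q_def by (intro nn_integral_suminf) measurable
    also have "\<dots> = (\<Sum>k. ennreal (LINT z|P. norm (g k * (q k z)\<^sup>2)))"
      using ai g0 by (intro suminf_cong) (subst nn_integral_eq_integral, auto)
    also have "\<dots> = ennreal (\<Sum>k. LINT z|P. norm (g k * (q k z)\<^sup>2))"
      using ms by (intro suminf_ennreal2) auto
    finally have "(\<integral>\<^sup>+z. (\<Sum>k. ennreal (g k * (q k z)\<^sup>2)) \<partial>P) \<noteq> \<infinity>" by simp
    then have "AE z in P. (\<Sum>k. ennreal (g k * (q k z)\<^sup>2)) \<noteq> \<infinity>"
      unfolding q_def by (intro nn_integral_PInf_AE) measurable
    then show ?thesis
      by eventually_elim (rule summable_suminf_not_top, use g0 in auto)
  qed
  define w where "w z = (\<Sum>k. g k) * (\<Sum>k. g k * (q k z)\<^sup>2)" for z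
  have wi: "integrable P w"
    unfolding w_def using ae ms ai g0
    by (intro integrable_mult_right integrable_suminf) (auto elim!: eventually_mono simp: abs_mult)
  have conv: "(\<lambda>n. \<Sum>u\<in>b ` {..<n}. H u *v V z (t - u)) \<longlonglongrightarrow> convolution H (V z) t"
    if s: "summable (\<lambda>k. g k * (q k z)\<^sup>2)" for z
  proof -
    have "summable (\<lambda>k. g k * q k z)"
    proof (rule summable_comparison_test'[OF summable_add[OF gs s], of 0])
      fix k
      \<comment> \<open>Convergence with squares passes to first powers, because the weights
        themselves are summable.\<close>
      have "q k z \<le> 1 + (q k z)\<^sup>2"
        using zero_le_power2[of "q k z - 1"] norm_ge_zero[of "V z (t - b k)"]
        unfolding q_def[symmetric] by (simp add: power2_eq_square algebra_simps)
      then have "g k * q k z \<le> g k * (1 + (q k z)\<^sup>2)" by (intro mult_left_mono g0)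
      then show "norm (g k * q k z) \<le> g k + g k * (q k z)\<^sup>2"
        using g0[of k] by (simp add: distrib_left q_def abs_mult)
    qed
    then have "(\<lambda>k. g k * q k z) summable_on UNIV"
      using g0 by (subst summable_on_UNIV_nonneg_real_iff) (auto simp: q_def)
    then have "(\<lambda>u. norm (H u) * norm (V z (t - u))) summable_on UNIV"
      using summable_on_reindex_bij_betw[of b UNIV UNIV "\<lambda>u. norm (H u) * norm (V z (t - u))"] b
      by (simp add: g_def q_def)
    then have "(\<lambda>u. H u *v V z (t - u)) summable_on UNIV"
      by (rule abs_summable_summable[OF Infinite_Sum.abs_summable_on_comparison_test']) (rule norm_matrix_vector_mult_le)
    then have "(\<lambda>n. \<Sum>u\<in>b ` {..<n}. H u *v V z (t - u)) \<longlonglongrightarrow> (\<Sum>\<^sub>\<infinity>u\<in>UNIV. H u *v V z (t - u))"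
      by (rule has_sum_enumeration[OF b])
    also have "(\<Sum>\<^sub>\<infinity>u\<in>UNIV. H u *v V z (t - u)) = convolution H (V z) t" by (rule conv_lag)
    finally show ?thesis .
  qed
  have bound: "(norm (\<Sum>u\<in>b ` {..<n}. H u *v V z (t - u)))\<^sup>2 \<le> w z"
    if s: "summable (\<lambda>k. g k * (q k z)\<^sup>2)" for n z
  proof -
    have "norm (\<Sum>u\<in>b ` {..<n}. H u *v V z (t - u)) \<le> (\<Sum>k<n. g k * q k z)"
      unfolding sum_b g_def q_def by (intro sum_norm_le norm_matrix_vector_mult_le)
    then have "(norm (\<Sum>u\<in>b ` {..<n}. H u *v V z (t - u)))\<^sup>2 \<le> (\<Sum>k<n. g k * q k z)\<^sup>2"
      by (intro power_mono) auto
    also have "\<dots> \<le> (\<Sum>k<n. g k) * (\<Sum>k<n. g k * (q k z)\<^sup>2)"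
      by (rule sum_norm_square_le) (rule g0)
    also have "\<dots> \<le> w z"
      unfolding w_def using g0 gs s
      by (intro mult_mono sum_le_suminf suminf_nonneg sum_nonneg) auto
    finally show ?thesis .
  qed
  have pm: "(\<lambda>z. \<Sum>u\<in>b ` {..<n}. H u *v V z (t - u)) \<in> borel_measurable P" for n
    by (intro borel_measurable_sum measurable_compose[OF V])
      (intro borel_measurable_continuous_onI mv.continuous_on continuous_intros)
  show ?thesis
  proof (rule integral_dominated_convergence[where w = w])
    show "AE z in P. (\<lambda>n. (norm (\<Sum>u\<in>b ` {..<n}. H u *v V z (t - u)))\<^sup>2) \<longlonglongrightarrow> (norm (convolution H (V z) t))\<^sup>2"
      using ae by eventually_elim (intro tendsto_intros conv)
    show "AE z in P. norm ((norm (\<Sum>u\<in>b ` {..<n}. H u *v V z (t - u)))\<^sup>2) \<le> w z" for n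
      using ae by eventually_elim (use bound in auto)
    \<comment> \<open>Convergence holds only almost everywhere and does not by itself give
      measurability; the formula \<open>infsum_vec_eq_suminf\<close>, valid at every point,
      does.\<close>
    show "(\<lambda>z. (norm (convolution H (V z) t))\<^sup>2) \<in> borel_measurable P"
    proof -
      have hm: "(\<lambda>z. H u *v V z (t - u)) \<in> borel_measurable P" for u
        by (intro measurable_compose[OF V]) (intro borel_measurable_continuous_onI mv.continuous_on continuous_intros)
      then have [measurable]: "(\<lambda>z. (H u *v V z (t - u)) $ i) \<in> borel_measurable P" for u i
        by (rule measurable_compose) (intro borel_measurable_continuous_onI continuous_intros)
      note [measurable] = hm
      have "(\<lambda>z. \<Sum>\<^sub>\<infinity>u\<in>UNIV. H u *v V z (t - u)) \<in> borel_measurable P"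
        unfolding infsum_vec_eq_suminf[OF b] by measurable
      then have "(\<lambda>z. convolution H (V z) t) \<in> borel_measurable P" unfolding conv_lag .
      then show ?thesis by measurable
    qed
  qed (use wi pm in auto)
qed

lemma
  fixes H :: "int ^ 'd \<Rightarrow> real ^ 'm ^ 'm"
  assumes H: "(\<lambda>s. norm (H s)) summable_on UNIV" and b: "bij b"
  shows partial_transfer_tendsto: "(\<lambda>n. partial_transfer H (b ` {..<n}) \<theta>) \<longlonglongrightarrow> transfer_function H \<theta>"
    and norm_partial_transfer_le:
      "norm (partial_transfer H (b ` {..<n}) \<theta>) \<le> (real CARD('m))\<^sup>2 * infsum (\<lambda>s. norm (H s)) UNIV"
proof -
  have nt: "norm (complex_of_real (H u $ l $ i) * cis (- pairing \<theta> u)) \<le> norm (H u)" for u l i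
    using Finite_Cartesian_Product.norm_nth_le[of "H u $ l" i] Finite_Cartesian_Product.norm_nth_le[of "H u" l]
    by (simp add: norm_mult)
  show "(\<lambda>n. partial_transfer H (b ` {..<n}) \<theta>) \<longlonglongrightarrow> transfer_function H \<theta>"
    unfolding partial_transfer_def transfer_function_def
    by (intro tendsto_vec_lambda has_sum_enumeration[OF b] abs_summable_summable[OF Infinite_Sum.abs_summable_on_comparison_test'[OF H nt]])
  have "norm (partial_transfer H (b ` {..<n}) \<theta> $ l $ i) \<le> infsum (\<lambda>s. norm (H s)) UNIV" for l i
  proof -
    have "norm (partial_transfer H (b ` {..<n}) \<theta> $ l $ i) \<le> (\<Sum>u\<in>b ` {..<n}. norm (H u))"
      unfolding partial_transfer_def vec_lambda_beta by (intro sum_norm_le nt)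
    also have "\<dots> \<le> infsum (\<lambda>s. norm (H s)) UNIV"
      by (rule finite_sum_le_infsum[OF H]) auto
    finally show ?thesis .
  qed
  then have "norm (partial_transfer H (b ` {..<n}) \<theta>) \<le> (\<Sum>l\<in>(UNIV :: 'm set). \<Sum>i\<in>(UNIV :: 'm set). infsum (\<lambda>s. norm (H s)) UNIV)"
    by (intro order_trans[OF norm_matrix_le_sum] sum_mono)
  then show "norm (partial_transfer H (b ` {..<n}) \<theta>) \<le> (real CARD('m))\<^sup>2 * infsum (\<lambda>s. norm (H s)) UNIV"
    by (simp add: power2_eq_square)
qed

section \<open>Component fields of a joint field\<close>

definition subfield :: "('m \<Rightarrow> 'n) \<Rightarrow> (int ^ 'd \<Rightarrow> real ^ 'n) \<Rightarrow> int ^ 'd \<Rightarrow> real ^ 'm" where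
  "subfield \<iota> z = (\<lambda>t. \<chi> i. z t $ \<iota> i)"

lemma component_eq_subfield: "first_component = subfield Inl" "second_component = subfield Inr"
  by (simp_all add: fun_eq_iff first_component_def second_component_def subfield_def)

lemma measurable_path_component: "(\<lambda>z :: int ^ 'd \<Rightarrow> real ^ 'n. z t $ i) \<in> borel_measurable path_space"
  by (rule measurable_compose[OF measurable_path]) (auto intro: borel_measurable_continuous_onI continuous_intros)

lemma measurable_subfield [measurable]:
  fixes \<iota> :: "'m::finite \<Rightarrow> 'n::finite"
  shows "subfield \<iota> \<in> measurable (path_space :: (int ^ 'd \<Rightarrow> real ^ 'n) measure) path_space"
proof -
  have "(\<lambda>z. subfield \<iota> z t) \<in> borel_measurable (path_space :: (int ^ 'd \<Rightarrow> real ^ 'n) measure)" for t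
  proof (subst borel_measurable_euclidean_space, intro ballI)
    fix b :: "real ^ 'm" assume "b \<in> Basis"
    then obtain i where "b = axis i 1" by (auto simp: Basis_vec_def)
    then show "(\<lambda>z. subfield \<iota> z t \<bullet> b) \<in> borel_measurable (path_space :: (int ^ 'd \<Rightarrow> real ^ 'n) measure)"
      using measurable_path_component by (simp add: inner_axis subfield_def)
  qed
  then show ?thesis
    unfolding path_space_def
    by (intro measurable_PiM_single'[of UNIV "\<lambda>t z. subfield \<iota> z t", simplified]) (auto simp: PiE_UNIV_domain path_space_def)
qed

lemma subfield_law:
  fixes P :: "(int ^ 'd \<Rightarrow> real ^ 'n) measure" and \<iota> :: "'m::finite \<Rightarrow> 'n"
  assumes P: "prob_space P" "sets P = sets path_space" "gaussian_field P" "zero_mean_field P"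
  defines "Q \<equiv> distr P path_space (subfield \<iota>)"
  shows "prob_space Q" "sets Q = sets path_space" "gaussian_field Q" "zero_mean_field Q"
    "covariance Q s t $ i $ j = covariance P s t $ \<iota> i $ \<iota> j"
proof -
  interpret prob_space P by fact
  have m[measurable]: "subfield \<iota> \<in> measurable P path_space"
    using measurable_subfield by (simp cong: measurable_cong_sets add: P(2))
  show "prob_space Q" unfolding Q_def by (rule prob_space_distr) simp
  show "sets Q = sets path_space" by (simp add: Q_def)
  show "gaussian_field Q"
    unfolding gaussian_field_def
  proof (intro allI impI)
    fix T :: "(int ^ 'd) set" and a :: "int ^ 'd \<Rightarrow> real ^ 'm" assume T: "finite T"
    define a' :: "int ^ 'd \<Rightarrow> real ^ 'n" where "a' t = (\<Sum>i\<in>UNIV. a t $ i *\<^sub>R axis (\<iota> i) 1)" for t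
    have e: "a t \<bullet> subfield \<iota> z t = a' t \<bullet> z t" for t z
    proof -
      have "a' t \<bullet> z t = (\<Sum>i\<in>UNIV. a t $ i * z t $ \<iota> i)"
        by (simp add: a'_def inner_sum_left inner_axis')
      then show ?thesis by (simp add: inner_vec_def subfield_def)
    qed
    have "distr Q borel (\<lambda>z. \<Sum>t\<in>T. a t \<bullet> z t) = distr P borel (\<lambda>z. \<Sum>t\<in>T. a' t \<bullet> z t)"
      unfolding Q_def by (subst distr_distr) (auto simp: comp_def e)
    then show "gaussian_distribution (distr Q borel (\<lambda>z. \<Sum>t\<in>T. a t \<bullet> z t))"
      using P(3) T by (simp add: gaussian_field_def)
  qed
  show "zero_mean_field Q"
    unfolding zero_mean_field_def
  proof
    fix t
    have lin: "bounded_linear (\<lambda>v :: real ^ 'n. (\<chi> i. v $ \<iota> i) :: real ^ 'm)"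
      by (rule linear_conv_bounded_linear[THEN iffD1]) (rule linearI, simp_all add: vec_eq_iff)
    have z: "integrable P (\<lambda>z. z t)" "(LINT z|P. z t) = 0" using P(4) by (auto simp: zero_mean_field_def)
    have "integrable P (\<lambda>z. subfield \<iota> z t)" "(LINT z|P. subfield \<iota> z t) = 0"
      unfolding subfield_def using integrable_bounded_linear[OF lin z(1)] integral_bounded_linear[OF lin z(1)] z(2)
      by (simp_all add: vec_eq_iff)
    then show "integrable Q (\<lambda>z. z t) \<and> (LINT z|Q. z t) = 0"
      unfolding Q_def by (simp add: integrable_distr_eq integral_distr)
  qed
  show "covariance Q s t $ i $ j = covariance P s t $ \<iota> i $ \<iota> j"
    unfolding covariance_def Q_def vec_lambda_beta
    using borel_measurable_times[OF measurable_path_component measurable_path_component]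
    by (subst integral_distr) (auto simp: subfield_def)
qed

section \<open>Measurability of matrix-valued functions\<close>

lemma measurable_matrix_mult:
  fixes f :: "'a \<Rightarrow> complex ^ 'n ^ 'm" and g :: "'a \<Rightarrow> complex ^ 'k ^ 'n"
  assumes "f \<in> borel_measurable M" "g \<in> borel_measurable M"
  shows "(\<lambda>x. f x ** g x) \<in> borel_measurable M"
  by (rule borel_measurable_continuous_Pair[OF assms]) (intro mm.continuous_on continuous_intros)

lemma measurable_conj_transpose:
  "f \<in> borel_measurable M \<Longrightarrow> (\<lambda>x. (f x)\<^sup>\<dagger>) \<in> borel_measurable M"
  by (erule measurable_compose)
    (intro borel_measurable_continuous_onI linear_continuous_on bounded_linear_conj_transpose)

lemma measurable_trace:
  "f \<in> borel_measurable M \<Longrightarrow> (\<lambda>x. trace (f x :: complex ^ 'n ^ 'n)) \<in> borel_measurable M"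
  by (erule measurable_compose)
    (intro borel_measurable_continuous_onI linear_continuous_on bounded_linear_trace)

lemma measurable_matrix_nth:
  fixes f :: "'a \<Rightarrow> complex ^ 'n ^ 'm"
  shows "f \<in> borel_measurable M \<Longrightarrow> (\<lambda>x. f x $ i $ j) \<in> borel_measurable M"
  by (erule measurable_compose) (intro borel_measurable_continuous_onI continuous_intros)

lemma measurable_vec_lambda:
  fixes f :: "'a \<Rightarrow> 'm::finite \<Rightarrow> 'n::finite \<Rightarrow> complex"
  assumes "\<And>i j. (\<lambda>x. f x i j) \<in> borel_measurable M"
  shows "(\<lambda>x. (\<chi> i j. f x i j) :: complex ^ 'n ^ 'm) \<in> borel_measurable M"
proof (subst borel_measurable_euclidean_space, intro ballI)
  fix b :: "complex ^ 'n ^ 'm" assume "b \<in> Basis"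
  then obtain i j c where "b = axis i (axis j c)" by (auto simp: Basis_vec_def)
  then show "(\<lambda>x. (\<chi> i j. f x i j) \<bullet> b) \<in> borel_measurable M"
    using assms by (simp add: inner_axis)
qed

text \<open>\<open>psd_sqrt\<close> and the shifted inverse are known to be continuous on the closed
  set of positive semidefinite matrices. Extended by 0 they become Borel functions, which agree with
  the original ones along an everywhere positive semidefinite \<open>f\<close>.\<close>

lemma measurable_continuous_on_psd:
  fixes g :: "complex ^ 'n ^ 'n \<Rightarrow> complex ^ 'n ^ 'n"
  assumes g: "continuous_on {A. psd A} g" and f: "f \<in> borel_measurable M" "\<And>x. psd (f x)"
  shows "(\<lambda>x. g (f x)) \<in> borel_measurable M"
proof -
  have "(\<lambda>A. if A \<in> {A. psd A} then g A else 0) \<in> borel_measurable borel"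
    by (rule borel_measurable_continuous_on_if[OF borel_closed[OF closed_psd] g]) simp
  from measurable_compose[OF f(1) this] f(2) show ?thesis by simp
qed

lemmas measurable_psd_sqrt = measurable_continuous_on_psd[OF continuous_on_psd_sqrt]

lemma measurable_fidelity_arg:
  assumes "f \<in> borel_measurable M" "g \<in> borel_measurable M" "h \<in> borel_measurable M" "\<And>x. psd (h x)"
  shows "(\<lambda>x. psd_sqrt (h x) ** g x ** f x ** g x ** psd_sqrt (h x)) \<in> borel_measurable M"
  using assms by (intro measurable_matrix_mult measurable_psd_sqrt)

lemma measurable_fidelity:
  assumes "f \<in> borel_measurable M" "g \<in> borel_measurable M" "h \<in> borel_measurable M"
    "\<And>x. psd (f x)" "\<And>x. (g x)\<^sup>\<dagger> = g x" "\<And>x. psd (h x)"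
  shows "(\<lambda>x. fidelity (f x) (g x) (h x)) \<in> borel_measurable M"
  unfolding fidelity_def using assms
  by (intro measurable_compose[OF measurable_trace borel_measurable_Re] measurable_psd_sqrt measurable_fidelity_arg psd_fidelity_arg)

lemma measurable_optimal_cross:
  assumes "f \<in> borel_measurable M" "g \<in> borel_measurable M" "h \<in> borel_measurable M"
    "\<And>x. psd (f x)" "\<And>x. (g x)\<^sup>\<dagger> = g x" "\<And>x. psd (h x)" "0 < \<delta>"
  shows "(\<lambda>x. optimal_cross \<delta> (f x) (g x) (h x)) \<in> borel_measurable M"
  unfolding optimal_cross_def using assms
  by (intro measurable_matrix_mult measurable_psd_sqrt measurable_fidelity_arg psd_fidelity_arg
      measurable_continuous_on_psd[OF continuous_on_shift_inverse] psd_sqrt(1))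

lemma hermitian_conj_transpose_mult: "(X\<^sup>\<dagger> ** X)\<^sup>\<dagger> = X\<^sup>\<dagger> ** X"
  by (simp add: conj_transpose_mult)

lemma trace_congruence: "trace (X ** M ** X\<^sup>\<dagger>) = trace ((X\<^sup>\<dagger> ** X) ** (M :: complex ^ 'n ^ 'n))"
  using trace_mul_sym[of "X ** M" "X\<^sup>\<dagger>"] by (simp add: matrix_mul_assoc)

lemma norm_matrix_le_entries:
  fixes A :: "complex ^ 'n ^ 'n"
  assumes "\<And>i j. norm (A $ i $ j) \<le> c" shows "norm A \<le> (real CARD('n))\<^sup>2 * c"
proof -
  have "norm A \<le> (\<Sum>i\<in>(UNIV :: 'n set). \<Sum>j\<in>(UNIV :: 'n set). c)"
    by (rule order_trans[OF norm_matrix_le_sum]) (intro sum_mono assms)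
  then show ?thesis by (simp add: power2_eq_square)
qed

section \<open>Couplings of two spectral densities\<close>

text \<open>Exceptional null sets are removed once and for all: where one of the two inequalities
  fails, the density is replaced by 0, which satisfies both. The pointwise matrix lemmas then apply
  at every frequency.\<close>

lemma bounded_density_version:
  fixes \<Phi> :: "real ^ 'd \<Rightarrow> complex ^ 'm ^ 'm"
  assumes \<Phi>: "\<Phi> \<in> borel_measurable torus_measure" "AE \<theta> in torus_measure. psd (\<Phi> \<theta>)" "bounded_coercive \<Phi>"
  obtains A C where "A \<in> borel_measurable torus_measure" "\<And>\<theta>. psd (A \<theta>)"
    "\<And>\<theta> i. Re (A \<theta> $ i $ i) \<le> C" "AE \<theta> in torus_measure. A \<theta> = \<Phi> \<theta>"
proof -
  obtain c C where C: "0 < c" "c \<le> C" "AE \<theta> in torus_measure. psd (mat (complex_of_real C) - \<Phi> \<theta>)"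
    using \<Phi>(3) unfolding bounded_coercive_def by auto
  define S where "S = {M :: complex ^ 'm ^ 'm. psd M} \<inter> {M. psd (mat (complex_of_real C) - M)}"
  define A where "A \<theta> = (if \<Phi> \<theta> \<in> S then \<Phi> \<theta> else 0)" for \<theta>
  have "closed {M :: complex ^ 'm ^ 'm. psd (mat (complex_of_real C) - M)}"
    using continuous_closed_vimage[OF closed_psd, of "\<lambda>M. mat (complex_of_real C) - M"]
    by (auto simp: vimage_def continuous_at_imp_continuous_on intro!: continuous_intros)
  then have S: "S \<in> sets borel" unfolding S_def using closed_psd by (intro sets.Int borel_closed)
  have "(\<lambda>M. if M \<in> S then M else 0) \<in> borel_measurable borel"
    by (rule borel_measurable_continuous_on_if[OF S]) (auto intro!: continuous_intros)
  from measurable_compose[OF \<Phi>(1) this] have "A \<in> borel_measurable torus_measure"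
    by (simp add: A_def[abs_def])
  moreover have p: "psd (A \<theta>)" "psd (mat (complex_of_real C) - A \<theta>)" for \<theta>
    using C psd_mat[of C] by (auto simp: A_def S_def)
  moreover have "Re (A \<theta> $ i $ i) \<le> C" for \<theta> i
    using psd_diag_nonneg[OF p(2)[of \<theta>], of i] by (simp add: mat_def)
  moreover have "AE \<theta> in torus_measure. A \<theta> = \<Phi> \<theta>"
    using \<Phi>(2) C(3) by eventually_elim (simp add: A_def S_def)
  ultimately show thesis using that by blast
qed

locale spectral_pair =
  fixes A B :: "real ^ 'd \<Rightarrow> complex ^ 'm ^ 'm" and H :: "int ^ 'd \<Rightarrow> real ^ 'm ^ 'm"
    and b :: "nat \<Rightarrow> int ^ 'd" and C :: real
  assumes A_measurable: "A \<in> borel_measurable torus_measure" and psd_A: "\<And>\<theta>. psd (A \<theta>)"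
    and B_measurable: "B \<in> borel_measurable torus_measure" and psd_B: "\<And>\<theta>. psd (B \<theta>)"
    and A_diag: "\<And>\<theta> i. Re (A \<theta> $ i $ i) \<le> C" and B_diag: "\<And>\<theta> i. Re (B \<theta> $ i $ i) \<le> C"
    and H_summable: "(\<lambda>s. norm (H s)) summable_on UNIV" and bij_b: "bij b"
begin

abbreviation lags :: "nat \<Rightarrow> (int ^ 'd) set" where
  "lags n \<equiv> b ` {..<n}"

abbreviation transfer :: "nat \<Rightarrow> real ^ 'd \<Rightarrow> complex ^ 'm ^ 'm" where
  "transfer n \<equiv> partial_transfer H (lags n)"

abbreviation partial_weight :: "nat \<Rightarrow> real ^ 'd \<Rightarrow> complex ^ 'm ^ 'm" where
  "partial_weight n \<theta> \<equiv> (transfer n \<theta>)\<^sup>\<dagger> ** transfer n \<theta>"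

text \<open>The squared dimension here and in \<open>spectral_bound\<close> comes from estimating a
  Frobenius norm by the sum of the moduli of the entries.\<close>

definition transfer_bound where "transfer_bound = (real CARD('m))\<^sup>2 * infsum (\<lambda>s. norm (H s)) UNIV"

definition spectral_bound where "spectral_bound = (real CARD('m))\<^sup>2 * C"

lemma A_entry: "norm (A \<theta> $ i $ j) \<le> C"
  using norm_entry_le_psd[OF psd_A, of \<theta> i j] A_diag[of \<theta> i] A_diag[of \<theta> j] by simp

lemma B_entry: "norm (B \<theta> $ i $ j) \<le> C"
  using norm_entry_le_psd[OF psd_B, of \<theta> i j] B_diag[of \<theta> i] B_diag[of \<theta> j] by simp

lemma norm_A: "norm (A \<theta>) \<le> spectral_bound" and norm_B: "norm (B \<theta>) \<le> spectral_bound"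
  unfolding spectral_bound_def by (intro norm_matrix_le_entries A_entry B_entry)+

lemma transfer_tendsto: "(\<lambda>n. transfer n \<theta>) \<longlonglongrightarrow> transfer_function H \<theta>"
  by (rule partial_transfer_tendsto[OF H_summable bij_b])

lemma norm_transfer: "norm (transfer n \<theta>) \<le> transfer_bound"
  unfolding transfer_bound_def by (rule norm_partial_transfer_le[OF H_summable bij_b])

lemma norm_transfer_function: "norm (transfer_function H \<theta>) \<le> transfer_bound"
  by (rule LIMSEQ_le_const2[OF tendsto_norm[OF transfer_tendsto]]) (use norm_transfer in auto)

lemma transfer_bound_nonneg: "0 \<le> transfer_bound"
  using order_trans[OF norm_ge_zero norm_transfer_function] .

lemma transfer_measurable: "partial_transfer H F \<in> borel_measurable torus_measure"
  unfolding partial_transfer_def[abs_def]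
  by (intro measurable_vec_lambda borel_measurable_sum borel_measurable_torus_continuous continuous_intros)

lemma transfer_function_measurable: "transfer_function H \<in> borel_measurable torus_measure"
  by (rule borel_measurable_LIMSEQ_metric[OF transfer_measurable transfer_tendsto])

lemma weight_eq: "weight H \<theta> = (transfer_function H \<theta>)\<^sup>\<dagger> ** transfer_function H \<theta>"
  by (simp add: weight_def)

lemma weight_hermitian: "(weight H \<theta>)\<^sup>\<dagger> = weight H \<theta>"
  unfolding weight_eq by (rule hermitian_conj_transpose_mult)

lemma weight_measurable: "weight H \<in> borel_measurable torus_measure"
  unfolding weight_def[abs_def]
  by (intro measurable_matrix_mult measurable_conj_transpose transfer_function_measurable)

lemma partial_weight_measurable: "(\<lambda>\<theta>. (partial_transfer H F \<theta>)\<^sup>\<dagger> ** partial_transfer H F \<theta>) \<in> borel_measurable torus_measure"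
  by (intro measurable_matrix_mult measurable_conj_transpose transfer_measurable)

lemma norm_conj_transpose_mult_le: "norm X \<le> transfer_bound \<Longrightarrow> norm (X\<^sup>\<dagger> ** X) \<le> transfer_bound\<^sup>2"
  for X :: "complex ^ 'm ^ 'm"
  using norm_matrix_mult_le[of "X\<^sup>\<dagger>" X] mult_mono[of "norm X" transfer_bound "norm X" transfer_bound] transfer_bound_nonneg
  by (simp add: power2_eq_square)

lemma norm_weight: "norm (weight H \<theta>) \<le> transfer_bound\<^sup>2"
  unfolding weight_eq by (rule norm_conj_transpose_mult_le[OF norm_transfer_function])

lemma partial_weight_tendsto: "(\<lambda>n. partial_weight n \<theta>) \<longlonglongrightarrow> weight H \<theta>"
  unfolding weight_eq
  by (intro mm.tendsto bounded_linear.tendsto[OF bounded_linear_conj_transpose] transfer_tendsto)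

lemma trace_bound: "norm X \<le> transfer_bound \<Longrightarrow> norm M \<le> c \<Longrightarrow> norm (trace (X ** M ** X\<^sup>\<dagger>)) \<le> real CARD('m) * (transfer_bound * c * transfer_bound)"
  for X M :: "complex ^ 'm ^ 'm"
proof -
  assume X: "norm X \<le> transfer_bound" and M: "norm M \<le> c"
  have c: "0 \<le> c" using order_trans[OF norm_ge_zero M] .
  have "norm (trace (X ** M ** X\<^sup>\<dagger>)) \<le> real CARD('m) * norm (X ** M ** X\<^sup>\<dagger>)" by (rule norm_trace_le)
  also have "norm (X ** M ** X\<^sup>\<dagger>) \<le> norm X * norm M * norm (X\<^sup>\<dagger>)"
    by (intro norm_matrix_mult_le[THEN order_trans] mult_mono) auto
  also have "\<dots> \<le> transfer_bound * c * transfer_bound" using X M c transfer_bound_nonneg by (intro mult_mono) auto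
  finally show ?thesis by (simp add: mult_left_mono)
qed

lemma trace_integral_tendsto:
  assumes M: "M \<in> borel_measurable torus_measure" "\<And>\<theta>. norm (M \<theta>) \<le> c"
  shows "(\<lambda>n. LINT \<theta>|torus_measure. trace (transfer n \<theta> ** M \<theta> ** (transfer n \<theta>)\<^sup>\<dagger>))
      \<longlonglongrightarrow> (LINT \<theta>|torus_measure. trace (weight H \<theta> ** M \<theta>))"
    and "integrable torus_measure (\<lambda>\<theta>. trace (weight H \<theta> ** M \<theta>))"
proof -
  have m: "(\<lambda>\<theta>. trace (weight H \<theta> ** M \<theta>)) \<in> borel_measurable torus_measure"
    by (intro measurable_trace measurable_matrix_mult weight_measurable M)
  show "(\<lambda>n. LINT \<theta>|torus_measure. trace (transfer n \<theta> ** M \<theta> ** (transfer n \<theta>)\<^sup>\<dagger>))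
      \<longlonglongrightarrow> (LINT \<theta>|torus_measure. trace (weight H \<theta> ** M \<theta>))"
  proof (rule integral_dominated_convergence[where w = "\<lambda>_. real CARD('m) * (transfer_bound * c * transfer_bound)"])
    show "(\<lambda>\<theta>. trace (transfer n \<theta> ** M \<theta> ** (transfer n \<theta>)\<^sup>\<dagger>)) \<in> borel_measurable torus_measure" for n
      by (intro measurable_trace measurable_matrix_mult measurable_conj_transpose transfer_measurable M)
    show "AE \<theta> in torus_measure. norm (trace (transfer n \<theta> ** M \<theta> ** (transfer n \<theta>)\<^sup>\<dagger>)) \<le> real CARD('m) * (transfer_bound * c * transfer_bound)" for n
      using trace_bound[OF norm_transfer M(2)] by (intro AE_I2)
    have "(\<lambda>n. trace (transfer n \<theta> ** M \<theta> ** (transfer n \<theta>)\<^sup>\<dagger>)) \<longlonglongrightarrow> trace (weight H \<theta> ** M \<theta>)" for \<theta>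
      unfolding trace_congruence
      by (intro bounded_linear.tendsto[OF bounded_linear_trace] mm.tendsto tendsto_const partial_weight_tendsto)
    then show "AE \<theta> in torus_measure. (\<lambda>n. trace (transfer n \<theta> ** M \<theta> ** (transfer n \<theta>)\<^sup>\<dagger>)) \<longlonglongrightarrow> trace (weight H \<theta> ** M \<theta>)"
      by (intro AE_I2)
  qed (use m in auto)
  have "norm (trace (weight H \<theta> ** M \<theta>)) \<le> real CARD('m) * (transfer_bound * c * transfer_bound)" for \<theta>
    using trace_bound[OF norm_transfer_function[of \<theta>] M(2)[of \<theta>]] unfolding trace_congruence weight_eq .
  then show "integrable torus_measure (\<lambda>\<theta>. trace (weight H \<theta> ** M \<theta>))"
    by (rule integrable_torus_bounded[OF m])
qed

lemma fidelity_integrable: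
  assumes "f \<in> borel_measurable torus_measure" "g \<in> borel_measurable torus_measure" "h \<in> borel_measurable torus_measure"
    "\<And>x. psd (f x)" "\<And>x. (g x)\<^sup>\<dagger> = g x" "\<And>x. psd (h x)" "\<And>x. norm (f x) \<le> a'" "\<And>x. norm (h x) \<le> a'" "\<And>x. norm (g x) \<le> w"
  shows "integrable torus_measure (\<lambda>\<theta> :: real ^ 'd. fidelity (f \<theta>) (g \<theta>) (h \<theta> :: complex ^ 'm ^ 'm))"
proof (rule integrable_torus_bounded[OF measurable_fidelity])
  fix \<theta>
  show "norm (fidelity (f \<theta>) (g \<theta>) (h \<theta>)) \<le> (real CARD('m))\<^sup>2 * w * a'"
    using fidelity_nonneg[of "f \<theta>" "g \<theta>" "h \<theta>" a' w] fidelity_le[of "f \<theta>" "g \<theta>" "h \<theta>" a' w] assms by auto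
qed (use assms in auto)

lemma fidelity_integral_tendsto:
  "(\<lambda>n. LINT \<theta>|torus_measure. fidelity (A \<theta>) (partial_weight n \<theta>) (B \<theta>))
    \<longlonglongrightarrow> (LINT \<theta>|torus_measure. fidelity (A \<theta>) (weight H \<theta>) (B \<theta>))"
proof (rule integral_dominated_convergence[where w = "\<lambda>_. (real CARD('m))\<^sup>2 * transfer_bound\<^sup>2 * spectral_bound"])
  show "(\<lambda>\<theta>. fidelity (A \<theta>) (weight H \<theta>) (B \<theta>)) \<in> borel_measurable torus_measure"
    by (intro measurable_fidelity A_measurable B_measurable weight_measurable psd_A psd_B weight_hermitian)
  show "(\<lambda>\<theta>. fidelity (A \<theta>) (partial_weight n \<theta>) (B \<theta>)) \<in> borel_measurable torus_measure" for n
    by (intro measurable_fidelity A_measurable B_measurable partial_weight_measurable psd_A psd_B hermitian_conj_transpose_mult)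
  show "AE \<theta> in torus_measure. norm (fidelity (A \<theta>) (partial_weight n \<theta>) (B \<theta>)) \<le> (real CARD('m))\<^sup>2 * transfer_bound\<^sup>2 * spectral_bound" for n
  proof (rule AE_I2)
    fix \<theta>
    note h = psd_A[of \<theta>] hermitian_conj_transpose_mult[of "transfer n \<theta>"] psd_B[of \<theta>] norm_A[of \<theta>] norm_B[of \<theta>]
      norm_conj_transpose_mult_le[OF norm_transfer[of n \<theta>]]
    show "norm (fidelity (A \<theta>) (partial_weight n \<theta>) (B \<theta>)) \<le> (real CARD('m))\<^sup>2 * transfer_bound\<^sup>2 * spectral_bound"
      using fidelity_nonneg[OF h] fidelity_le[OF h] by simp
  qed
  show "AE \<theta> in torus_measure. (\<lambda>n. fidelity (A \<theta>) (partial_weight n \<theta>) (B \<theta>)) \<longlonglongrightarrow> fidelity (A \<theta>) (weight H \<theta>) (B \<theta>)"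
    by (intro AE_I2 fidelity_tendsto tendsto_const partial_weight_tendsto psd_A psd_B weight_hermitian hermitian_conj_transpose_mult)
qed simp

text \<open>The fidelity stands apart because the other two terms depend only on the marginals and
  are common to all couplings.\<close>

definition optimal_cost :: real where
  "optimal_cost = Re (LINT \<theta>|torus_measure. trace (weight H \<theta> ** A \<theta>)) +
    Re (LINT \<theta>|torus_measure. trace (weight H \<theta> ** B \<theta>)) -
    2 * (LINT \<theta>|torus_measure. fidelity (A \<theta>) (weight H \<theta>) (B \<theta>))"

lemma integrable_entry:
  assumes "M \<in> borel_measurable torus_measure" "\<And>\<theta> i j. norm (M \<theta> $ i $ j) \<le> c"
  shows "integrable torus_measure (\<lambda>\<theta> :: real ^ 'd. M \<theta> $ i $ (j :: 'm) :: complex)"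
  using measurable_matrix_nth[OF assms(1)] assms(2) by (rule integrable_torus_bounded)

lemma optimal_cost_eq:
  "complex_of_real optimal_cost = trace (LINT \<theta>|torus_measure. weight H \<theta> ** A \<theta> + weight H \<theta> ** B \<theta>
    - 2 *\<^sub>R psd_sqrt (psd_sqrt (B \<theta>) ** weight H \<theta> ** A \<theta> ** weight H \<theta> ** psd_sqrt (B \<theta>)))"
proof -
  define S where "S \<theta> = psd_sqrt (psd_sqrt (B \<theta>) ** weight H \<theta> ** A \<theta> ** weight H \<theta> ** psd_sqrt (B \<theta>))" for \<theta>
  have psdS: "psd (S \<theta>)" for \<theta>
    unfolding S_def by (intro psd_sqrt(1) psd_fidelity_arg psd_A psd_B weight_hermitian)
  have Sm: "S \<in> borel_measurable torus_measure"
    unfolding S_def[abs_def]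
    by (intro measurable_psd_sqrt measurable_fidelity_arg psd_fidelity_arg A_measurable B_measurable weight_measurable psd_A psd_B weight_hermitian)
  have Si: "integrable torus_measure S"
  proof (rule integrable_torus_bounded[OF Sm])
    show "norm (S \<theta>) \<le> real CARD('m) * transfer_bound\<^sup>2 * spectral_bound" for \<theta>
      unfolding S_def
      by (rule norm_psd_sqrt_fidelity_arg_le[OF psd_A weight_hermitian psd_B norm_A norm_B norm_weight])
  qed
  have WM: "integrable torus_measure (\<lambda>\<theta>. weight H \<theta> ** M \<theta>)"
    if "M \<in> borel_measurable torus_measure" "\<And>\<theta>. norm (M \<theta>) \<le> spectral_bound" for M :: "real ^ 'd \<Rightarrow> complex ^ 'm ^ 'm"
  proof (rule integrable_torus_bounded)
    show "(\<lambda>\<theta>. weight H \<theta> ** M \<theta>) \<in> borel_measurable torus_measure"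
      by (intro measurable_matrix_mult weight_measurable that)
    show "norm (weight H \<theta> ** M \<theta>) \<le> transfer_bound\<^sup>2 * spectral_bound" for \<theta>
      by (rule order_trans[OF norm_matrix_mult_le]) (intro mult_mono norm_weight that, auto)
  qed
  note WA = WM[OF A_measurable norm_A] and WB = WM[OF B_measurable norm_B]
  \<comment> \<open>The trace equals that of the congruence of \<open>M\<close> by the adjoint of
    the transfer function, a positive semidefinite matrix.\<close>
  have real: "trace (weight H \<theta> ** M) = of_real (Re (trace (weight H \<theta> ** M)))" if "psd M" for \<theta> M
  proof -
    have "psd (((transfer_function H \<theta>)\<^sup>\<dagger>)\<^sup>\<dagger> ** M ** (transfer_function H \<theta>)\<^sup>\<dagger>)"
      by (rule psd_congruence[OF that])
    from psd_trace(2)[OF this] show ?thesis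
      by (simp add: trace_congruence weight_eq complex_eq_iff)
  qed
  have t: "bounded_linear (trace :: complex ^ 'm ^ 'm \<Rightarrow> complex)" by (rule bounded_linear_trace)
  have "trace (LINT \<theta>|torus_measure. weight H \<theta> ** A \<theta> + weight H \<theta> ** B \<theta> - 2 *\<^sub>R S \<theta>) =
      (LINT \<theta>|torus_measure. trace (weight H \<theta> ** A \<theta> + weight H \<theta> ** B \<theta> - 2 *\<^sub>R S \<theta>))"
    using WA WB Si by (intro integral_bounded_linear[OF t, symmetric]) auto
  also have "\<dots> = (LINT \<theta>|torus_measure. complex_of_real (Re (trace (weight H \<theta> ** A \<theta>)) + Re (trace (weight H \<theta> ** B \<theta>))
      - 2 * fidelity (A \<theta>) (weight H \<theta>) (B \<theta>)))"
  proof (rule Bochner_Integration.integral_cong[OF refl])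
    fix \<theta> :: "real ^ 'd"
    have "trace (S \<theta>) = of_real (fidelity (A \<theta>) (weight H \<theta>) (B \<theta>))"
      using psd_trace(2)[OF psdS, of \<theta>] by (simp add: complex_eq_iff fidelity_def S_def)
    then show "trace (weight H \<theta> ** A \<theta> + weight H \<theta> ** B \<theta> - 2 *\<^sub>R S \<theta>) =
        complex_of_real (Re (trace (weight H \<theta> ** A \<theta>)) + Re (trace (weight H \<theta> ** B \<theta>)) - 2 * fidelity (A \<theta>) (weight H \<theta>) (B \<theta>))"
      using real[OF psd_A, of \<theta> \<theta>] real[OF psd_B, of \<theta> \<theta>] by (simp add: trace_add trace_sub trace_scaleR)
  qed
  also have "\<dots> = complex_of_real (LINT \<theta>|torus_measure. Re (trace (weight H \<theta> ** A \<theta>)) + Re (trace (weight H \<theta> ** B \<theta>))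
      - 2 * fidelity (A \<theta>) (weight H \<theta>) (B \<theta>))"
    by (rule integral_complex_of_real)
  also have "(LINT \<theta>|torus_measure. Re (trace (weight H \<theta> ** A \<theta>)) + Re (trace (weight H \<theta> ** B \<theta>))
      - 2 * fidelity (A \<theta>) (weight H \<theta>) (B \<theta>)) = optimal_cost"
  proof -
    have "integrable torus_measure (\<lambda>\<theta>. fidelity (A \<theta>) (weight H \<theta>) (B \<theta>))"
      by (rule fidelity_integrable[OF A_measurable weight_measurable B_measurable psd_A weight_hermitian psd_B norm_A norm_B norm_weight])
    then show ?thesis
      unfolding optimal_cost_def
      using trace_integral_tendsto(2)[OF A_measurable norm_A] trace_integral_tendsto(2)[OF B_measurable norm_B]
      by simp
  qed
  finally show ?thesis by (simp add: S_def)
qed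

end

text \<open>Rests on the completeness of Lebesgue measure. The integrand of the theorem is
  uncontrolled on a null set, as \<open>psd_sqrt\<close> has no specified value off the positive
  semidefinite matrices.\<close>

lemma measurable_torus_AE:
  fixes f g :: "real ^ 'd \<Rightarrow> 'b::euclidean_space"
  assumes g: "g \<in> borel_measurable torus_measure" and ae: "AE \<theta> in torus_measure. g \<theta> = f \<theta>"
  shows "f \<in> borel_measurable torus_measure"
proof -
  have r: "h \<in> borel_measurable torus_measure \<longleftrightarrow> (\<lambda>\<theta>. indicator torus_box \<theta> *\<^sub>R h \<theta>) \<in> borel_measurable lebesgue"
    for h :: "real ^ 'd \<Rightarrow> 'b"
    unfolding measurable_cong_sets[OF sets_torus_measure refl]
    by (rule borel_measurable_restrict_space_iff) simp
  have "AE \<theta> in lebesgue. \<theta> \<in> torus_box \<longrightarrow> g \<theta> = f \<theta>"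
    using ae unfolding AE_torus_measure by (subst (asm) AE_restrict_space_iff) auto
  then have "AE \<theta> in lebesgue. indicator torus_box \<theta> *\<^sub>R g \<theta> = indicator torus_box \<theta> *\<^sub>R f \<theta>"
    by eventually_elim (auto simp: indicator_def)
  with g show ?thesis unfolding r by (rule borel_measurable_AE)
qed

text \<open>For each truncation the squared norm of the difference expands into two marginal terms
  and a cross term. By stationarity the second moment of the difference field is the same at every
  site, which is the uniform bound that \<open>convolution_second_moment\<close> asks for.\<close>

lemma coupling_cost_tendsto:
  fixes P :: "(int ^ 'd \<Rightarrow> real ^ ('m::finite + 'm)) measure" and H :: "int ^ 'd \<Rightarrow> real ^ 'm ^ 'm"
  assumes P: "gaussian_stationary_law P" and H: "(\<lambda>s. norm (H s)) summable_on UNIV" and b: "bij b"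
  shows "(\<lambda>n. cross_term H (b ` {..<n}) (\<lambda>i j u. covariance P u 0 $ Inl i $ Inl j) +
      cross_term H (b ` {..<n}) (\<lambda>i j u. covariance P u 0 $ Inr i $ Inr j) -
      2 * cross_term H (b ` {..<n}) (\<lambda>i j u. covariance P u 0 $ Inl i $ Inr j))
    \<longlonglongrightarrow> (LINT z|P. (norm (convolution H (\<lambda>s. first_component z s - second_component z s) t))\<^sup>2)"
proof -
  have P: "prob_space P" "sets P = sets path_space" "gaussian_field P" "zero_mean_field P" "stationary_field P"
    using P by (auto simp: gaussian_stationary_law_def)
  have int: "integrable P (\<lambda>z. z s $ k * z s' $ l)" for s s' k l
    by (rule gaussian_field_component(3)[OF P(3,4,2)])
  have cov: "(LINT z|P. z s $ k * z s' $ l) = covariance P (s - s') 0 $ k $ l" for s s' k l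
  proof -
    have "(LINT z|P. z s $ k * z s' $ l) = covariance P s s' $ k $ l" by (simp add: covariance_def)
    then show ?thesis by (simp only: stationary_covariance[OF P(5), of s s'])
  qed
  have comp: "first_component z s $ i = z s $ Inl i" "second_component z s $ i = z s $ Inr i"
    for z :: "int ^ 'd \<Rightarrow> real ^ ('m + 'm)" and s i
    by (simp_all add: first_component_def second_component_def)
  define V where "V z s = first_component z s - second_component z s" for z :: "int ^ 'd \<Rightarrow> real ^ ('m + 'm)" and s
  define x where "x n z = (\<Sum>u\<in>b ` {..<n}. H u *v first_component z (t - u))" for n and z :: "int ^ 'd \<Rightarrow> real ^ ('m + 'm)"
  define y where "y n z = (\<Sum>u\<in>b ` {..<n}. H u *v second_component z (t - u))" for n and z :: "int ^ 'd \<Rightarrow> real ^ ('m + 'm)"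
  have Vn: "(norm (V z s))\<^sup>2 = (\<Sum>i\<in>UNIV. z s $ Inl i * z s $ Inl i + z s $ Inr i * z s $ Inr i - 2 * (z s $ Inl i * z s $ Inr i))" for z s
    unfolding norm_vec_power2 V_def by (intro sum.cong refl) (simp add: comp power2_eq_square algebra_simps)
  have "(\<lambda>n. LINT z|P. (norm (\<Sum>u\<in>b ` {..<n}. H u *v V z (t - u)))\<^sup>2) \<longlonglongrightarrow> (LINT z|P. (norm (convolution H (V z) t))\<^sup>2)"
  proof (rule convolution_second_moment[OF P(1) _ _ _ H b])
    fix s
    have "first_component \<in> measurable P path_space" "second_component \<in> measurable P path_space"
      unfolding component_eq_subfield measurable_cong_sets[OF P(2) refl] by (rule measurable_subfield)+
    from this[THEN measurable_compose, OF measurable_path] show "(\<lambda>z. V z s) \<in> borel_measurable P"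
      unfolding V_def by (rule borel_measurable_diff)
    show "integrable P (\<lambda>z. (norm (V z s))\<^sup>2)"
      unfolding Vn by (intro Bochner_Integration.integrable_sum Bochner_Integration.integrable_diff
          Bochner_Integration.integrable_add integrable_mult_right int)
    have "(LINT z|P. (norm (V z s))\<^sup>2) = (\<Sum>i\<in>UNIV. covariance P 0 0 $ Inl i $ Inl i +
        covariance P 0 0 $ Inr i $ Inr i - 2 * covariance P 0 0 $ Inl i $ Inr i)"
      unfolding Vn using int by (simp add: cov)
    then show "(LINT z|P. (norm (V z s))\<^sup>2) \<le> (\<Sum>i\<in>UNIV. covariance P 0 0 $ Inl i $ Inl i +
        covariance P 0 0 $ Inr i $ Inr i - 2 * covariance P 0 0 $ Inl i $ Inr i)" by simp
  qed
  moreover have "(LINT z|P. (norm (\<Sum>u\<in>b ` {..<n}. H u *v V z (t - u)))\<^sup>2) =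
      cross_term H (b ` {..<n}) (\<lambda>i j u. covariance P u 0 $ Inl i $ Inl j) +
      cross_term H (b ` {..<n}) (\<lambda>i j u. covariance P u 0 $ Inr i $ Inr j) -
      2 * cross_term H (b ` {..<n}) (\<lambda>i j u. covariance P u 0 $ Inl i $ Inr j)" for n
  proof -
    have "(\<Sum>u\<in>b ` {..<n}. H u *v V z (t - u)) = x n z - y n z" for z
      by (simp add: V_def x_def y_def mv.diff_right sum_subtractf)
    then have e: "(norm (\<Sum>u\<in>b ` {..<n}. H u *v V z (t - u)))\<^sup>2 = x n z \<bullet> x n z + y n z \<bullet> y n z - 2 * (x n z \<bullet> y n z)" for z
      by (simp add: power2_norm_eq_inner inner_diff_left inner_diff_right inner_commute)
    note exp = expectation_inner_partial_sums[where P = P and H = H and F = "b ` {..<n}" and t = t]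
    have xx: "integrable P (\<lambda>z. x n z \<bullet> x n z)" "(LINT z|P. x n z \<bullet> x n z) = cross_term H (b ` {..<n}) (\<lambda>i j u. covariance P u 0 $ Inl i $ Inl j)"
      unfolding x_def by (rule exp; simp only: comp int cov)+
    have yy: "integrable P (\<lambda>z. y n z \<bullet> y n z)" "(LINT z|P. y n z \<bullet> y n z) = cross_term H (b ` {..<n}) (\<lambda>i j u. covariance P u 0 $ Inr i $ Inr j)"
      unfolding y_def by (rule exp; simp only: comp int cov)+
    have xy: "integrable P (\<lambda>z. x n z \<bullet> y n z)" "(LINT z|P. x n z \<bullet> y n z) = cross_term H (b ` {..<n}) (\<lambda>i j u. covariance P u 0 $ Inl i $ Inr j)"
      unfolding x_def y_def by (rule exp; simp only: comp int cov)+
    show ?thesis unfolding e using xx yy xy by simp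
  qed
  ultimately show ?thesis by (simp add: V_def[abs_def])
qed

lemma psd_block_diag:
  fixes A C B :: "complex ^ 'n ^ 'n"
  assumes "psd (block_matrix A C B)" shows "psd A" "psd B"
proof -
  note J = joint_psd_block[OF assms, unfolded joint_psd_def, rule_format]
  have "cnj (block_matrix A C B $ l $ k) = block_matrix A C B $ k $ l" for k l
    using psdD(1)[OF assms] by (metis conj_transpose_nth)
  from this[of "Inl _" "Inl _"] this[of "Inr _" "Inr _"] have "A\<^sup>\<dagger> = A" "B\<^sup>\<dagger> = B"
    by (simp_all add: vec_eq_iff)
  then show "psd A" "psd B"
    using J[of _ 0] J[of 0] by (simp_all add: psd_cip)
qed

section \<open>Lower bound for the cross term of a coupling\<close>

context spectral_pair
begin

text \<open>Both densities must converge along the same subsequence, so the two differences are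
  treated as one function with values in a product space, dominated by the sum \<open>e\<close> of
  all entrywise errors.\<close>

lemma fejer_means_AE_subseq:
  defines "AN \<equiv> \<lambda>N \<theta>. \<chi> i j. fejer_mean N (fourier_coeff (\<lambda>\<theta>. A \<theta> $ i $ j)) \<theta>"
    and "BN \<equiv> \<lambda>N \<theta>. \<chi> i j. fejer_mean N (fourier_coeff (\<lambda>\<theta>. B \<theta> $ i $ j)) \<theta>"
  obtains r where "strict_mono r" "AE \<theta> in torus_measure. (\<lambda>N. AN (r N) \<theta>) \<longlonglongrightarrow> A \<theta>"
    "AE \<theta> in torus_measure. (\<lambda>N. BN (r N) \<theta>) \<longlonglongrightarrow> B \<theta>"
proof -
  define u where "u N \<theta> = (AN N \<theta> - A \<theta>, BN N \<theta> - B \<theta>)" for N \<theta>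
  define e where "e N \<theta> = (\<Sum>i\<in>UNIV. \<Sum>j\<in>UNIV. norm (AN N \<theta> $ i $ j - A \<theta> $ i $ j)) +
      (\<Sum>i\<in>UNIV. \<Sum>j\<in>UNIV. norm (BN N \<theta> $ i $ j - B \<theta> $ i $ j))" for N \<theta>
  have ei: "integrable torus_measure (\<lambda>\<theta>. norm (AN N \<theta> $ i $ j - A \<theta> $ i $ j))"
    "integrable torus_measure (\<lambda>\<theta>. norm (BN N \<theta> $ i $ j - B \<theta> $ i $ j))" for N i j
    unfolding AN_def BN_def vec_lambda_beta
    by (intro integrable_norm Bochner_Integration.integrable_diff integrable_fejer_mean
        integrable_entry[OF A_measurable A_entry] integrable_entry[OF B_measurable B_entry])+
  have ANm: "AN N \<in> borel_measurable torus_measure" and BNm: "BN N \<in> borel_measurable torus_measure" for N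
    unfolding AN_def BN_def by (intro measurable_vec_lambda measurable_fejer_mean)+
  have um: "u N \<in> borel_measurable torus_measure" for N
    unfolding u_def[abs_def] by (intro borel_measurable_Pair borel_measurable_diff ANm BNm A_measurable B_measurable)
  have le: "norm (u N \<theta>) \<le> e N \<theta>" for N \<theta>
  proof -
    have "norm (u N \<theta>) \<le> norm (AN N \<theta> - A \<theta>) + norm (BN N \<theta> - B \<theta>)"
      unfolding u_def by (rule norm_Pair_le)
    also have "\<dots> \<le> e N \<theta>"
      unfolding e_def using norm_matrix_le_sum[of "AN N \<theta> - A \<theta>"] norm_matrix_le_sum[of "BN N \<theta> - B \<theta>"] by simp
    finally show ?thesis .
  qed
  have eint: "integrable torus_measure (e N)" for N
    unfolding e_def[abs_def] by (intro Bochner_Integration.integrable_add Bochner_Integration.integrable_sum ei)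
  have ui: "integrable torus_measure (u N)" for N
    by (rule Bochner_Integration.integrable_bound[OF eint um])
      (rule AE_I2, unfold real_norm_def, rule order_trans[OF le abs_ge_self])
  have e0: "(\<lambda>N. LINT \<theta>|torus_measure. e N \<theta>) \<longlonglongrightarrow> 0"
  proof -
    have "(LINT \<theta>|torus_measure. e N \<theta>) = (\<Sum>i\<in>UNIV. \<Sum>j\<in>UNIV. LINT \<theta>|torus_measure. norm (AN N \<theta> $ i $ j - A \<theta> $ i $ j)) +
      (\<Sum>i\<in>UNIV. \<Sum>j\<in>UNIV. LINT \<theta>|torus_measure. norm (BN N \<theta> $ i $ j - B \<theta> $ i $ j))" for N
      unfolding e_def using ei by simp
    moreover have "(\<lambda>N. LINT \<theta>|torus_measure. norm (AN N \<theta> $ i $ j - A \<theta> $ i $ j)) \<longlonglongrightarrow> 0"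
      "(\<lambda>N. LINT \<theta>|torus_measure. norm (BN N \<theta> $ i $ j - B \<theta> $ i $ j)) \<longlonglongrightarrow> 0" for i j
      unfolding AN_def BN_def vec_lambda_beta
      by (rule fejer_mean_tendsto[OF measurable_matrix_nth[OF A_measurable] AE_I2[OF A_entry]],
          rule fejer_mean_tendsto[OF measurable_matrix_nth[OF B_measurable] AE_I2[OF B_entry]])
    ultimately show ?thesis
      by (simp only:) (intro tendsto_add_zero tendsto_null_sum)
  qed
  have "(\<lambda>N. LINT \<theta>|torus_measure. norm (u N \<theta>)) \<longlonglongrightarrow> 0"
  proof (rule tendsto_sandwich[OF _ _ tendsto_const e0])
    show "\<forall>\<^sub>F N in sequentially. (LINT \<theta>|torus_measure. norm (u N \<theta>)) \<le> (LINT \<theta>|torus_measure. e N \<theta>)"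
      using ui eint le by (intro always_eventually allI integral_mono) auto
  qed simp
  from tendsto_L1_AE_subseq[OF ui this] obtain r where r: "strict_mono r" "AE \<theta> in torus_measure. (\<lambda>N. u (r N) \<theta>) \<longlonglongrightarrow> 0"
    by blast
  have "AE \<theta> in torus_measure. (\<lambda>N. AN (r N) \<theta>) \<longlonglongrightarrow> A \<theta> \<and> (\<lambda>N. BN (r N) \<theta>) \<longlonglongrightarrow> B \<theta>"
    using r(2)
  proof eventually_elim
    case (elim \<theta>)
    from tendsto_fst[OF elim] tendsto_snd[OF elim] show ?case by (simp add: u_def LIM_zero_iff)
  qed
  then have "AE \<theta> in torus_measure. (\<lambda>N. AN (r N) \<theta>) \<longlonglongrightarrow> A \<theta>" "AE \<theta> in torus_measure. (\<lambda>N. BN (r N) \<theta>) \<longlonglongrightarrow> B \<theta>"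
    by (auto elim: eventually_mono)
  with r(1) that show thesis by blast
qed

text \<open>At a fixed truncation only finitely many covariances occur, so the damping weights may
  tend to 1 inside the sum. For each \<open>N\<close> the block \<open>CN\<close> of the periodogram
  is a genuine cross density, to which the pointwise bound applies; only the diagonal blocks have to
  converge as functions.\<close>

lemma cross_term_le:
  fixes P :: "(int ^ 'd \<Rightarrow> real ^ ('m + 'm)) measure"
  assumes P: "gaussian_stationary_law P"
    and cA: "\<And>u i j. complex_of_real (covariance P u 0 $ Inl i $ Inl j) = fourier_coeff (\<lambda>\<theta>. A \<theta> $ i $ j) u"
    and cB: "\<And>u i j. complex_of_real (covariance P u 0 $ Inr i $ Inr j) = fourier_coeff (\<lambda>\<theta>. B \<theta> $ i $ j) u"
  shows "cross_term H (lags n) (\<lambda>i j u. covariance P u 0 $ Inl i $ Inr j) \<le>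
    (LINT \<theta>|torus_measure. fidelity (A \<theta>) (partial_weight n \<theta>) (B \<theta>))"
proof -
  define AN where "AN N \<theta> = (\<chi> i j. fejer_mean N (fourier_coeff (\<lambda>\<theta>. A \<theta> $ i $ j)) \<theta>)" for N \<theta>
  define BN where "BN N \<theta> = (\<chi> i j. fejer_mean N (fourier_coeff (\<lambda>\<theta>. B \<theta> $ i $ j)) \<theta>)" for N \<theta>
  define CN :: "nat \<Rightarrow> real ^ 'd \<Rightarrow> complex ^ 'm ^ 'm"
    where "CN N \<theta> = (\<chi> i j. fejer_mean N (\<lambda>u. complex_of_real (covariance P u 0 $ Inl i $ Inr j)) \<theta>)" for N \<theta>
  let ?W = "partial_weight n"
  have block: "periodogram N P \<theta> = block_matrix (AN N \<theta>) (CN N \<theta>) (BN N \<theta>)" for N \<theta>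
  proof -
    have h: "periodogram N P \<theta> $ k $ l = cnj (periodogram N P \<theta> $ l $ k)" for k l
      using psdD(1)[OF psd_periodogram[OF P, of N \<theta>]] by (metis conj_transpose_nth)
    have p: "periodogram N P \<theta> $ k $ l = fejer_mean N (\<lambda>u. complex_of_real (covariance P u 0 $ k $ l)) \<theta>" for k l
      by (simp add: periodogram_def)
    have "periodogram N P \<theta> $ k $ l = block_matrix (AN N \<theta>) (CN N \<theta>) (BN N \<theta>) $ k $ l" for k l
    proof (cases k; cases l)
      fix i j
      show ?thesis if "k = Inl i" "l = Inl j" using that by (simp add: p AN_def cA)
      show ?thesis if "k = Inl i" "l = Inr j" using that by (simp add: p CN_def)
      show ?thesis if "k = Inr i" "l = Inl j" using that by (subst h) (simp add: p CN_def)
      show ?thesis if "k = Inr i" "l = Inr j" using that by (simp add: p BN_def cB)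
    qed
    then show ?thesis by (simp add: vec_eq_iff)
  qed
  have J: "joint_psd (AN N \<theta>) (CN N \<theta>) (BN N \<theta>)" and pA: "psd (AN N \<theta>)" and pB: "psd (BN N \<theta>)" for N \<theta>
    using psd_periodogram[OF P, of N \<theta>] unfolding block by (auto intro: joint_psd_block psd_block_diag)
  have eA: "norm (AN N \<theta> $ i $ j) \<le> C" and eB: "norm (BN N \<theta> $ i $ j) \<le> C" for N \<theta> i j
    unfolding AN_def BN_def vec_lambda_beta
    by (intro fejer_mean_norm_le measurable_matrix_nth A_measurable B_measurable AE_I2 A_entry B_entry)+
  \<comment> \<open>There is no cross density that would bound \<open>CN\<close>; joint positivity
    bounds it by the diagonal blocks.\<close>
  have eC: "norm (CN N \<theta> $ i $ j) \<le> C" for N \<theta> i j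
    using joint_psd_norm_entry_le[OF J, of N \<theta> i j] complex_Re_le_cmod[of "AN N \<theta> $ i $ i"]
      complex_Re_le_cmod[of "BN N \<theta> $ j $ j"] eA[of N \<theta> i i] eB[of N \<theta> j j] by argo
  have nA: "norm (AN N \<theta>) \<le> spectral_bound" and nB: "norm (BN N \<theta>) \<le> spectral_bound" and nC: "norm (CN N \<theta>) \<le> spectral_bound" for N \<theta>
    unfolding spectral_bound_def by (intro norm_matrix_le_entries eA eB eC)+
  have mA: "AN N \<in> borel_measurable torus_measure" and mB: "BN N \<in> borel_measurable torus_measure"
    and mC: "CN N \<in> borel_measurable torus_measure" for N
    unfolding AN_def[abs_def] BN_def[abs_def] CN_def[abs_def] by (intro measurable_vec_lambda measurable_fejer_mean)+
  note nW = norm_conj_transpose_mult_le[OF norm_transfer]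
  have fid_i: "integrable torus_measure (\<lambda>\<theta>. fidelity (AN N \<theta>) (?W \<theta>) (BN N \<theta>))" for N
    by (rule fidelity_integrable[OF mA partial_weight_measurable mB pA hermitian_conj_transpose_mult pB nA nB nW])
  have step: "cross_term H (lags n) (\<lambda>i j u. fejer_weight N u * covariance P u 0 $ Inl i $ Inr j) \<le>
      (LINT \<theta>|torus_measure. fidelity (AN N \<theta>) (?W \<theta>) (BN N \<theta>))" for N
  proof -
    have ti: "integrable torus_measure (\<lambda>\<theta>. trace (transfer n \<theta> ** CN N \<theta> ** (transfer n \<theta>)\<^sup>\<dagger>))"
    proof (rule integrable_torus_bounded)
      show "(\<lambda>\<theta>. trace (transfer n \<theta> ** CN N \<theta> ** (transfer n \<theta>)\<^sup>\<dagger>)) \<in> borel_measurable torus_measure"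
        by (intro measurable_trace measurable_matrix_mult measurable_conj_transpose transfer_measurable mC)
      show "norm (trace (transfer n \<theta> ** CN N \<theta> ** (transfer n \<theta>)\<^sup>\<dagger>)) \<le> real CARD('m) * (transfer_bound * spectral_bound * transfer_bound)" for \<theta>
        by (rule trace_bound[OF norm_transfer nC])
    qed
    have "cross_term H (lags n) (\<lambda>i j u. fejer_weight N u * covariance P u 0 $ Inl i $ Inr j) =
        Re (LINT \<theta>|torus_measure. trace (transfer n \<theta> ** CN N \<theta> ** (transfer n \<theta>)\<^sup>\<dagger>))"
    proof (rule cross_term_spectral)
      show "integrable torus_measure (\<lambda>\<theta>. CN N \<theta> $ i $ j)" for i j
        by (rule integrable_entry[OF mC eC])
      show "fejer_weight N u * covariance P u 0 $ Inl i $ Inr j = Re (fourier_coeff (\<lambda>\<theta>. CN N \<theta> $ i $ j) u)" for i j u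
        by (simp add: CN_def fourier_coeff_fejer_mean)
    qed
    also have "\<dots> = (LINT \<theta>|torus_measure. Re (trace (transfer n \<theta> ** CN N \<theta> ** (transfer n \<theta>)\<^sup>\<dagger>)))"
      by (rule integral_Re[OF ti, symmetric])
    also have "\<dots> \<le> (LINT \<theta>|torus_measure. fidelity (AN N \<theta>) (?W \<theta>) (BN N \<theta>))"
      using ti fid_i
      by (intro integral_mono integrable_Re) (auto simp: trace_congruence intro!: joint_psd_le_fidelity pA pB hermitian_conj_transpose_mult J)
    finally show ?thesis .
  qed
  obtain r where r: "strict_mono r" "AE \<theta> in torus_measure. (\<lambda>N. AN (r N) \<theta>) \<longlonglongrightarrow> A \<theta>"
    "AE \<theta> in torus_measure. (\<lambda>N. BN (r N) \<theta>) \<longlonglongrightarrow> B \<theta>"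
    using fejer_means_AE_subseq unfolding AN_def BN_def by blast
  have "(\<lambda>N. LINT \<theta>|torus_measure. fidelity (AN (r N) \<theta>) (?W \<theta>) (BN (r N) \<theta>))
      \<longlonglongrightarrow> (LINT \<theta>|torus_measure. fidelity (A \<theta>) (?W \<theta>) (B \<theta>))"
  proof (rule integral_dominated_convergence[where w = "\<lambda>_. (real CARD('m))\<^sup>2 * transfer_bound\<^sup>2 * spectral_bound"])
    show "(\<lambda>\<theta>. fidelity (A \<theta>) (?W \<theta>) (B \<theta>)) \<in> borel_measurable torus_measure"
      by (intro measurable_fidelity A_measurable B_measurable partial_weight_measurable psd_A psd_B hermitian_conj_transpose_mult)
    show "(\<lambda>\<theta>. fidelity (AN (r N) \<theta>) (?W \<theta>) (BN (r N) \<theta>)) \<in> borel_measurable torus_measure" for N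
      using fid_i by (rule borel_measurable_integrable)
    show "AE \<theta> in torus_measure. norm (fidelity (AN (r N) \<theta>) (?W \<theta>) (BN (r N) \<theta>)) \<le> (real CARD('m))\<^sup>2 * transfer_bound\<^sup>2 * spectral_bound" for N
    proof (rule AE_I2)
      fix \<theta>
      note h = pA[of "r N" \<theta>] hermitian_conj_transpose_mult[of "transfer n \<theta>"] pB[of "r N" \<theta>] nA[of "r N" \<theta>] nB[of "r N" \<theta>] nW[of n \<theta>]
      show "norm (fidelity (AN (r N) \<theta>) (?W \<theta>) (BN (r N) \<theta>)) \<le> (real CARD('m))\<^sup>2 * transfer_bound\<^sup>2 * spectral_bound"
        using fidelity_nonneg[OF h] fidelity_le[OF h] by simp
    qed
    show "AE \<theta> in torus_measure. (\<lambda>N. fidelity (AN (r N) \<theta>) (?W \<theta>) (BN (r N) \<theta>)) \<longlonglongrightarrow> fidelity (A \<theta>) (?W \<theta>) (B \<theta>)"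
      using r(2,3)
      by eventually_elim (intro fidelity_tendsto tendsto_const pA pB psd_A psd_B hermitian_conj_transpose_mult)
  qed simp
  moreover have "(\<lambda>N. cross_term H (lags n) (\<lambda>i j u. fejer_weight (r N) u * covariance P u 0 $ Inl i $ Inr j))
      \<longlonglongrightarrow> cross_term H (lags n) (\<lambda>i j u. 1 * covariance P u 0 $ Inl i $ Inr j)"
    unfolding cross_term_def
    by (intro tendsto_intros LIMSEQ_subseq_LIMSEQ[OF fejer_weight_tendsto r(1), unfolded comp_def])
  ultimately show ?thesis
    using step by (intro LIMSEQ_le[of "\<lambda>N. cross_term H (lags n) (\<lambda>i j u. fejer_weight (r N) u * covariance P u 0 $ Inl i $ Inr j)"]) auto
qed

end

section \<open>Near-optimal fields and the two cost estimates\<close>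

lemma sum_mult_group_snd:
  fixes f :: "'a \<times> 'k::finite \<Rightarrow> complex"
  assumes "finite F"
  shows "(\<Sum>p\<in>F. f p * g (snd p)) = (\<Sum>k\<in>UNIV. (\<Sum>p\<in>{p \<in> F. snd p = k}. f p) * g k)"
proof -
  have "(\<Sum>p\<in>F. f p * g (snd p)) = (\<Sum>k\<in>UNIV. \<Sum>p\<in>{p \<in> F. snd p = k}. f p * g (snd p))"
    using assms by (intro sum.group[symmetric]) auto
  also have "\<dots> = (\<Sum>k\<in>UNIV. \<Sum>p\<in>{p \<in> F. snd p = k}. f p * g k)"
    by (intro sum.cong refl) auto
  finally show ?thesis by (simp add: sum_distrib_right)
qed

text \<open>The form is the integral of the form of \<open>M\<close> at a vector \<open>w\<close>,
  whose component \<open>k\<close> is the exponential sum over the indices with second part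
  \<open>k\<close>. Real coefficients \<open>a\<close> see only the real part of the Hermitian
  kernel of Fourier coefficients.\<close>

lemma psd_kernel_spectral:
  fixes M :: "real ^ 'd \<Rightarrow> complex ^ 'k ^ 'k"
  assumes M: "\<And>\<theta>. psd (M \<theta>)" and int: "\<And>k l. integrable torus_measure (\<lambda>\<theta>. M \<theta> $ k $ l)"
  shows "psd_kernel (\<lambda>p q. Re (fourier_coeff (\<lambda>\<theta>. M \<theta> $ snd p $ snd q) (fst p - fst q)))"
  unfolding psd_kernel_def
proof (intro conjI allI impI)
  have herm: "cnj (M \<theta> $ l $ k) = M \<theta> $ k $ l" for \<theta> k l
    using psdD(1)[OF M] by (metis conj_transpose_nth)
  fix p q :: "(int ^ 'd) \<times> 'k"
  have "fourier_coeff (\<lambda>\<theta>. M \<theta> $ snd p $ snd q) (fst p - fst q) =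
      (LINT \<theta>|torus_measure. cnj (M \<theta> $ snd q $ snd p * cis (pairing \<theta> (fst q - fst p))))"
    unfolding fourier_coeff_def by (simp add: herm cis_cnj pairing_linear)
  also have "\<dots> = cnj (fourier_coeff (\<lambda>\<theta>. M \<theta> $ snd q $ snd p) (fst q - fst p))"
    unfolding fourier_coeff_def by (rule Bochner_Integration.integral_cnj)
  finally show "Re (fourier_coeff (\<lambda>\<theta>. M \<theta> $ snd p $ snd q) (fst p - fst q)) =
      Re (fourier_coeff (\<lambda>\<theta>. M \<theta> $ snd q $ snd p) (fst q - fst p))" by simp
next
  fix F :: "((int ^ 'd) \<times> 'k) set" and a assume F: "finite F"
  define w where "w \<theta> = (\<chi> k. \<Sum>p\<in>{p \<in> F. snd p = k}. complex_of_real (a p) * cis (- pairing \<theta> (fst p)))" for \<theta>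
  have e: "cip (w \<theta>) (M \<theta> *v w \<theta>) =
      (\<Sum>p\<in>F. \<Sum>q\<in>F. complex_of_real (a p * a q) * (M \<theta> $ snd p $ snd q * cis (pairing \<theta> (fst p - fst q))))" for \<theta>
  proof -
    let ?f = "\<lambda>p. complex_of_real (a p) * cis (pairing \<theta> (fst p))"
    let ?g = "\<lambda>q. complex_of_real (a q) * cis (- pairing \<theta> (fst q))"
    have "(\<Sum>p\<in>F. \<Sum>q\<in>F. complex_of_real (a p * a q) * (M \<theta> $ snd p $ snd q * cis (pairing \<theta> (fst p - fst q)))) =
        (\<Sum>p\<in>F. ?f p * (\<Sum>q\<in>F. ?g q * M \<theta> $ snd p $ snd q))"
    proof -
      have "cis (pairing \<theta> (s - t)) = cis (pairing \<theta> s) * cis (- pairing \<theta> t)" for s t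
        by (simp add: cis_mult pairing_linear)
      then show ?thesis by (simp add: sum_distrib_left mult_ac)
    qed
    also have "\<dots> = (\<Sum>k\<in>UNIV. (\<Sum>p\<in>{p \<in> F. snd p = k}. ?f p) * (\<Sum>q\<in>F. ?g q * M \<theta> $ k $ snd q))"
      by (rule sum_mult_group_snd[OF F])
    also have "\<dots> = (\<Sum>k\<in>UNIV. (\<Sum>p\<in>{p \<in> F. snd p = k}. ?f p) * (\<Sum>l\<in>UNIV. (\<Sum>q\<in>{q \<in> F. snd q = l}. ?g q) * M \<theta> $ k $ l))"
      by (rule sum.cong[OF refl], rule arg_cong[OF sum_mult_group_snd[OF F]])
    also have "\<dots> = cip (w \<theta>) (M \<theta> *v w \<theta>)"
      by (simp add: cip_def matrix_vector_mult_def w_def cis_cnj mult.commute)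
    finally show ?thesis by simp
  qed
  have i: "integrable torus_measure (\<lambda>\<theta>. complex_of_real (a p * a q) * (M \<theta> $ snd p $ snd q * cis (pairing \<theta> (fst p - fst q))))" for p q
    by (intro integrable_mult_right integrable_mult_cis int)
  have "(\<Sum>p\<in>F. \<Sum>q\<in>F. a p * a q * Re (fourier_coeff (\<lambda>\<theta>. M \<theta> $ snd p $ snd q) (fst p - fst q))) =
      Re (\<Sum>p\<in>F. \<Sum>q\<in>F. complex_of_real (a p * a q) * fourier_coeff (\<lambda>\<theta>. M \<theta> $ snd p $ snd q) (fst p - fst q))"
    by simp
  also have "(\<Sum>p\<in>F. \<Sum>q\<in>F. complex_of_real (a p * a q) * fourier_coeff (\<lambda>\<theta>. M \<theta> $ snd p $ snd q) (fst p - fst q)) =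
      (\<Sum>p\<in>F. \<Sum>q\<in>F. LINT \<theta>|torus_measure. complex_of_real (a p * a q) * (M \<theta> $ snd p $ snd q * cis (pairing \<theta> (fst p - fst q))))"
    by (simp only: fourier_coeff_def integral_mult_right_zero)
  also have "\<dots> = (\<Sum>p\<in>F. LINT \<theta>|torus_measure. (\<Sum>q\<in>F. complex_of_real (a p * a q) * (M \<theta> $ snd p $ snd q * cis (pairing \<theta> (fst p - fst q)))))"
    by (intro sum.cong refl Bochner_Integration.integral_sum[symmetric] i)
  also have "\<dots> = (LINT \<theta>|torus_measure. cip (w \<theta>) (M \<theta> *v w \<theta>))"
    unfolding e by (intro Bochner_Integration.integral_sum[symmetric] Bochner_Integration.integrable_sum i)
  also have "Re \<dots> = (LINT \<theta>|torus_measure. Re (cip (w \<theta>) (M \<theta> *v w \<theta>)))"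
    unfolding e by (intro integral_Re[symmetric] Bochner_Integration.integrable_sum i)
  also have "0 \<le> \<dots>" by (intro Bochner_Integration.integral_nonneg psdD(2) M)
  finally show "0 \<le> (\<Sum>p\<in>F. \<Sum>q\<in>F. a p * a q * Re (fourier_coeff (\<lambda>\<theta>. M \<theta> $ snd p $ snd q) (fst p - fst q)))" .
qed

context spectral_pair
begin

text \<open>Joint positivity bounds the entries of the cross spectrum \<open>X\<close> by
  \<open>C\<close>, so its Fourier coefficients exist. The loss of \<open>\<delta>\<close> times the
  dimension in its trace enters twice, as the cross term does.\<close>

lemma near_optimal_field:
  assumes \<delta>: "0 < \<delta>"
  obtains P :: "(int ^ 'd \<Rightarrow> real ^ ('m + 'm)) measure"
  where "gaussian_stationary_law P"
    "\<And>u i j. covariance P u 0 $ Inl i $ Inl j = Re (fourier_coeff (\<lambda>\<theta>. A \<theta> $ i $ j) u)"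
    "\<And>u i j. covariance P u 0 $ Inr i $ Inr j = Re (fourier_coeff (\<lambda>\<theta>. B \<theta> $ i $ j) u)"
    "(LINT z|P. (norm (convolution H (\<lambda>s. first_component z s - second_component z s) t))\<^sup>2)
      \<le> optimal_cost + 2 * (\<delta> * real CARD('m))"
proof -
  define X where "X \<theta> = optimal_cross \<delta> (A \<theta>) (weight H \<theta>) (B \<theta>)" for \<theta>
  define M where "M \<theta> = block_matrix (A \<theta>) (X \<theta>) (B \<theta>)" for \<theta>
  have J: "joint_psd (A \<theta>) (X \<theta>) (B \<theta>)" for \<theta>
    unfolding X_def by (rule joint_psd_optimal_cross[OF psd_A weight_hermitian psd_B \<delta>])
  have Xm: "X \<in> borel_measurable torus_measure"
    unfolding X_def[abs_def]
    by (intro measurable_optimal_cross A_measurable weight_measurable B_measurable psd_A weight_hermitian psd_B \<delta>)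
  have Xe: "norm (X \<theta> $ i $ j) \<le> C" for \<theta> i j
    using joint_psd_norm_entry_le[OF J, of \<theta> i j] A_diag[of \<theta> i] B_diag[of \<theta> j] by simp
  have Xn: "norm (X \<theta>) \<le> spectral_bound" for \<theta> unfolding spectral_bound_def by (rule norm_matrix_le_entries[OF Xe])
  note iA = integrable_entry[OF A_measurable A_entry] and iB = integrable_entry[OF B_measurable B_entry]
    and iX = integrable_entry[OF Xm Xe]
  have iM: "integrable torus_measure (\<lambda>\<theta>. M \<theta> $ k $ l)" for k l
    unfolding M_def by (cases k; cases l) (simp_all add: iA iB iX)
  have "psd_kernel (\<lambda>p q. Re (fourier_coeff (\<lambda>\<theta>. M \<theta> $ snd p $ snd q) (fst p - fst q)))"
    by (rule psd_kernel_spectral[OF _ iM]) (unfold M_def, rule psd_block[OF J psd_A psd_B])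
  then obtain P :: "(int ^ 'd \<Rightarrow> real ^ ('m + 'm)) measure" where P: "gaussian_stationary_law P"
    and cov: "\<And>s t k l. covariance P s t $ k $ l = Re (fourier_coeff (\<lambda>\<theta>. M \<theta> $ k $ l) (s - t))"
    by (rule gaussian_stationary_law_exists) auto
  have cA: "covariance P u 0 $ Inl i $ Inl j = Re (fourier_coeff (\<lambda>\<theta>. A \<theta> $ i $ j) u)"
    and cB: "covariance P u 0 $ Inr i $ Inr j = Re (fourier_coeff (\<lambda>\<theta>. B \<theta> $ i $ j) u)"
    and cX: "covariance P u 0 $ Inl i $ Inr j = Re (fourier_coeff (\<lambda>\<theta>. X \<theta> $ i $ j) u)" for u i j
    by (simp_all add: cov M_def)
  let ?I = "\<lambda>Y. Re (LINT \<theta>|torus_measure. trace (weight H \<theta> ** Y \<theta>))"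
  have lim: "(\<lambda>n. cross_term H (lags n) c) \<longlonglongrightarrow> ?I Y"
    if "Y \<in> borel_measurable torus_measure" "\<And>\<theta>. norm (Y \<theta>) \<le> spectral_bound" "\<And>i j. integrable torus_measure (\<lambda>\<theta>. Y \<theta> $ i $ j)"
      "\<And>i j u. c i j u = Re (fourier_coeff (\<lambda>\<theta>. Y \<theta> $ i $ j) u)" for c Y
    unfolding cross_term_spectral[OF that(3,4)]
    by (intro tendsto_Re trace_integral_tendsto(1)[OF that(1,2)])
  have "(\<lambda>n. cross_term H (lags n) (\<lambda>i j u. covariance P u 0 $ Inl i $ Inl j) +
      cross_term H (lags n) (\<lambda>i j u. covariance P u 0 $ Inr i $ Inr j) -
      2 * cross_term H (lags n) (\<lambda>i j u. covariance P u 0 $ Inl i $ Inr j)) \<longlonglongrightarrow> ?I A + ?I B - 2 * ?I X"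
    by (intro tendsto_intros lim A_measurable B_measurable Xm norm_A norm_B Xn iA iB iX cA cB cX)
  then have cost: "(LINT z|P. (norm (convolution H (\<lambda>s. first_component z s - second_component z s) t))\<^sup>2) = ?I A + ?I B - 2 * ?I X"
    using coupling_cost_tendsto[OF P H_summable bij_b] by (rule LIMSEQ_unique[rotated])
  have fi: "integrable torus_measure (\<lambda>\<theta>. fidelity (A \<theta>) (weight H \<theta>) (B \<theta>))"
    by (rule fidelity_integrable[OF A_measurable weight_measurable B_measurable psd_A weight_hermitian psd_B norm_A norm_B norm_weight])
  note ti = trace_integral_tendsto(2)[OF Xm Xn]
  have "(LINT \<theta>|torus_measure. fidelity (A \<theta>) (weight H \<theta>) (B \<theta>)) - \<delta> * real CARD('m) =
      (LINT \<theta>|(torus_measure :: (real ^ 'd) measure). fidelity (A \<theta>) (weight H \<theta>) (B \<theta>) - \<delta> * real CARD('m))"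
    using fi by simp
  also have "\<dots> \<le> (LINT \<theta>|torus_measure. Re (trace (weight H \<theta> ** X \<theta>)))"
  proof (rule integral_mono)
    show "fidelity (A \<theta>) (weight H \<theta>) (B \<theta>) - \<delta> * real CARD('m) \<le> Re (trace (weight H \<theta> ** X \<theta>))" for \<theta>
      unfolding X_def by (rule optimal_cross_ge[OF psd_A weight_hermitian psd_B \<delta>])
  qed (use fi ti in auto)
  also have "\<dots> = ?I X" by (rule integral_Re[OF ti])
  finally have "(LINT z|P. (norm (convolution H (\<lambda>s. first_component z s - second_component z s) t))\<^sup>2)
      \<le> optimal_cost + 2 * (\<delta> * real CARD('m))"
    unfolding cost optimal_cost_def by simp
  with P cA cB that show thesis by blast
qed

text \<open>The comparison is made at each truncation with the weight truncated in the same way;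
  both sides converge when the truncation is removed.\<close>

lemma coupling_cost_ge:
  fixes P :: "(int ^ 'd \<Rightarrow> real ^ ('m + 'm)) measure"
  assumes P: "gaussian_stationary_law P"
    and cA: "\<And>u i j. complex_of_real (covariance P u 0 $ Inl i $ Inl j) = fourier_coeff (\<lambda>\<theta>. A \<theta> $ i $ j) u"
    and cB: "\<And>u i j. complex_of_real (covariance P u 0 $ Inr i $ Inr j) = fourier_coeff (\<lambda>\<theta>. B \<theta> $ i $ j) u"
  shows "optimal_cost \<le> (LINT z|P. (norm (convolution H (\<lambda>s. first_component z s - second_component z s) t))\<^sup>2)"
proof (rule LIMSEQ_le[OF _ coupling_cost_tendsto[OF P H_summable bij_b]])
  let ?I = "\<lambda>Y n. Re (LINT \<theta>|torus_measure. trace (transfer n \<theta> ** Y \<theta> ** (transfer n \<theta>)\<^sup>\<dagger>))"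
  show "(\<lambda>n. ?I A n + ?I B n - 2 * (LINT \<theta>|torus_measure. fidelity (A \<theta>) (partial_weight n \<theta>) (B \<theta>))) \<longlonglongrightarrow> optimal_cost"
    unfolding optimal_cost_def
    by (intro tendsto_intros tendsto_Re trace_integral_tendsto(1)[OF A_measurable norm_A]
        trace_integral_tendsto(1)[OF B_measurable norm_B] fidelity_integral_tendsto)
  have Re_eq: "x = Re z" if "complex_of_real x = z" for x z using that by auto
  have "cross_term H (lags n) (\<lambda>i j u. covariance P u 0 $ Inl i $ Inl j) = ?I A n"
    "cross_term H (lags n) (\<lambda>i j u. covariance P u 0 $ Inr i $ Inr j) = ?I B n" for n
    by (rule cross_term_spectral[OF integrable_entry[OF A_measurable A_entry] Re_eq[OF cA]],
        rule cross_term_spectral[OF integrable_entry[OF B_measurable B_entry] Re_eq[OF cB]])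
  then show "\<exists>N. \<forall>n\<ge>N. ?I A n + ?I B n - 2 * (LINT \<theta>|torus_measure. fidelity (A \<theta>) (partial_weight n \<theta>) (B \<theta>))
      \<le> cross_term H (lags n) (\<lambda>i j u. covariance P u 0 $ Inl i $ Inl j) +
      cross_term H (lags n) (\<lambda>i j u. covariance P u 0 $ Inr i $ Inr j) -
      2 * cross_term H (lags n) (\<lambda>i j u. covariance P u 0 $ Inl i $ Inr j)"
    using cross_term_le[OF P cA cB] by simp
qed

end

section \<open>Identification of the infimum\<close>

lemma spectral_density_fourier:
  assumes S: "spectral_density P \<Phi>" and A: "A \<in> borel_measurable torus_measure" "AE \<theta> in torus_measure. A \<theta> = \<Phi> \<theta>"
  shows "complex_of_real (covariance P u 0 $ i $ j) = fourier_coeff (\<lambda>\<theta>. A \<theta> $ i $ j) u"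
proof -
  have "\<Phi> \<in> borel_measurable torus_measure" using S by (auto simp: spectral_density_def)
  then have "(LINT \<theta>|torus_measure. \<Phi> \<theta> $ i $ j * cis (pairing \<theta> u)) = (LINT \<theta>|torus_measure. A \<theta> $ i $ j * cis (pairing \<theta> u))"
    using A by (intro integral_cong_AE borel_measurable_times measurable_matrix_nth measurable_cis_pairing) (auto elim: eventually_mono)
  then show ?thesis using S by (simp add: spectral_density_def fourier_coeff_def)
qed

theorem proposition2:
  fixes px py :: "(int ^ 'd::finite \<Rightarrow> real ^ 'm::finite) measure"
    and \<Phi>x \<Phi>y :: "real ^ 'd \<Rightarrow> complex ^ 'm ^ 'm"
    and H :: "int ^ 'd \<Rightarrow> real ^ 'm ^ 'm"
    and t :: "int ^ 'd"
  assumes "gaussian_stationary_law px" and "gaussian_stationary_law py"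
    and "spectral_density px \<Phi>x" and "bounded_coercive \<Phi>x"
    and "spectral_density py \<Phi>y" and "bounded_coercive \<Phi>y"
    and "(\<lambda>s. norm (H s)) summable_on UNIV"
  shows "complex_of_real ((transport_dist H t px py)\<^sup>2) =
      trace (LINT \<theta>|torus_measure.
        weight H \<theta> ** \<Phi>x \<theta> + weight H \<theta> ** \<Phi>y \<theta>
          - 2 *\<^sub>R psd_sqrt (psd_sqrt (\<Phi>y \<theta>) ** weight H \<theta> ** \<Phi>x \<theta> ** weight H \<theta> ** psd_sqrt (\<Phi>y \<theta>))) \<and>
    transport_dist H t px py = weighted_hellinger_dist (weight H) \<Phi>x \<Phi>y"
proof -
  have px: "prob_space px" "sets px = sets path_space" "gaussian_field px" "zero_mean_field px" "stationary_field px"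
    using assms(1) by (auto simp: gaussian_stationary_law_def)
  have py: "prob_space py" "sets py = sets path_space" "gaussian_field py" "zero_mean_field py" "stationary_field py"
    using assms(2) by (auto simp: gaussian_stationary_law_def)
  have density: "\<Phi>x \<in> borel_measurable torus_measure" "AE \<theta> in torus_measure. psd (\<Phi>x \<theta>)"
      "\<Phi>y \<in> borel_measurable torus_measure" "AE \<theta> in torus_measure. psd (\<Phi>y \<theta>)"
    using assms(3,5) by (auto simp: spectral_density_def)
  obtain A Ca where A: "A \<in> borel_measurable torus_measure" "\<And>\<theta>. psd (A \<theta>)" "\<And>\<theta> i. Re (A \<theta> $ i $ i) \<le> Ca"
      "AE \<theta> in torus_measure. A \<theta> = \<Phi>x \<theta>"
    by (rule bounded_density_version[OF density(1,2) assms(4)]) blast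
  obtain B Cb where B: "B \<in> borel_measurable torus_measure" "\<And>\<theta>. psd (B \<theta>)" "\<And>\<theta> i. Re (B \<theta> $ i $ i) \<le> Cb"
      "AE \<theta> in torus_measure. B \<theta> = \<Phi>y \<theta>"
    by (rule bounded_density_version[OF density(3,4) assms(6)]) blast
  obtain b :: "nat \<Rightarrow> int ^ 'd" where b: "bij b" by (rule lattice_enumeration)
  interpret spectral_pair A B H b "max Ca Cb"
    using A B b assms(7) by unfold_locales (auto simp: le_max_iff_disj)
  note fx = spectral_density_fourier[OF assms(3) A(1,4)] and fy = spectral_density_fourier[OF assms(5) B(1,4)]
  let ?cost = "\<lambda>P :: (int ^ 'd \<Rightarrow> real ^ ('m + 'm)) measure.
    LINT z|P. (norm (convolution H (\<lambda>s. first_component z s - second_component z s) t))\<^sup>2"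
  have lower: "optimal_cost \<le> ?cost P" if "P \<in> couplings px py" for P
  proof -
    have P: "gaussian_stationary_law P" "distr P path_space first_component = px" "distr P path_space second_component = py"
      using that by (auto simp: couplings_def)
    have P': "prob_space P" "sets P = sets path_space" "gaussian_field P" "zero_mean_field P"
      using P(1) by (auto simp: gaussian_stationary_law_def)
    have "covariance P u 0 $ Inl i $ Inl j = covariance px u 0 $ i $ j"
      "covariance P u 0 $ Inr i $ Inr j = covariance py u 0 $ i $ j" for u i j
      using subfield_law(5)[OF P', of Inl u 0 i j] subfield_law(5)[OF P', of Inr u 0 i j] P(2,3)
      by (simp_all add: component_eq_subfield)
    then show ?thesis by (intro coupling_cost_ge[OF P(1)]) (simp_all add: fx fy)
  qed
  have upper: "\<exists>P\<in>couplings px py. ?cost P \<le> optimal_cost + 2 * (\<delta> * real CARD('m))" if delta: "0 < \<delta>" for \<delta>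
  proof -
    obtain P :: "(int ^ 'd \<Rightarrow> real ^ ('m + 'm)) measure" where P: "gaussian_stationary_law P"
      and cA: "\<And>u i j. covariance P u 0 $ Inl i $ Inl j = Re (fourier_coeff (\<lambda>\<theta>. A \<theta> $ i $ j) u)"
      and cB: "\<And>u i j. covariance P u 0 $ Inr i $ Inr j = Re (fourier_coeff (\<lambda>\<theta>. B \<theta> $ i $ j) u)"
      and cost: "?cost P \<le> optimal_cost + 2 * (\<delta> * real CARD('m))"
      using near_optimal_field[OF delta] by blast
    have P': "prob_space P" "sets P = sets path_space" "gaussian_field P" "zero_mean_field P" "stationary_field P"
      using P by (auto simp: gaussian_stationary_law_def)
    \<comment> \<open>Stationarity reduces every covariance to one with second site 0. Taking real
      parts loses nothing, since the coefficients of \<open>A\<close> and \<open>B\<close> are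
      covariances of \<open>px\<close> and \<open>py\<close> and hence real.\<close>
    have cov: "covariance P s u $ Inl i $ Inl j = covariance px s u $ i $ j"
      "covariance P s u $ Inr i $ Inr j = covariance py s u $ i $ j" for s u i j
      by (simp_all only: stationary_covariance[OF P'(5), of s u] stationary_covariance[OF px(5), of s u]
          stationary_covariance[OF py(5), of s u] cA cB fx[symmetric] fy[symmetric] Re_complex_of_real)
    have "distr P path_space first_component = px"
      unfolding component_eq_subfield
      by (rule gaussian_field_unique[OF subfield_law(1)[OF P'(1-4)] px(1) subfield_law(2)[OF P'(1-4)] px(2)
            subfield_law(3)[OF P'(1-4)] subfield_law(4)[OF P'(1-4)] px(3,4)])
        (simp add: vec_eq_iff subfield_law(5)[OF P'(1-4)] cov)
    moreover have "distr P path_space second_component = py"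
      unfolding component_eq_subfield
      by (rule gaussian_field_unique[OF subfield_law(1)[OF P'(1-4)] py(1) subfield_law(2)[OF P'(1-4)] py(2)
            subfield_law(3)[OF P'(1-4)] subfield_law(4)[OF P'(1-4)] py(3,4)])
        (simp add: vec_eq_iff subfield_law(5)[OF P'(1-4)] cov)
    ultimately show ?thesis using P cost by (auto simp: couplings_def)
  qed
  \<comment> \<open>The real infimum is governed by its order rules only on a nonempty set that is
    bounded below.\<close>
  have ne: "couplings px py \<noteq> {}" using upper[of 1] by auto
  have bdd: "bdd_below (?cost ` couplings px py)" by (rule bdd_belowI2[of _ 0]) simp
  have INF: "(INF P\<in>couplings px py. ?cost P) = optimal_cost"
  proof (rule antisym)
    show "optimal_cost \<le> (INF P\<in>couplings px py. ?cost P)"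
      by (rule cINF_greatest[OF ne lower])
    show "(INF P\<in>couplings px py. ?cost P) \<le> optimal_cost"
    proof (rule field_le_epsilon)
      fix e :: real assume "0 < e"
      \<comment> \<open>With this value of \<open>\<delta>\<close> the excess
        \<open>2 * (\<delta> * real CARD('m))\<close> equals \<open>e\<close>.\<close>
      then have "0 < e / (2 * real CARD('m))" by simp
      from upper[OF this] obtain P where P: "P \<in> couplings px py" "?cost P \<le> optimal_cost + e" by auto
      show "(INF P\<in>couplings px py. ?cost P) \<le> optimal_cost + e"
        by (rule order_trans[OF cINF_lower[OF bdd P(1)] P(2)])
    qed
  qed
  \<comment> \<open>Nonnegativity is read off from the infimum of nonnegative costs; squaring the
    square root in \<open>transport_dist\<close> requires it.\<close>
  have "0 \<le> optimal_cost" unfolding INF[symmetric] by (rule cINF_greatest[OF ne]) simp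
  then have sq: "(transport_dist H t px py)\<^sup>2 = optimal_cost" "0 \<le> transport_dist H t px py"
    unfolding transport_dist_def INF by simp_all
  define R where "R X Y \<theta> = weight H \<theta> ** X \<theta> + weight H \<theta> ** Y \<theta>
    - 2 *\<^sub>R psd_sqrt (psd_sqrt (Y \<theta>) ** weight H \<theta> ** X \<theta> ** weight H \<theta> ** psd_sqrt (Y \<theta>))"
    for X Y :: "real ^ 'd \<Rightarrow> complex ^ 'm ^ 'm" and \<theta>
  \<comment> \<open>Where the versions agree with the densities the integrands are the same term,
    whatever \<open>psd_sqrt\<close> does elsewhere.\<close>
  have ae: "AE \<theta> in torus_measure. R A B \<theta> = R \<Phi>x \<Phi>y \<theta>"
    using A(4) B(4) by eventually_elim (simp add: R_def)
  have Rm: "R A B \<in> borel_measurable torus_measure"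
    unfolding R_def[abs_def]
    by (intro borel_measurable_add borel_measurable_diff borel_measurable_scaleR borel_measurable_const measurable_matrix_mult
        weight_measurable A B measurable_psd_sqrt measurable_fidelity_arg psd_fidelity_arg weight_hermitian)
  have "(LINT \<theta>|torus_measure. R A B \<theta>) = (LINT \<theta>|torus_measure. R \<Phi>x \<Phi>y \<theta>)"
    by (rule integral_cong_AE[OF Rm measurable_torus_AE[OF Rm ae] ae])
  then have main: "complex_of_real optimal_cost = trace (LINT \<theta>|torus_measure. R \<Phi>x \<Phi>y \<theta>)"
    using optimal_cost_eq unfolding R_def by simp
  moreover have "transport_dist H t px py = weighted_hellinger_dist (weight H) \<Phi>x \<Phi>y"
  proof -
    have "weighted_hellinger_dist (weight H) \<Phi>x \<Phi>y = sqrt (Re (complex_of_real optimal_cost))"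
      unfolding main weighted_hellinger_dist_def R_def ..
    then show ?thesis using sq by (metis Re_complex_of_real real_sqrt_unique)
  qed
  ultimately show ?thesis unfolding sq(1) R_def by blast
qed

end
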